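(* Let $X$ be a finite pure simplicial complex of dimension $n$, let $0\le k\le n-1$, and suppose that $X$ is $(k+1)$-gallery connected and $H^k(X,\mathbb{R})=0$. Let $\mathcal{A}$ be a set of $k$-dimensional polytope boundaries in $X$ with $|\mathcal A|\ge 2$, and let $l,\lambda\in\mathbb{R}$, $l,\lambda>0$, and $s\in\mathbb{N}$ be constants such that $$\inf_{\tau\in X^{(k)}}\frac{m(\tau)}{|\{S\in\mathcal{A}:\tau\subset S\}|}\ge l,\qquad \sup_{S\in\mathcal{A}}|\{\tau\in X^{(k)}:\tau\subset S\}|\le s,\qquad Spec(\Delta_k^+)\setminus\{0\}\subset[\lambda,\infty).$$ Denote $$D=\max_{\tau\in X^{(k)}}|\{\sigma\in X^{(k+1)}:\tau\subset\sigma\}|,$$ and assume $s>1$ and $Dk>1$ (so that the expression below is defined). Let $\mathcal{T}$ be the set of boundaries of $(k+1)$-simplices of $X$ and $\mathcal{S}=\mathcal{A}\cup\mathcal{T}$. Then for every Hilbert space $H$ and every map $f:X\to H$ which is admissible with respect to $\mathcal{S}$, $$distor_{k,\mathcal{S}}(f)\ \ge\ \left(\frac{\ln\left(\frac{\lfloor |\mathcal{A}|/2\rfloor}{|X^{(k)}|}\right)-s\ln(2)}{(s-1)\ln(Dk)}-1\right)\left(\sqrt{\frac{(n+1)!\,s}{2\,(k+2)!\,l\,\lambda}\,\frac{|X^{(n)}|}{|\mathcal{A}|}}\right)^{-1}.$$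
   Context: Complexes. $X$ is pure of dimension $n$ if every simplex is a face of an $n$-simplex. $X^{(i)}$ is the set of $i$-simplices; $\Sigma(i)$ is the set of ordered $i$-simplices $(v_0,\dots,v_i)$. $X$ also denotes the geometric realization. $C^i(X,\mathbb{R})$ is the space of functions $\phi:\Sigma(i)\to\mathbb{R}$ that are antisymmetric: $\phi((v_0,\dots,v_i))=sign(\pi)\,\phi((v_{\pi(0)},\dots,v_{\pi(i)}))$ for every permutation $\pi$. For $\tau\in X^{(i)}$, $m(\tau)=(n-i)!\,|\{\sigma\in X^{(n)}:\tau\subseteq\sigma\}|$. The inner product on $C^i(X,\mathbb{R})$ is $\langle\phi,\psi\rangle=\sum_{\sigma\in\Sigma(i)}\frac{m(\sigma)}{(i+1)!}\phi(\sigma)\psi(\sigma)$. The differential is $(d_i\phi)((v_0,\dots,v_{i+1}))=\sum_{j=0}^{i+1}(-1)^j\phi((v_0,\dots,\widehat{v_j},\dots,v_{i+1}))$; $H^i(X,\mathbb{R})=\ker d_i/\mathrm{im}\,d_{i-1}$, where for $i=0$ one uses $C^{-1}(X,\mathbb{R})=\mathbb{R}$ and $d_{-1}$ sends a number to the corresponding constant function (reduced cohomology). $\Delta_i^+=d_i^*d_i$, with $d_i^*$ the adjoint for these inner products, and $Spec$ is its spectrum. Galleries. A $(k+1)$-gallery is a sequence $\sigma_1,\dots,\sigma_r$ ($r\ge1$) of $(k+1)$-simplices of $X$ such that $\sigma_i\cap\sigma_{i+1}$ is a $k$-simplex for $1\le i\le r-1$; it connects $\eta_0,\eta_1\in X^{(k)}$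 if $\eta_0\subset\sigma_1$, $\eta_1\subset\sigma_r$. $X$ is $(k+1)$-gallery connected if every two $k$-simplices are connected by a $(k+1)$-gallery. For a set $S$ of $k$-simplices, $F\subseteq X^{(k+1)}$ is a $(k+1)$-gallery filling of $S$ if every two elements of $S$ are connected by a $(k+1)$-gallery with all simplices in $F$; $Fill_{k+1}(S)$ is the minimal cardinality of a $(k+1)$-gallery filling of $S$. Polytope boundaries. A $k$-dimensional polytope boundary is an abstract $k$-dimensional simplicial complex $S$ isomorphic to the boundary complex of a convex $(k+1)$-dimensional polytope $P_S\subset\mathbb{R}^{k+1}$; a $k$-dimensional polytope boundary in $X$ is a subcomplex of $X$ of this type (identified with its set of $k$-simplices when speaking of $Fill_{k+1}(S)$). Choosing $P_S$ includes choosing an identification, affine on each simplex, of $S$ with $\partial P_S$. The standard orientation of $\mathbb{R}^{k+1}$ orients $P_S$ and hence all $k$-simplices of $S$; $\Sigma_{S,+}(k)$ denotes the set of these oriented $k$-simplices (one representative for each). The boundary $\partial\sigma$ of a $(k+1)$-simplex $\sigma$ (the union of its $k$-faces) is a $k$-dimensional polytope boundary. In the first condition a quotient with zero denominator is $+\infty$. Admissible maps. A map $f:S\to H$ is admissible (for a choice of $P_S$) if there are an open neighbourhood $U\subset\mathbb{R}^{k+1}$ of $P_S$ and an extension $\widetilde f:U\to H$ of $f$ which is a smooth map into a finite-dimensional subspace $\mathbb{R}^m\subset H$. $f:X\to H$ is admissible with respect to $\mathcal{S}$ if, for any choice of $\{P_S:S\in\mathcal{S}\}$, the restriction of $f$ to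 every $S\in\mathcal{S}$ is admissible, with $\mathbb{R}^m$ a common finite-dimensional subspace containing all the images. With $(x_1,\dots,x_m)$ orthonormal coordinates on $\mathbb{R}^m$, $$Fill_{k+1,H}(f(S))=EnVol_{proj}(f(S))=\sqrt{\sum_{1\le i_1<\dots<i_{k+1}\le m}\Big(\sum_{\tau\in\Sigma_{S,+}(k)}\int_{f(\tau)}x_{i_1}\,dx_{i_2}\wedge\dots\wedge dx_{i_{k+1}}\Big)^2},$$ where $\int_{f(\tau)}\omega$ means the integral of $f^*\omega$ over the oriented simplex $\tau$ (for $k=0$, $S=\{v_0,v_1\}$, this is the distance $\|f(v_1)-f(v_0)\|$). Distortion. $$distor_{k,\mathcal{S}}(f)=\sup_{S\in\mathcal{S}}\frac{Fill_{k+1,H}(f(S))}{Fill_{k+1}(S)}\cdot\sup_{S\in\mathcal{S}}\frac{Fill_{k+1}(S)}{Fill_{k+1,H}(f(S))},$$ taken to be $\infty$ if $Fill_{k+1,H}(f(S))=0$ for some $S\in\mathcal{S}$. *)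

theory Defs
  imports "HOL-Analysis.Analysis"
begin

section \<open>Simplicial complexes and weighted cochains\<close>

text \<open>Simplices are nonempty finite vertex sets; the empty simplex is not part of a complex.\<close>

definition abstract_complex :: "'v set set \<Rightarrow> bool" where
  "abstract_complex X \<longleftrightarrow>
     (\<forall>\<sigma>\<in>X. finite \<sigma> \<and> \<sigma> \<noteq> {}) \<and> (\<forall>\<sigma>\<in>X. \<forall>\<tau>. \<tau> \<subseteq> \<sigma> \<and> \<tau> \<noteq> {} \<longrightarrow> \<tau> \<in> X)"

definition simplices :: "nat \<Rightarrow> 'v set set \<Rightarrow> 'v set set" where
  "simplices i X = {\<sigma> \<in> X. card \<sigma> = Suc i}"

definition pure_complex :: "nat \<Rightarrow> 'v set set \<Rightarrow> bool" where
  "pure_complex n X \<longleftrightarrow>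
     abstract_complex X \<and> X \<noteq> {} \<and> (\<forall>\<tau>\<in>X. \<exists>\<sigma>\<in>simplices n X. \<tau> \<subseteq> \<sigma>)"

definition ordered_simplices :: "nat \<Rightarrow> 'v set set \<Rightarrow> 'v list set" where
  "ordered_simplices i X = {vs. distinct vs \<and> length vs = Suc i \<and> set vs \<in> X}"

text \<open>A cochain is a function on ordered simplices, extended by \<open>0\<close> to all other lists.\<close>

definition cochains :: "nat \<Rightarrow> 'v set set \<Rightarrow> ('v list \<Rightarrow> real) set" where
  "cochains i X = {\<phi>.
     (\<forall>vs. vs \<notin> ordered_simplices i X \<longrightarrow> \<phi> vs = 0) \<and>
     (\<forall>vs\<in>ordered_simplices i X. \<forall>\<pi>. \<pi> permutes {..<Suc i} \<longrightarrow>
        \<phi> (permute_list \<pi> vs) = of_int (sign \<pi>) * \<phi> vs)}"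

definition simplex_weight :: "nat \<Rightarrow> 'v set set \<Rightarrow> 'v set \<Rightarrow> real" where
  "simplex_weight n X \<tau> = fact (n - (card \<tau> - 1)) * real (card {\<sigma> \<in> simplices n X. \<tau> \<subseteq> \<sigma>})"

definition cochain_inner ::
    "nat \<Rightarrow> 'v set set \<Rightarrow> nat \<Rightarrow> ('v list \<Rightarrow> real) \<Rightarrow> ('v list \<Rightarrow> real) \<Rightarrow> real" where
  "cochain_inner n X i \<phi> \<psi> =
     (\<Sum>vs\<in>ordered_simplices i X. simplex_weight n X (set vs) / fact (i + 1) * \<phi> vs * \<psi> vs)"

definition coboundary :: "'v set set \<Rightarrow> nat \<Rightarrow> ('v list \<Rightarrow> real) \<Rightarrow> 'v list \<Rightarrow> real" where
  "coboundary X i \<phi> = (\<lambda>vs. if vs \<in> ordered_simplices (Suc i) X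
     then \<Sum>j\<le>Suc i. (-1) ^ j * \<phi> (take j vs @ drop (Suc j) vs) else 0)"

text \<open>Reduced cohomology: the image of \<open>d\<^bsub>-1\<^esub>\<close> consists of the constant \<open>0\<close>-cochains.\<close>

definition coboundaries :: "'v set set \<Rightarrow> nat \<Rightarrow> ('v list \<Rightarrow> real) set" where
  "coboundaries X i =
     (case i of
        0 \<Rightarrow> range (\<lambda>c vs. if vs \<in> ordered_simplices 0 X then c else 0)
      | Suc j \<Rightarrow> coboundary X j ` cochains j X)"

definition cocycles :: "'v set set \<Rightarrow> nat \<Rightarrow> ('v list \<Rightarrow> real) set" where
  "cocycles X i = {\<phi> \<in> cochains i X. coboundary X i \<phi> = (\<lambda>_. 0)}"

definition cohomology_vanishes :: "'v set set \<Rightarrow> nat \<Rightarrow> bool" where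
  "cohomology_vanishes X i \<longleftrightarrow> cocycles X i = coboundaries X i"

definition coboundary_adjoint ::
    "nat \<Rightarrow> 'v set set \<Rightarrow> nat \<Rightarrow> ('v list \<Rightarrow> real) \<Rightarrow> 'v list \<Rightarrow> real" where
  "coboundary_adjoint n X i \<psi> = (THE \<theta>. \<theta> \<in> cochains i X \<and>
     (\<forall>\<phi>\<in>cochains i X.
        cochain_inner n X (Suc i) (coboundary X i \<phi>) \<psi> = cochain_inner n X i \<phi> \<theta>))"

definition up_laplacian ::
    "nat \<Rightarrow> 'v set set \<Rightarrow> nat \<Rightarrow> ('v list \<Rightarrow> real) \<Rightarrow> 'v list \<Rightarrow> real" where
  "up_laplacian n X i \<phi> = coboundary_adjoint n X i (coboundary X i \<phi>)"

text \<open>The cochain space of a finite complex is finite-dimensional and the operator is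
  self-adjoint, so the spectrum is the set of real eigenvalues.\<close>

definition up_spectrum :: "nat \<Rightarrow> 'v set set \<Rightarrow> nat \<Rightarrow> real set" where
  "up_spectrum n X i = {\<mu>. \<exists>\<phi>\<in>cochains i X. \<phi> \<noteq> (\<lambda>_. 0) \<and>
     up_laplacian n X i \<phi> = (\<lambda>vs. \<mu> * \<phi> vs)}"


section \<open>Galleries of \<open>(k+1)\<close>-simplices\<close>

definition gallery :: "'v set set \<Rightarrow> nat \<Rightarrow> 'v set list \<Rightarrow> bool" where
  "gallery X k gs \<longleftrightarrow> gs \<noteq> [] \<and> set gs \<subseteq> simplices (k + 1) X \<and>
     (\<forall>i. Suc i < length gs \<longrightarrow> gs ! i \<inter> gs ! Suc i \<in> simplices k X)"

definition gallery_connects :: "'v set list \<Rightarrow> 'v set \<Rightarrow> 'v set \<Rightarrow> bool" where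
  "gallery_connects gs \<eta>\<^sub>0 \<eta>\<^sub>1 \<longleftrightarrow> \<eta>\<^sub>0 \<subseteq> hd gs \<and> \<eta>\<^sub>1 \<subseteq> last gs"

definition gallery_connected :: "'v set set \<Rightarrow> nat \<Rightarrow> bool" where
  "gallery_connected X k \<longleftrightarrow>
     (\<forall>\<eta>\<^sub>0\<in>simplices k X. \<forall>\<eta>\<^sub>1\<in>simplices k X. \<exists>gs. gallery X k gs \<and> gallery_connects gs \<eta>\<^sub>0 \<eta>\<^sub>1)"

definition gallery_filling :: "'v set set \<Rightarrow> nat \<Rightarrow> 'v set set \<Rightarrow> 'v set set \<Rightarrow> bool" where
  "gallery_filling X k S F \<longleftrightarrow> F \<subseteq> simplices (k + 1) X \<and>
     (\<forall>\<eta>\<^sub>0\<in>simplices k S. \<forall>\<eta>\<^sub>1\<in>simplices k S.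
        \<exists>gs. gallery X k gs \<and> set gs \<subseteq> F \<and> gallery_connects gs \<eta>\<^sub>0 \<eta>\<^sub>1)"

definition gallery_fill :: "'v set set \<Rightarrow> nat \<Rightarrow> 'v set set \<Rightarrow> nat" where
  "gallery_fill X k S = (LEAST c. \<exists>F. gallery_filling X k S F \<and> card F = c)"


section \<open>Polytope boundaries\<close>

text \<open>The Euclidean space \<open>\<real>\<^bsup>k+1\<^esup>\<close> is \<open>real ^ 'd\<close> with \<open>CARD('d) = k + 1\<close>; the linear order on
  the index type is only used to fix the standard orientation.

  A choice of the polytope together with an identification of \<open>S\<close> with its boundary complex
  is given by a map \<open>r\<close> on the vertices: the polytope is the convex hull of the image, and the
  identification is the affine extension of \<open>r\<close> to every simplex.\<close>

definition polytope_of :: "'v set set \<Rightarrow> ('v \<Rightarrow> real ^ 'd) \<Rightarrow> (real ^ 'd) set" where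
  "polytope_of S r = convex hull (r ` \<Union>S)"

definition polytope_realisation :: "'v set set \<Rightarrow> ('v \<Rightarrow> real ^ 'd) \<Rightarrow> bool" where
  "polytope_realisation S r \<longleftrightarrow>
     polytope (polytope_of S r) \<and> interior (polytope_of S r) \<noteq> {} \<and>
     inj_on r (\<Union>S) \<and> (\<forall>\<sigma>\<in>S. \<not> affine_dependent (r ` \<sigma>)) \<and>
     (\<lambda>\<sigma>. convex hull (r ` \<sigma>)) ` S =
       {F. F face_of polytope_of S r \<and> F \<noteq> {} \<and> F \<noteq> polytope_of S r}"

definition polytope_boundary_in :: "'d::finite itself \<Rightarrow> 'v set set \<Rightarrow> 'v set set \<Rightarrow> bool" where
  "polytope_boundary_in D X S \<longleftrightarrow> S \<subseteq> X \<and> abstract_complex S \<and>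
     (\<exists>r :: 'v \<Rightarrow> real ^ 'd::finite. polytope_realisation S r)"

definition simplex_boundary :: "'v set \<Rightarrow> 'v set set" where
  "simplex_boundary \<sigma> = {\<tau>. \<tau> \<subset> \<sigma> \<and> \<tau> \<noteq> {}}"

text \<open>Boundary orientation, outward normal first: for a facet with ordered vertices
  \<open>v\<^sub>0, \<dots>, v\<^sub>k\<close> and an interior point \<open>c\<close>, the vector \<open>v\<^sub>0 - c\<close> points outwards, and
  \<open>det (v\<^sub>0 - c, v\<^sub>1 - v\<^sub>0, \<dots>, v\<^sub>k - v\<^sub>0) = det (v\<^sub>0 - c, v\<^sub>1 - c, \<dots>, v\<^sub>k - c)\<close>.
  The sign does not depend on \<open>c\<close>.\<close>

definition orientation_sign ::
    "'v set set \<Rightarrow> ('v \<Rightarrow> real ^ 'd::{finite,linorder}) \<Rightarrow> 'v list \<Rightarrow> real" where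
  "orientation_sign S r vs =
     (let c = (SOME c. c \<in> interior (polytope_of S r))
      in sgn (det ((\<chi> i. r (vs ! card {j. j < i}) - c) :: real ^ 'd::{finite,linorder} ^ 'd::{finite,linorder})))"


section \<open>Geometric realisation and integration over simplices\<close>

text \<open>Points of the geometric realisation are given by barycentric coordinates.\<close>

definition geometric_realisation :: "'v set set \<Rightarrow> ('v \<Rightarrow> real) set" where
  "geometric_realisation X =
     {t. (\<forall>v. 0 \<le> t v) \<and> {v. t v \<noteq> 0} \<in> X \<and> (\<Sum>v | t v \<noteq> 0. t v) = 1}"

definition open_simplex :: "nat \<Rightarrow> (nat \<Rightarrow> real) set" where
  "open_simplex k =
     {t \<in> extensional {..<k}. (\<forall>j<k. 0 < t j) \<and> (\<Sum>j<k. t j) < 1}"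

text \<open>The affine chart of the ordered simplex \<open>(v\<^sub>0, \<dots>, v\<^sub>k)\<close>, that is
  \<open>t \<mapsto> v\<^sub>0 + (\<Sum>j<k. t\<^sub>j (v\<^bsub>j+1\<^esub> - v\<^sub>0))\<close>.\<close>

definition simplex_chart :: "nat \<Rightarrow> 'v list \<Rightarrow> (nat \<Rightarrow> real) \<Rightarrow> 'v \<Rightarrow> real" where
  "simplex_chart k vs t = (\<lambda>v. \<Sum>j\<le>k. if vs ! j = v
     then (case j of 0 \<Rightarrow> 1 - (\<Sum>i<k. t i) | Suc i \<Rightarrow> t i) else 0)"

text \<open>The integral over the ordered simplex \<open>vs\<close> of the pullback under \<open>f\<close> of
  \<open>x\<^bsub>is ! 0\<^esub> dx\<^bsub>is ! 1\<^esub> \<and> \<dots> \<and> dx\<^bsub>is ! k\<^esub>\<close>, where \<open>x\<^sub>i\<close> is the coordinate along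
  \<open>bs ! i\<close>. The sum over permutations is the Jacobian determinant in the chart.
  For \<open>k = 0\<close> this is evaluation at the vertex.\<close>

definition form_integral ::
    "'h::real_inner list \<Rightarrow> nat \<Rightarrow> (('v \<Rightarrow> real) \<Rightarrow> 'h) \<Rightarrow> nat list \<Rightarrow> 'v list \<Rightarrow> real" where
  "form_integral bs k f is vs =
     (let x = (\<lambda>a t. bs ! (is ! a) \<bullet> f (simplex_chart k vs t));
          pd = (\<lambda>b a t. deriv (\<lambda>u. x a (t(b := u))) (t b))
      in set_lebesgue_integral (PiM {..<k} (\<lambda>_. lborel)) (open_simplex k)
           (\<lambda>t. x 0 t * (\<Sum>\<pi> | \<pi> permutes {..<k}.
              of_int (sign \<pi>) * (\<Prod>a<k. pd (\<pi> a) (Suc a) t))))"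

definition orthonormal_list :: "'h::real_inner list \<Rightarrow> bool" where
  "orthonormal_list bs \<longleftrightarrow>
     (\<forall>i<length bs. \<forall>j<length bs. bs ! i \<bullet> bs ! j = (if i = j then 1 else 0))"

text \<open>The oriented facets are represented by an arbitrary ordering together with a sign (a
  positively oriented ordering need not exist for \<open>k = 0\<close>); the product of the sign and the
  integral does not depend on the ordering.\<close>

definition hilbert_fill ::
    "'h::real_inner list \<Rightarrow> ('v \<Rightarrow> real ^ 'd::{finite,linorder}) \<Rightarrow> nat \<Rightarrow>
     (('v \<Rightarrow> real) \<Rightarrow> 'h) \<Rightarrow> 'v set set \<Rightarrow> real" where
  "hilbert_fill bs r k f S =
     sqrt (\<Sum>is | length is = k + 1 \<and> sorted_wrt (<) is \<and> set is \<subseteq> {..<length bs}.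
       (\<Sum>\<tau>\<in>simplices k S.
          let vs = (SOME vs. distinct vs \<and> set vs = \<tau>)
          in orientation_sign S r vs * form_integral bs k f is vs)\<^sup>2)"


section \<open>Admissible maps and distortion\<close>

primrec cont_diff_on ::
    "nat \<Rightarrow> 'a::real_normed_vector set \<Rightarrow> ('a \<Rightarrow> 'b::real_normed_vector) \<Rightarrow> bool" where
  "cont_diff_on 0 U g \<longleftrightarrow> continuous_on U g"
| "cont_diff_on (Suc q) U g \<longleftrightarrow>
     (\<exists>g'. (\<forall>x\<in>U. (g has_derivative g' x) (at x)) \<and> (\<forall>h. cont_diff_on q U (\<lambda>x. g' x h)))"

definition smooth_on :: "'a::real_normed_vector set \<Rightarrow> ('a \<Rightarrow> 'b::real_normed_vector) \<Rightarrow> bool" where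
  "smooth_on U g \<longleftrightarrow> (\<forall>q. cont_diff_on q U g)"

definition admissible_on ::
    "'h::real_normed_vector set \<Rightarrow> ('v \<Rightarrow> real ^ 'd) \<Rightarrow> 'v set set \<Rightarrow> (('v \<Rightarrow> real) \<Rightarrow> 'h) \<Rightarrow> bool"
  where
  "admissible_on W r S f \<longleftrightarrow> (\<exists>U g. open U \<and> polytope_of S r \<subseteq> U \<and> smooth_on U g \<and> g ` U \<subseteq> W \<and>
     (\<forall>t\<in>geometric_realisation S. g (\<Sum>v\<in>\<Union>S. t v *\<^sub>R r v) = f t))"

definition admissible ::
    "'d::finite itself \<Rightarrow> 'v set set set \<Rightarrow> (('v \<Rightarrow> real) \<Rightarrow> 'h::real_normed_vector) \<Rightarrow> bool" where
  "admissible D \<S> f \<longleftrightarrow>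
     (\<forall>r :: 'v set set \<Rightarrow> 'v \<Rightarrow> real ^ 'd::finite. (\<forall>S\<in>\<S>. polytope_realisation S (r S)) \<longrightarrow>
        (\<exists>B. finite B \<and> (\<forall>S\<in>\<S>. admissible_on (span B) (r S) S f)))"

definition distortion ::
    "'h::real_inner list \<Rightarrow> ('v set set \<Rightarrow> 'v \<Rightarrow> real ^ 'd::{finite,linorder}) \<Rightarrow>
     'v set set \<Rightarrow> nat \<Rightarrow> 'v set set set \<Rightarrow> (('v \<Rightarrow> real) \<Rightarrow> 'h) \<Rightarrow> ereal" where
  "distortion bs r X k \<S> f =
     (if \<exists>S\<in>\<S>. hilbert_fill bs (r S) k f S = 0 then \<infinity>
      else (SUP S\<in>\<S>. ereal (hilbert_fill bs (r S) k f S / real (gallery_fill X k S))) *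
           (SUP S\<in>\<S>. ereal (real (gallery_fill X k S) / hilbert_fill bs (r S) k f S)))"

end

theory Submission
  imports Defs "HOL-Combinatorics.Multiset_Permutations"
begin

text \<open>
The distortion is a product \<open>M1 * M2\<close> of two maxima: every \<open>S\<close> in the family satisfies
\<open>Fill_H (f S) \<le> M1 * Fill S\<close> and \<open>Fill S \<le> M2 * Fill_H (f S)\<close>. Their product is bounded below by
comparing the boundaries of single \<open>(k+1)\<close>-simplices, which have \<open>Fill = 1\<close>, with the spheres in \<open>A\<close>, most of
which have large \<open>Fill\<close>.

\<^bold>\<open>Energy.\<close> For an increasing multi-index \<open>I\<close> let \<open>\<phi> I\<close> be the \<open>k\<close>-cochain whose value
on a chosen ordering of \<open>\<tau>\<close> is the integral of \<open>x\<^sub>i\<^sub>1 dx\<^sub>i\<^sub>2 \<dots>\<close> over \<open>f \<tau>\<close>.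
Then \<open>Fill_H (f S)\<^sup>2\<close> is the sum over \<open>I\<close> of the squared pairing of \<open>\<phi> I\<close> with
the fundamental cycle of \<open>S\<close> (\<open>hilbert_fill_eq_facet_pairings\<close>). For the boundary of a simplex this is
\<open>\<Sum>I. (d (\<phi> I) \<sigma>)\<^sup>2\<close>, which is therefore at most \<open>M1\<^sup>2\<close>. A sphere is a cycle, since each ridge of a simplicial
polytope lies in exactly two facets and these induce opposite orientations on it (\<open>ridge_facets\<close>). So
changing \<open>\<phi> I\<close> by a coboundary does not change its pairing with a sphere (\<open>stokes\<close>), and since
the cohomology vanishes, \<open>\<phi> I\<close> may be taken orthogonal to all cocycles. The spectral gap then bounds
the norm of \<open>\<phi> I\<close> by that of \<open>d (\<phi> I)\<close> (\<open>up_spectrum_gap\<close>), and the Cauchy--Schwarz inequality together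
with the multiplicity bound \<open>l\<close> gives \<open>(\<Sum>S\<in>A. Fill_H (f S)\<^sup>2) \<le> s / (l * lam) * M1\<^sup>2 * w\<close>,
where \<open>w\<close> is the sum of the weights of all \<open>(k+1)\<close>-simplices (\<open>sum_facet_pairings_le\<close>).

\<^bold>\<open>Counting.\<close> Let \<open>R\<close> be the first factor of the bound; it may be assumed positive. A sphere with \<open>Fill S < 3/2 * R\<close> has
all facets within gallery distance about \<open>3/4 * R\<close> of some \<open>k\<close>-simplex, because a connected
set of \<open>q\<close> simplices has radius about \<open>q / 2\<close> (\<open>centre_exists\<close>). A ball of that radius has at most
\<open>2 * (D * k) powr (R + 1)\<close> elements (\<open>ball_size_bound\<close>), and a sphere is determined by all of its
facets but one (\<open>facet_determined_by_others\<close>), so that at most \<open>s - 1\<close> elements of the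
ball have to be recorded. By the choice of \<open>R\<close> at most a twelfth of the spheres in \<open>A\<close> can have such a small
filling (\<open>card_small_filling_le\<close>); hence \<open>2 * R\<^sup>2 * card A \<le> (\<Sum>S\<in>A. (Fill S)\<^sup>2)\<close>. Radius \<open>q / 2\<close> instead of
\<open>q\<close> is what makes the constants fit: a step in the gallery metric has up to \<open>(k+1) * (D-1)\<close>
continuations, which can exceed \<open>D * k\<close> but not \<open>(D * k) powr (4/3)\<close>, and \<open>3/4 * R\<close> such steps contribute
\<open>(D * k) powr R\<close>.

Combining both estimates with \<open>Fill S \<le> M2 * Fill_H (f S)\<close> bounds \<open>M1 * M2\<close> from below.
\<close>

section \<open>Facets and ridges of a simplicial polytope\<close>

text \<open>Row \<open>i\<close> of the matrix in \<open>orientation_sign\<close> belongs to the vertex number \<open>index_rank i\<close>, counted from 0.\<close>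
definition index_rank :: "'d::{finite,linorder} \<Rightarrow> nat" where
  "index_rank i = card {j. j < i}"

lemma index_rank_strict: "i < j \<Longrightarrow> index_rank i < index_rank j"
  unfolding index_rank_def by (rule psubset_card_mono) auto

lemma bij_index_rank: "bij_betw (index_rank :: 'd::{finite,linorder} \<Rightarrow> nat) UNIV {..<CARD('d)}"
proof -
  have inj: "inj (index_rank :: 'd \<Rightarrow> nat)"
    by (metis (no_types, lifting) index_rank_strict injI less_irrefl_nat linorder_less_linear)
  have "index_rank i < CARD('d)" for i :: 'd
    unfolding index_rank_def by (rule psubset_card_mono) auto
  hence "range (index_rank :: 'd \<Rightarrow> nat) \<subseteq> {..<CARD('d)}" by auto
  moreover have "card (range (index_rank :: 'd \<Rightarrow> nat)) = CARD('d)"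
    using inj by (simp add: card_image)
  ultimately have "range (index_rank :: 'd \<Rightarrow> nat) = {..<CARD('d)}"
    by (simp add: card_subset_eq)
  thus ?thesis using inj by (simp add: bij_betw_def)
qed

text \<open>The edge vectors from the apex \<open>c\<close> to the vertices of the ordered simplex; \<open>orientation_sign\<close> is the
sign of its determinant for an interior point \<open>c\<close>.\<close>
definition cone_matrix :: "real^'d::{finite,linorder} \<Rightarrow> ('v \<Rightarrow> real^'d::{finite,linorder}) \<Rightarrow> 'v list \<Rightarrow> real^'d::{finite,linorder}^'d::{finite,linorder}" where
  "cone_matrix c r vs = (\<chi> i. r (vs ! index_rank i) - c)"

lemma det_swap_rows:
  fixes M :: "real^'d::{finite,linorder}^'d::{finite,linorder}"
  assumes "i \<noteq> j"
  shows "det (\<chi> x. M $ (Transposition.transpose i j x)) = - det M"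
proof -
  have "det (\<chi> x. M $ (Transposition.transpose i j x) :: real^'d::{finite,linorder}^'d::{finite,linorder}) = of_int (sign (Transposition.transpose i j)) * det M"
    by (rule det_permute_rows) (simp add: permutes_swap_id)
  thus ?thesis using assms by (simp add: sign_swap_id)
qed

lemma index_rank_inj: "index_rank i = index_rank j \<longleftrightarrow> i = j"
  using bij_index_rank[where 'd='a] by (auto simp: bij_betw_def inj_on_def)

lemma index_rank_ex: "m < CARD('d::{finite,linorder}) \<Longrightarrow> \<exists>i::'d. index_rank i = m"
  using bij_index_rank[where 'd='d] by (auto simp: bij_betw_def) (metis imageE lessThan_iff)

lemma index_rank_less: "index_rank (i::'d::{finite,linorder}) < CARD('d)"
  using bij_index_rank[where 'd='d] by (auto simp: bij_betw_def)

lemma det_cone_matrix_swap: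
  fixes c :: "real^'d::{finite,linorder}"
  assumes "length us + length ws + 2 = CARD('d)"
  shows "det (cone_matrix c r (us @ a # b # ws)) = - det (cone_matrix c r (us @ b # a # ws))"
proof -
  obtain i :: 'd where i: "index_rank i = length us" using assms index_rank_ex[where 'd='d, of "length us"] by auto
  obtain j :: 'd where j: "index_rank j = Suc (length us)" using assms index_rank_ex[where 'd='d, of "Suc (length us)"] by auto
  have ij: "i \<noteq> j" using i j by auto
  have *: "(us @ a # b # ws) ! index_rank x = (us @ b # a # ws) ! index_rank (Transposition.transpose i j x)" for x
  proof -
    consider "x = i" | "x = j" | "x \<noteq> i" "x \<noteq> j" by blast
    thus ?thesis
    proof cases
      case 3
      hence "index_rank x \<noteq> length us" "index_rank x \<noteq> Suc (length us)"
        using i j by (metis index_rank_inj)+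
      hence "index_rank x < length us \<or> index_rank x \<ge> length us + 2" by linarith
      thus ?thesis using 3 by (auto simp: nth_append nth_Cons' Transposition.transpose_def)
    qed (use i j ij in \<open>auto simp: nth_append Transposition.transpose_def\<close>)
  qed
  have "cone_matrix c r (us @ a # b # ws) = (\<chi> x. cone_matrix c r (us @ b # a # ws) $ (Transposition.transpose i j x))"
    by (simp add: cone_matrix_def * vec_eq_iff)
  thus ?thesis using det_swap_rows[OF ij] by simp
qed

text \<open>Fixes one interior point that serves all ordered simplices at once.\<close>
lemma orientation_sign_eq_sgn_det:
  "\<exists>c. (interior (polytope_of S r) \<noteq> {} \<longrightarrow> c \<in> interior (polytope_of S r)) \<and>
     (\<forall>vs. orientation_sign S r vs = sgn (det (cone_matrix c r vs)))"
proof -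
  let ?c = "SOME c. c \<in> interior (polytope_of S r)"
  have "interior (polytope_of S r) \<noteq> {} \<longrightarrow> ?c \<in> interior (polytope_of S r)"
    using someI_ex[of "\<lambda>c. c \<in> interior (polytope_of S r)"] by auto
  moreover have "\<forall>vs. orientation_sign S r vs = sgn (det (cone_matrix ?c r vs))"
    by (simp add: orientation_sign_def cone_matrix_def index_rank_def Let_def)
  ultimately show ?thesis by blast
qed

text \<open>The complexes in question: boundary complexes of simplicial polytopes of dimension \<open>k + 1\<close>.\<close>
locale polytope_sphere =
  fixes S :: "'v set set" and r :: "'v \<Rightarrow> real^'d::{finite,linorder}" and k :: nat
  assumes cplx: "abstract_complex S" and realisation: "polytope_realisation S r"
    and dim: "CARD('d) = Suc k"
begin

abbreviation "P \<equiv> polytope_of S r"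

lemma polytope_P: "polytope P" and interior_P: "interior P \<noteq> {}" and inj_vertices: "inj_on r (\<Union>S)"
  and indep: "\<sigma> \<in> S \<Longrightarrow> \<not> affine_dependent (r ` \<sigma>)"
  and faces: "(\<lambda>\<sigma>. convex hull (r ` \<sigma>)) ` S = {F. F face_of P \<and> F \<noteq> {} \<and> F \<noteq> P}"
  using realisation by (auto simp: polytope_realisation_def)

lemma face: "\<sigma> \<in> S \<Longrightarrow> convex hull (r ` \<sigma>) face_of P \<and> convex hull (r ` \<sigma>) \<noteq> {} \<and> convex hull (r ` \<sigma>) \<noteq> P"
  using faces by blast

lemma faceE: assumes "F face_of P" "F \<noteq> {}" "F \<noteq> P" obtains \<sigma> where "\<sigma> \<in> S" "F = convex hull (r ` \<sigma>)"
  using faces assms by blast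

lemma simplex_finite: "\<sigma> \<in> S \<Longrightarrow> finite \<sigma>"
  using cplx unfolding abstract_complex_def by simp

lemma simplex_nonempty: "\<sigma> \<in> S \<Longrightarrow> \<sigma> \<noteq> {}"
  using cplx unfolding abstract_complex_def by simp

lemma simplex_subset: "\<sigma> \<in> S \<Longrightarrow> \<tau> \<subseteq> \<sigma> \<Longrightarrow> \<tau> \<noteq> {} \<Longrightarrow> \<tau> \<in> S"
  using cplx unfolding abstract_complex_def by blast

lemma in_P: "v \<in> \<Union>S \<Longrightarrow> r v \<in> P"
  unfolding polytope_of_def by (simp add: hull_inc)

text \<open>The vertices of \<open>S\<close> are extreme points of \<open>P\<close>, and an extreme point in the hull of finitely many points of
\<open>P\<close> is one of these points. Thus inclusions of faces can be read off from vertex sets.\<close>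
lemma vertex_in_face:
  assumes "w \<in> \<Union>S" "\<sigma> \<in> S" "r w \<in> convex hull (r ` \<sigma>)"
  shows "w \<in> \<sigma>"
proof -
  have "{w} \<in> S" using assms(1) simplex_subset by blast
  hence "{r w} face_of P" using face[of "{w}"] by simp
  hence "r w extreme_point_of P" by (simp add: face_of_singleton)
  hence "r w extreme_point_of convex hull (r ` \<sigma>)"
    using extreme_point_of_face[of "convex hull (r ` \<sigma>)" P "r w"] face[OF assms(2)] assms(3) by blast
  hence "r w \<in> r ` \<sigma>" by (rule extreme_point_of_convex_hull)
  then obtain u where u: "u \<in> \<sigma>" "r w = r u" by blast
  have "u \<in> \<Union>S" using u(1) assms(2) by (rule UnionI[rotated])
  hence "w = u" using inj_onD[OF inj_vertices u(2) assms(1)] by simp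
  thus ?thesis using u by simp
qed

lemma hull_mono_iff:
  assumes "\<rho> \<subseteq> \<Union>S" "\<sigma> \<in> S" "convex hull (r ` \<rho>) \<subseteq> convex hull (r ` \<sigma>)"
  shows "\<rho> \<subseteq> \<sigma>"
proof
  fix w assume "w \<in> \<rho>"
  hence "r w \<in> convex hull (r ` \<rho>)" by (simp add: hull_inc)
  thus "w \<in> \<sigma>" using vertex_in_face assms \<open>w \<in> \<rho>\<close> by blast
qed

lemma aff_dim_hull: assumes "\<sigma> \<in> S" shows "aff_dim (convex hull (r ` \<sigma>)) = int (card \<sigma>) - 1"
proof -
  have "inj_on r \<sigma>" using inj_vertices assms by (meson Union_upper inj_on_subset)
  thus ?thesis using aff_dim_affine_independent[OF indep[OF assms]] by (simp add: aff_dim_convex_hull card_image)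
qed

lemma aff_dim_P: "aff_dim P = int (Suc k)"
  using aff_dim_nonempty_interior[OF interior_P] dim by simp

lemma facetE:
  assumes "F facet_of P"
  obtains \<tau> where "\<tau> \<in> simplices k S" "F = convex hull (r ` \<tau>)"
proof -
  have "F face_of P" "F \<noteq> {}" "F \<noteq> P" using assms by (auto simp: facet_of_def)
  then obtain \<tau> where \<tau>: "\<tau> \<in> S" "F = convex hull (r ` \<tau>)" by (rule faceE)
  have "int (card \<tau>) - 1 = int k" using assms aff_dim_hull[OF \<tau>(1)] aff_dim_P \<tau>(2) by (simp add: facet_of_def)
  hence "\<tau> \<in> simplices k S" using \<tau>(1) by (simp add: simplices_def)
  thus ?thesis using \<tau>(2) by (rule that)
qed

lemma facet_hull: "\<tau> \<in> simplices k S \<Longrightarrow> convex hull (r ` \<tau>) facet_of P"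
  using face[of \<tau>] aff_dim_hull[of \<tau>] aff_dim_P by (simp add: facet_of_def simplices_def)

lemma in_facet: assumes "\<sigma> \<in> S" shows "\<exists>\<tau>\<in>simplices k S. \<sigma> \<subseteq> \<tau>"
proof -
  obtain F where F: "F facet_of P" "convex hull (r ` \<sigma>) \<subseteq> F"
    using face_of_polyhedron_subset_facet[OF polytope_imp_polyhedron[OF polytope_P]] face[OF assms] by metis
  obtain \<tau> where \<tau>: "\<tau> \<in> simplices k S" "F = convex hull (r ` \<tau>)" using facetE[OF F(1)] by metis
  thus ?thesis using hull_mono_iff[of \<sigma> \<tau>] F assms by (auto simp: simplices_def)
qed

lemma facet_set_determines: "S = {\<sigma>. \<sigma> \<noteq> {} \<and> (\<exists>\<tau>\<in>simplices k S. \<sigma> \<subseteq> \<tau>)}"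
proof (intro set_eqI iffI)
  fix \<sigma> assume "\<sigma> \<in> S"
  thus "\<sigma> \<in> {\<sigma>. \<sigma> \<noteq> {} \<and> (\<exists>\<tau>\<in>simplices k S. \<sigma> \<subseteq> \<tau>)}"
    using simplex_nonempty[of \<sigma>] in_facet[of \<sigma>] by simp
next
  fix \<sigma> assume "\<sigma> \<in> {\<sigma>. \<sigma> \<noteq> {} \<and> (\<exists>\<tau>\<in>simplices k S. \<sigma> \<subseteq> \<tau>)}"
  then obtain \<tau> where "\<tau> \<in> S" "\<sigma> \<subseteq> \<tau>" "\<sigma> \<noteq> {}" unfolding simplices_def by auto
  thus "\<sigma> \<in> S" by (rule simplex_subset)
qed

lemma S_nonempty: "S \<noteq> {}"
proof
  assume "S = {}"
  hence "P = {}" by (simp add: polytope_of_def)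
  thus False using interior_P by simp
qed

lemma facets_nonempty: "simplices k S \<noteq> {}"
  using S_nonempty in_facet by blast

text \<open>A proper face of a polytope is the intersection of the facets that contain it. With one such facet only,
the ridge would be equal to that facet, and their dimensions differ.\<close>
lemma two_facets:
  assumes "\<rho> \<in> S" "card \<rho> = k"
  shows "\<exists>v w. v \<noteq> w \<and> v \<notin> \<rho> \<and> w \<notin> \<rho> \<and> insert v \<rho> \<in> S \<and> insert w \<rho> \<in> S"
proof -
  have poly': "polyhedron P" by (rule polytope_imp_polyhedron[OF polytope_P])
  have ext: "\<exists>v. v \<notin> \<rho> \<and> \<tau> = insert v \<rho>" if "\<tau> \<in> simplices k S" "\<rho> \<subseteq> \<tau>" for \<tau>
  proof -
    have "finite \<tau>" using that(1) simplex_finite by (auto simp: simplices_def)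
    hence "card (\<tau> - \<rho>) = 1" using that assms by (auto simp: simplices_def card_Diff_subset finite_subset)
    then obtain v where "\<tau> - \<rho> = {v}" by (auto simp: card_1_singleton_iff)
    thus ?thesis using that(2) by blast
  qed
  obtain \<tau> where \<tau>: "\<tau> \<in> simplices k S" "\<rho> \<subseteq> \<tau>" using in_facet[OF assms(1)] by auto
  have \<tau>S: "\<tau> \<in> S" "card \<tau> = Suc k" using \<tau>(1) by (simp_all add: simplices_def)
  have "\<exists>\<tau>'\<in>simplices k S. \<rho> \<subseteq> \<tau>' \<and> \<tau>' \<noteq> \<tau>"
  proof (rule ccontr)
    assume no: "\<not> ?thesis"
    have "F = convex hull (r ` \<tau>)" if "F facet_of P" "convex hull (r ` \<rho>) \<subseteq> F" for F
    proof -
      obtain \<tau>' where \<tau>': "\<tau>' \<in> simplices k S" "F = convex hull (r ` \<tau>')" using facetE[OF \<open>F facet_of P\<close>] by metis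
      hence "\<rho> \<subseteq> \<tau>'" using hull_mono_iff[of \<rho> \<tau>'] that assms by (auto simp: simplices_def)
      thus ?thesis using no \<tau>' by blast
    qed
    moreover have "convex hull (r ` \<tau>) facet_of P \<and> convex hull (r ` \<rho>) \<subseteq> convex hull (r ` \<tau>)"
      using \<tau> facet_hull hull_mono[OF image_mono[OF \<tau>(2)], of convex r] by blast
    ultimately have only: "{F. F facet_of P \<and> convex hull (r ` \<rho>) \<subseteq> F} = {convex hull (r ` \<tau>)}" by blast
    have "convex hull (r ` \<rho>) = \<Inter>{F. F facet_of P \<and> convex hull (r ` \<rho>) \<subseteq> F}"
      by (rule face_of_polyhedron[OF poly']) (simp_all only: face[OF assms(1)] not_False_eq_True)
    hence "convex hull (r ` \<rho>) = convex hull (r ` \<tau>)" unfolding only by simp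
    hence "int (card \<rho>) - 1 = int (card \<tau>) - 1"
      unfolding aff_dim_hull[OF assms(1), symmetric] by (simp only: aff_dim_hull[OF \<tau>S(1)])
    thus False using assms(2) \<tau>S(2) by simp
  qed
  then obtain \<tau>' where \<tau>': "\<tau>' \<in> simplices k S" "\<rho> \<subseteq> \<tau>'" "\<tau>' \<noteq> \<tau>" by blast
  obtain v w where "v \<notin> \<rho>" "\<tau> = insert v \<rho>" "w \<notin> \<rho>" "\<tau>' = insert w \<rho>" using ext \<tau> \<tau>' by metis
  moreover have "\<tau> \<in> S" "\<tau>' \<in> S" using \<tau> \<tau>' by (auto simp: simplices_def)
  ultimately show ?thesis using \<tau>'(3) by blast
qed

lemma facet_support:
  assumes "\<tau> \<in> simplices k S" "c \<in> interior P"
  shows "\<exists>a b. (\<forall>x\<in>P. a \<bullet> x \<le> b) \<and> convex hull (r ` \<tau>) = P \<inter> {x. a \<bullet> x = b} \<and> a \<bullet> c < b"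
proof -
  have "convex hull (r ` \<tau>) facet_of P" by (rule facet_hull[OF assms(1)])
  then obtain a b where ab: "a \<noteq> 0" "P \<subseteq> {x. a \<bullet> x \<le> b}" "convex hull (r ` \<tau>) = P \<inter> {x. a \<bullet> x = b}"
    using facet_of_polyhedron[OF polytope_imp_polyhedron[OF polytope_P]] by metis
  have "c \<in> interior {x. a \<bullet> x \<le> b}" using interior_mono[OF ab(2)] assms(2) by blast
  hence "a \<bullet> c < b" using ab(1) by (simp add: interior_halfspace_le)
  thus ?thesis using ab by blast
qed

text \<open>Test a linear relation between the rows against the functional that supports the facet: the functional
takes the same nonzero value on all rows, so the coefficients add up to \<open>0\<close>. The relation
is therefore an affine relation between the vertices of the facet.\<close>
lemma det_cone_matrix_nonzero:
  assumes "set vs \<in> simplices k S" "length vs = Suc k" "c \<in> interior P"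
  shows "det (cone_matrix c r vs) \<noteq> 0"
proof -
  let ?M = "cone_matrix c r vs"
  obtain a b where ab: "\<forall>x\<in>P. a \<bullet> x \<le> b" "convex hull (r ` set vs) = P \<inter> {x. a \<bullet> x = b}" "a \<bullet> c < b"
    using facet_support[OF assms(1,3)] by blast
  have dist: "distinct vs" using assms(1,2) by (simp add: card_distinct simplices_def)
  have inS: "set vs \<in> S" using assms(1) by (simp add: simplices_def)
  let ?g = "\<lambda>i::'d. vs ! index_rank i"
  have bij: "bij_betw ?g UNIV (set vs)"
    using bij_betw_trans[OF bij_index_rank[where 'd='d] bij_betw_nth[OF dist, of "{..<CARD('d)}" "set vs"]]
      assms(2) dim by (simp add: o_def)
  have bijr: "bij_betw (\<lambda>i. r (?g i)) UNIV (r ` set vs)"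
    using bij_betw_trans[OF bij inj_on_imp_bij_betw[OF inj_on_subset[OF inj_vertices Union_upper[OF inS]]]]
    by (simp only: o_def)
  have "e i = 0" if e: "(\<Sum>i\<in>UNIV. e i *s row i ?M) = 0" for e i
  proof -
    have rw: "row i ?M = r (?g i) - c" for i by (simp add: cone_matrix_def row_def vec_eq_iff)
    have sc: "(\<Sum>i\<in>UNIV. e i *\<^sub>R (r (?g i) - c)) = 0"
      using e by (simp add: rw scalar_mult_eq_scaleR)
    have "a \<bullet> r (?g i) = b" for i
    proof -
      have "r (?g i) \<in> convex hull (r ` set vs)" using bij_betwE[OF bijr] by (simp add: hull_inc)
      thus ?thesis using ab(2) by blast
    qed
    hence "a \<bullet> (\<Sum>i\<in>UNIV. e i *\<^sub>R (r (?g i) - c)) = (\<Sum>i\<in>UNIV. e i * (b - a \<bullet> c))"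
      unfolding inner_sum_right inner_diff_right inner_scaleR_right by simp
    also have "\<dots> = (\<Sum>i\<in>UNIV. e i) * (b - a \<bullet> c)" by (rule sum_distrib_right[symmetric])
    finally have s0: "(\<Sum>i\<in>UNIV. e i) = 0" unfolding sc using ab(3) by simp
    have "(\<Sum>i\<in>UNIV. e i *\<^sub>R (r (?g i) - c)) = (\<Sum>i\<in>UNIV. e i *\<^sub>R r (?g i)) - (\<Sum>i\<in>UNIV. e i) *\<^sub>R c"
      by (simp only: scaleR_diff_right sum_subtractf scaleR_left.sum)
    hence s1: "(\<Sum>i\<in>UNIV. e i *\<^sub>R r (?g i)) = 0" unfolding s0 sc by simp
    define U where "U = e \<circ> inv_into UNIV (\<lambda>i. r (?g i))"
    have Ue: "U (r (?g i)) = e i" for i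
      using inv_into_f_f[OF bij_betw_imp_inj_on[OF bijr] UNIV_I, of i] by (simp add: U_def)
    have "sum U (r ` set vs) = 0" "(\<Sum>x\<in>r ` set vs. U x *\<^sub>R x) = 0"
      using sum.reindex_bij_betw[OF bijr, of U] sum.reindex_bij_betw[OF bijr, of "\<lambda>x. U x *\<^sub>R x"] Ue s0 s1 by simp_all
    moreover have "\<not> (\<exists>U. sum U (r ` set vs) = 0 \<and> (\<exists>x\<in>r ` set vs. U x \<noteq> 0) \<and> (\<Sum>x\<in>r ` set vs. U x *\<^sub>R x) = 0)"
      using indep[OF inS] by (simp only: affine_dependent_explicit_finite[OF finite_imageI[OF finite_set]] not_False_eq_True)
    ultimately have "\<forall>x\<in>r ` set vs. U x = 0" by blast
    moreover have "r (?g i) \<in> r ` set vs" using bij_betwE[OF bijr] by blast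
    ultimately have "U (r (?g i)) = 0" by blast
    thus "e i = 0" unfolding Ue .
  qed
  hence "\<exists>B. ?M ** B = mat 1" by (subst matrix_right_invertible_independent_rows) simp
  thus ?thesis by (simp add: invertible_det_nz[symmetric] invertible_right_inverse)
qed


text \<open>Expand \<open>r w - c\<close> in the rows of the matrix of the facet of \<open>v\<close>. The functional that supports this facet
shows that the coefficients add up to at most \<open>1\<close>; the functional that supports the facet of \<open>w\<close>
shows that they add up to at least \<open>1\<close>, provided that the coefficient of \<open>r v - c\<close> is positive. Hence \<open>r w\<close> lies on
the facet of \<open>v\<close>. So the facets through a ridge lie on different sides of the hyperplane that joins the ridge to
the apex.\<close>
lemma same_side_unique:
  assumes f1: "insert v (set \<rho>) \<in> S" "v \<notin> set \<rho>" and f2: "insert w (set \<rho>) \<in> S" "w \<notin> set \<rho>"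
    and \<rho>: "distinct \<rho>" "length \<rho> = k" and c: "c \<in> interior P"
    and side: "det (cone_matrix c r (v # \<rho>)) * det (cone_matrix c r (w # \<rho>)) > 0"
  shows "v = w"
proof -
  have st: "insert v (set \<rho>) \<in> simplices k S" "insert w (set \<rho>) \<in> simplices k S"
    using f1 f2 \<rho> by (simp_all add: simplices_def distinct_card)
  let ?M = "cone_matrix c r (v # \<rho>)"
  have "det ?M \<noteq> 0" using side by auto
  then obtain B where B: "?M ** B = mat 1" by (metis invertible_det_nz invertible_right_inverse)
  hence B': "B ** ?M = mat 1" by (simp add: matrix_left_right_inverse)
  define x where "x = (r w - c) v* B"
  have "x v* ?M = r w - c" unfolding x_def by (simp add: vector_matrix_mul_assoc B')
  hence xe: "r w - c = (\<Sum>i\<in>UNIV. x $ i *s row i ?M)"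
    by (simp add: vector_matrix_mult_def vec_eq_iff row_def mult.commute sum_component)
  \<comment> \<open>The row of v, the only row in which the two matrices differ.\<close>
  obtain i0 :: 'd where i0: "index_rank i0 = 0" using index_rank_ex[where 'd='d, of 0] dim by auto
  have idx: "index_rank i = Suc (index_rank i - 1) \<and> index_rank i - 1 < length \<rho>" if "i \<noteq> i0" for i :: 'd
  proof -
    have "index_rank i \<noteq> 0" using that i0 index_rank_inj[of i i0] by simp
    thus ?thesis using index_rank_less[of i] dim \<rho>(2) by simp
  qed
  have rw: "row i (cone_matrix c r (u # \<rho>)) = (if i = i0 then r u - c else r (\<rho> ! (index_rank i - 1)) - c)" for u i
  proof (cases "i = i0")
    case False
    thus ?thesis using idx[OF False] by (simp add: cone_matrix_def row_def vec_eq_iff nth_Cons')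
  qed (simp add: cone_matrix_def row_def vec_eq_iff i0)
  have "cone_matrix c r (w # \<rho>) = (\<chi> i. if i = i0 then (\<Sum>i\<in>UNIV. x $ i *s row i ?M) else row i ?M)"
  proof -
    have "row i (cone_matrix c r (w # \<rho>)) = (if i = i0 then (\<Sum>i\<in>UNIV. x $ i *s row i ?M) else row i ?M)" for i
      unfolding xe[symmetric] by (simp add: rw)
    thus ?thesis by (simp add: row_def vec_eq_iff)
  qed
  hence "det (cone_matrix c r (w # \<rho>)) = x $ i0 * det ?M" by (simp only: cramer_lemma_transpose)
  hence "x $ i0 * (det ?M * det ?M) > 0" using side by (simp add: mult_ac)
  hence x0: "x $ i0 > 0" by (metis mult_le_0_iff not_le not_square_less_zero zero_le_square linorder_not_less mult_nonneg_nonpos2 mult_nonpos_nonneg)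
  have xe': "a \<bullet> (r w - c) = x $ i0 * (a \<bullet> (r v - c)) + (\<Sum>i\<in>UNIV - {i0}. x $ i * (a \<bullet> (r (\<rho> ! (index_rank i - 1)) - c)))" for a
  proof -
    have "a \<bullet> (r w - c) = (\<Sum>i\<in>UNIV. x $ i * (a \<bullet> row i ?M))"
      unfolding xe by (simp add: inner_sum_right scalar_mult_eq_scaleR)
    also have "\<dots> = x $ i0 * (a \<bullet> row i0 ?M) + (\<Sum>i\<in>UNIV - {i0}. x $ i * (a \<bullet> row i ?M))"
      by (rule sum.remove) auto
    finally show ?thesis by (simp add: rw)
  qed
  let ?s = "\<Sum>i\<in>UNIV - {i0}. x $ i"
  have nth\<rho>: "\<rho> ! (index_rank i - 1) \<in> set \<rho>" if "i \<noteq> i0" for i :: 'd using idx[OF that] by simp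
  have wP: "r w \<in> P" by (rule in_P) (use f2 in blast)
  have vP: "r v \<in> P" by (rule in_P) (use f1 in blast)
  obtain a b where ab: "\<forall>x\<in>P. a \<bullet> x \<le> b" "convex hull (r ` insert v (set \<rho>)) = P \<inter> {x. a \<bullet> x = b}" "a \<bullet> c < b"
    using facet_support[OF st(1) c] by blast
  obtain a' b' where ab': "\<forall>x\<in>P. a' \<bullet> x \<le> b'" "convex hull (r ` insert w (set \<rho>)) = P \<inter> {x. a' \<bullet> x = b'}" "a' \<bullet> c < b'"
    using facet_support[OF st(2) c] by blast
  have on: "a \<bullet> r u = b" if "u \<in> insert v (set \<rho>)" for u
  proof -
    have "r u \<in> convex hull (r ` insert v (set \<rho>))" using that by (meson hull_inc imageI)
    thus ?thesis using ab(2) by blast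
  qed
  have on': "a' \<bullet> r u = b'" if "u \<in> insert w (set \<rho>)" for u
  proof -
    have "r u \<in> convex hull (r ` insert w (set \<rho>))" using that by (meson hull_inc imageI)
    thus ?thesis using ab'(2) by blast
  qed
  define m where "m = b - a \<bullet> c"
  define m' where "m' = b' - a' \<bullet> c"
  have mpos: "m > 0" "m' > 0" using ab(3) ab'(3) by (simp_all add: m_def m'_def)
  have e1: "a \<bullet> (r w - c) = (x $ i0 + ?s) * m"
  proof -
    have "(\<Sum>i\<in>UNIV - {i0}. x $ i * (a \<bullet> (r (\<rho> ! (index_rank i - 1)) - c))) = (\<Sum>i\<in>UNIV - {i0}. x $ i * m)"
      using on nth\<rho> by (intro sum.cong) (auto simp: inner_diff_right m_def)
    thus ?thesis using xe'[of a] on[of v] by (simp add: inner_diff_right m_def distrib_right sum_distrib_right)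
  qed
  have e2: "a' \<bullet> (r w - c) = x $ i0 * (a' \<bullet> (r v - c)) + ?s * m'"
  proof -
    have "(\<Sum>i\<in>UNIV - {i0}. x $ i * (a' \<bullet> (r (\<rho> ! (index_rank i - 1)) - c))) = (\<Sum>i\<in>UNIV - {i0}. x $ i * m')"
      using on' nth\<rho> by (intro sum.cong) (auto simp: inner_diff_right m'_def)
    thus ?thesis using xe'[of a'] by (simp add: sum_distrib_right)
  qed
  have "a' \<bullet> (r w - c) = m'" using on'[of w] by (simp add: inner_diff_right m'_def)
  moreover have "a' \<bullet> (r v - c) \<le> m'" using bspec[OF ab'(1) vP] by (simp add: inner_diff_right m'_def)
  hence "x $ i0 * (a' \<bullet> (r v - c)) \<le> x $ i0 * m'" using x0 by simp
  ultimately have "1 * m' \<le> (x $ i0 + ?s) * m'" using e2 by (simp add: distrib_right)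
  hence g1: "1 \<le> x $ i0 + ?s" using mpos(2) by (simp only: mult_le_cancel_right_pos)
  have "1 * m \<le> (x $ i0 + ?s) * m" using g1 mpos(1) by (simp only: mult_le_cancel_right_pos)
  hence "a \<bullet> r w \<ge> b" using e1 by (simp add: m_def inner_diff_right)
  hence "a \<bullet> r w = b" using bspec[OF ab(1) wP] by simp
  hence "r w \<in> convex hull (r ` insert v (set \<rho>))" using wP ab(2) by simp
  hence "w \<in> insert v (set \<rho>)" using vertex_in_face[of w "insert v (set \<rho>)"] f1 f2 by blast
  thus ?thesis using f2(2) by blast
qed


text \<open>The boundary of a simplicial polytope is a closed oriented pseudomanifold. There are at least two facets by
\<open>two_facets\<close>, and since no two of them lie on the same side, there is no third one and the two
orientations cancel.\<close>
lemma ridge_facets: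
  assumes "set \<rho> \<in> S" "distinct \<rho>" "length \<rho> = k"
  shows "\<exists>v w. v \<noteq> w \<and> {u. u \<notin> set \<rho> \<and> insert u (set \<rho>) \<in> S} = {v, w} \<and>
    orientation_sign S r (v # \<rho>) + orientation_sign S r (w # \<rho>) = 0"
proof -
  obtain c where c: "c \<in> interior P" and o: "\<And>vs. orientation_sign S r vs = sgn (det (cone_matrix c r vs))"
    using orientation_sign_eq_sgn_det[of S r] interior_P by metis
  obtain v w where vw: "v \<noteq> w" "v \<notin> set \<rho>" "w \<notin> set \<rho>" "insert v (set \<rho>) \<in> S" "insert w (set \<rho>) \<in> S"
    using two_facets[OF assms(1)] assms(2,3) by (auto simp: distinct_card)
  have facet: "insert u (set \<rho>) \<in> simplices k S" if "u \<notin> set \<rho>" "insert u (set \<rho>) \<in> S" for u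
    using that assms by (simp add: simplices_def distinct_card)
  define d where "d u = det (cone_matrix c r (u # \<rho>))" for u
  have nz: "d u \<noteq> 0" if "u \<notin> set \<rho>" "insert u (set \<rho>) \<in> S" for u
    unfolding d_def by (rule det_cone_matrix_nonzero) (use facet[OF that] assms(3) c in auto)
  have opp: "d u * d u' < 0" if "u \<notin> set \<rho>" "insert u (set \<rho>) \<in> S" "u' \<notin> set \<rho>" "insert u' (set \<rho>) \<in> S" "u \<noteq> u'" for u u'
  proof (rule ccontr)
    assume "\<not> d u * d u' < 0"
    hence "d u * d u' > 0" using nz[OF that(1,2)] nz[OF that(3,4)] by (simp add: not_less le_less)
    thus False using same_side_unique[OF that(2,1,4,3) assms(2,3) c] that(5) unfolding d_def by blast
  qed
  have "sgn (d v) + sgn (d w) = 0"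
    using opp[OF vw(2,4,3,5,1)] by (auto simp: sgn_if mult_less_0_iff)
  moreover {
  have "u = v \<or> u = w" if u: "u \<notin> set \<rho>" "insert u (set \<rho>) \<in> S" for u
  proof (rule ccontr)
    assume "\<not> (u = v \<or> u = w)"
    hence "d u * d v < 0" "d u * d w < 0" "d v * d w < 0"
      using opp[OF u vw(2,4)] opp[OF u vw(3,5)] opp[OF vw(2,4,3,5,1)] by auto
    thus False by (auto simp: mult_less_0_iff)
  qed
  hence "{u. u \<notin> set \<rho> \<and> insert u (set \<rho>) \<in> S} = {v, w}" using vw(2-5) by auto }
  ultimately show ?thesis using vw(1) unfolding o d_def by metis
qed

lemma card_ridge_facets:
  assumes "\<rho> \<in> S" "card \<rho> = k"
  shows "card {\<tau> \<in> simplices k S. \<rho> \<subseteq> \<tau>} = 2"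
proof -
  obtain xs where xs: "set xs = \<rho>" "distinct xs" using finite_distinct_list[OF simplex_finite[OF assms(1)]] by blast
  have len: "length xs = k" using xs assms(2) distinct_card by force
  have "set xs \<in> S" using xs(1) assms(1) by simp
  then obtain v w where vw: "v \<noteq> w" "{u. u \<notin> \<rho> \<and> insert u \<rho> \<in> S} = {v, w}"
    using ridge_facets[OF _ xs(2) len] unfolding xs(1) by blast
  have vw': "v \<notin> \<rho>" "w \<notin> \<rho>" "insert v \<rho> \<in> S" "insert w \<rho> \<in> S" using vw(2) by auto
  hence vws: "insert v \<rho> \<in> simplices k S" "insert w \<rho> \<in> simplices k S"
    using assms(2) simplex_finite[OF assms(1)] by (simp_all add: simplices_def)
  have "{\<tau> \<in> simplices k S. \<rho> \<subseteq> \<tau>} = {insert v \<rho>, insert w \<rho>}"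
  proof (intro equalityI subsetI)
    fix \<tau> assume "\<tau> \<in> {\<tau> \<in> simplices k S. \<rho> \<subseteq> \<tau>}"
    hence \<tau>: "\<tau> \<in> S" "card \<tau> = Suc k" "\<rho> \<subseteq> \<tau>" by (auto simp: simplices_def)
    have "card (\<tau> - \<rho>) = 1" using \<tau> assms(2) simplex_finite[OF assms(1)] by (simp add: card_Diff_subset)
    then obtain u where "\<tau> - \<rho> = {u}" by (auto simp: card_1_singleton_iff)
    hence "\<tau> = insert u \<rho>" "u \<notin> \<rho>" using \<tau>(3) by auto
    thus "\<tau> \<in> {insert v \<rho>, insert w \<rho>}" using vw(2) \<tau>(1) by auto
  qed (use vws in auto)
  moreover have "insert v \<rho> \<noteq> insert w \<rho>" using vw(1) vw' by blast
  ultimately show ?thesis by simp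
qed

text \<open>Crossing two different ridges of a facet leads to two different facets.\<close>
lemma three_facets:
  assumes "k \<ge> 1" "finite S"
  shows "card (simplices k S) \<ge> 3"
proof -
  obtain \<tau> where \<tau>: "\<tau> \<in> simplices k S" using facets_nonempty by blast
  hence \<tau>S: "\<tau> \<in> S" "card \<tau> = Suc k" by (simp_all add: simplices_def)
  have "\<not> is_singleton \<tau>" using \<tau>S(2) assms by (simp add: is_singleton_altdef)
  moreover have "\<tau> \<noteq> {}" using \<tau>S by auto
  ultimately obtain a b where ab: "a \<in> \<tau>" "b \<in> \<tau>" "a \<noteq> b" by (metis is_singletonI')
  have other: "\<exists>\<tau>'\<in>simplices k S. \<tau> - {x} \<subseteq> \<tau>' \<and> x \<notin> \<tau>'" if x: "x \<in> \<tau>" for x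
  proof -
    have c: "card (\<tau> - {x}) = k" using \<tau>S x simplex_finite[OF \<tau>S(1)] by simp
    hence "\<tau> - {x} \<noteq> {}" using assms by (metis card.empty not_one_le_zero)
    hence "card {\<tau>' \<in> simplices k S. \<tau> - {x} \<subseteq> \<tau>'} = 2" by (rule card_ridge_facets[OF simplex_subset[OF \<tau>S(1) Diff_subset] c])
    hence "{\<tau>' \<in> simplices k S. \<tau> - {x} \<subseteq> \<tau>'} \<noteq> {\<tau>}" "\<not> {\<tau>' \<in> simplices k S. \<tau> - {x} \<subseteq> \<tau>'} \<subseteq> {\<tau>}"
      using card_mono[of "{\<tau>}" "{\<tau>' \<in> simplices k S. \<tau> - {x} \<subseteq> \<tau>'}"] by auto
    then obtain \<tau>' where \<tau>': "\<tau>' \<in> simplices k S" "\<tau> - {x} \<subseteq> \<tau>'" "\<tau>' \<noteq> \<tau>" by auto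
    have "x \<notin> \<tau>'"
    proof
      assume "x \<in> \<tau>'"
      hence "\<tau> \<subseteq> \<tau>'" using \<tau>' by auto
      thus False using \<tau>' \<tau>S card_subset_eq[of \<tau>' \<tau>] simplex_finite[of \<tau>'] by (auto simp: simplices_def)
    qed
    thus ?thesis using \<tau>' by blast
  qed
  obtain \<tau>1 where t1: "\<tau>1 \<in> simplices k S" "\<tau> - {a} \<subseteq> \<tau>1" "a \<notin> \<tau>1" using other[OF ab(1)] by blast
  obtain \<tau>2 where t2: "\<tau>2 \<in> simplices k S" "\<tau> - {b} \<subseteq> \<tau>2" "b \<notin> \<tau>2" using other[OF ab(2)] by blast
  have "card {\<tau>, \<tau>1, \<tau>2} = 3" using t1 t2 ab by (auto simp: card_insert_if)
  moreover have "{\<tau>, \<tau>1, \<tau>2} \<subseteq> simplices k S" using \<tau> t1 t2 by auto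
  moreover have "finite (simplices k S)" using assms(2) by (simp add: simplices_def)
  ultimately show ?thesis by (metis card_mono)
qed

end

text \<open>If the two removed facets were different, then one of them would have a ridge that is not in the other. This
ridge would lie in exactly one of the common facets, so in exactly one facet of the second sphere.\<close>
lemma facet_determined_by_others:
  fixes r r' :: "'v \<Rightarrow> real^'d::{finite,linorder}"
  assumes "polytope_sphere S r k" "polytope_sphere S' r' k" "k \<ge> 1"
    and \<tau>: "\<tau> \<in> simplices k S" and \<tau>': "\<tau>' \<in> simplices k S'"
    and eq: "simplices k S - {\<tau>} = simplices k S' - {\<tau>'}"
  shows "\<tau> = \<tau>'"
proof (rule ccontr)
  interpret A: polytope_sphere S r k by fact
  interpret B: polytope_sphere S' r' k by fact
  assume neq: "\<tau> \<noteq> \<tau>'"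
  have \<tau>S: "\<tau> \<in> S" "card \<tau> = Suc k" "\<tau>' \<in> S'" "card \<tau>' = Suc k" using \<tau> \<tau>' by (simp_all add: simplices_def)
  have "\<not> \<tau> \<subseteq> \<tau>'" using card_subset_eq[OF B.simplex_finite[OF \<tau>S(3)]] \<tau>S neq by auto
  then obtain z where z: "z \<in> \<tau>" "z \<notin> \<tau>'" by blast
  \<comment> \<open>A ridge of \<open>\<tau>\<close> that keeps z is not contained in \<open>\<tau>'\<close>; it exists since \<open>\<tau>\<close> has a second vertex.\<close>
  have "\<not> \<tau> \<subseteq> {z}" using \<tau>S(2) assms(3) card_mono[of "{z}" \<tau>] by auto
  then obtain u where u: "u \<in> \<tau>" "u \<noteq> z" by blast
  define \<rho> where "\<rho> = \<tau> - {u}"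
  have \<rho>: "z \<in> \<rho>" "card \<rho> = k" "\<rho> \<subseteq> \<tau>" "\<rho> \<noteq> {}" using u z \<tau>S A.simplex_finite[OF \<tau>S(1)] by (auto simp: \<rho>_def)
  have "\<rho> \<in> S" using A.simplex_subset[OF \<tau>S(1) \<rho>(3,4)] .
  hence "card {t \<in> simplices k S. \<rho> \<subseteq> t} = 2" using \<rho>(2) by (rule A.card_ridge_facets)
  moreover have "{t \<in> simplices k S. \<rho> \<subseteq> t} = insert \<tau> {t \<in> simplices k S'. \<rho> \<subseteq> t}"
    using eq \<tau> \<rho> z by blast
  moreover have "\<tau> \<notin> simplices k S'" using eq neq by blast
  ultimately have c1: "card {t \<in> simplices k S'. \<rho> \<subseteq> t} = 1"
    by (metis (no_types, lifting) card.infinite card_insert_disjoint finite_insert mem_Collect_eq numeral_2_eq_2 nat.inject One_nat_def zero_neq_numeral)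
  then obtain t where "t \<in> simplices k S'" "\<rho> \<subseteq> t" by (auto simp: card_1_singleton_iff)
  hence "\<rho> \<in> S'" using B.simplex_subset[of t \<rho>] \<rho>(4) by (auto simp: simplices_def)
  hence "card {t \<in> simplices k S'. \<rho> \<subseteq> t} = 2" using \<rho>(2) by (rule B.card_ridge_facets)
  thus False using c1 by simp
qed

section \<open>Cochains paired with oriented spheres\<close>

text \<open>Antisymmetry under transpositions of neighbours in lists of length \<open>m\<close>. This form needs no permutations of indices
and applies to orientations and cochains alike.\<close>
definition alternating :: "nat \<Rightarrow> ('v list \<Rightarrow> real) \<Rightarrow> bool" where
  "alternating m \<phi> \<longleftrightarrow>
     (\<forall>us a b ws. length us + length ws + 2 = m \<longrightarrow> \<phi> (us @ a # b # ws) = - \<phi> (us @ b # a # ws))"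

lemma alternating_swap:
  "alternating m \<phi> \<Longrightarrow> length us + length ws + 2 = m \<Longrightarrow> \<phi> (us @ a # b # ws) = - \<phi> (us @ b # a # ws)"
  unfolding alternating_def by blast

lemma alternating_move_front:
  assumes "alternating m \<phi>" "length us + length ws + 1 = m"
  shows "\<phi> (us @ v # ws) = (-1) ^ length us * \<phi> (v # us @ ws)"
  using assms(2)
proof (induction us arbitrary: ws rule: rev_induct)
  case (snoc u us)
  have "\<phi> ((us @ [u]) @ v # ws) = \<phi> (us @ u # v # ws)" by simp
  also have "\<dots> = - \<phi> (us @ v # u # ws)"
    by (rule alternating_swap[OF assms(1)]) (use snoc.prems in simp)
  also have "\<dots> = - ((-1) ^ length us * \<phi> (v # us @ (u # ws)))"
    using snoc.IH[of "u # ws"] snoc.prems by simp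
  finally show ?case by simp
qed simp

lemma swap_invariant_mset:
  assumes "\<And>us a b ws. length us + length ws + 2 = m \<Longrightarrow> g (us @ a # b # ws) = g (us @ b # a # ws)"
    and "mset xs = mset ys" "length xs = m"
  shows "g xs = g ys"
  using assms
proof (induction xs arbitrary: m g ys)
  case (Cons x xs)
  have "x \<in> set ys" using Cons.prems(2) by (metis list.set_intros(1) set_mset_mset)
  then obtain us ws where ys: "ys = us @ x # ws" by (meson split_list)
  have move: "length us + length ws + 1 = m \<Longrightarrow> g (us @ x # ws) = g (x # us @ ws)" for us ws
  proof (induction us arbitrary: ws rule: rev_induct)
    case (snoc u us)
    have "g ((us @ [u]) @ x # ws) = g (us @ u # x # ws)" by simp
    also have "\<dots> = g (us @ x # u # ws)" by (rule Cons.prems(1)) (use snoc.prems in simp)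
    also have "\<dots> = g (x # us @ (u # ws))" using snoc.IH[of "u # ws"] snoc.prems by simp
    finally show ?case by simp
  qed simp
  have ms: "mset xs = mset (us @ ws)" using Cons.prems(2) ys by simp
  have len: "length us + length ws + 1 = m" using mset_eq_length[OF Cons.prems(2)] Cons.prems(3) ys by simp
  have "g (x # xs) = g (x # us @ ws)"
  proof (rule Cons.IH[of "length xs" "\<lambda>zs. g (x # zs)" "us @ ws"])
    fix us' :: "'a list" and a b and ws' :: "'a list"
    assume "length us' + length ws' + 2 = length xs"
    thus "g (x # us' @ a # b # ws') = g (x # us' @ b # a # ws')"
      using Cons.prems(1)[of "x # us'" ws' a b] Cons.prems(3) by simp
  qed (use ms in simp_all)
  thus ?case unfolding ys using move[OF len] by simp
qed simp

text \<open>What makes sums over unordered facets meaningful: sign times value is independent of the ordering.\<close>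
lemma alternating_mult_mset:
  assumes "alternating m \<phi>" "alternating m \<psi>" "mset xs = mset ys" "length xs = m"
  shows "\<phi> xs * \<psi> xs = \<phi> ys * \<psi> ys"
proof (rule swap_invariant_mset[where m = m and g = "\<lambda>zs. \<phi> zs * \<psi> zs"])
  fix us :: "'a list" and a b and ws :: "'a list" assume l: "length us + length ws + 2 = m"
  show "\<phi> (us @ a # b # ws) * \<psi> (us @ a # b # ws) = \<phi> (us @ b # a # ws) * \<psi> (us @ b # a # ws)"
    using alternating_swap[OF assms(1) l, of a b] alternating_swap[OF assms(2) l, of a b] by simp
qed (use assms in auto)

lemma alternating_Cons: "alternating (Suc m) \<phi> \<Longrightarrow> alternating m (\<lambda>xs. \<phi> (v # xs))"
  unfolding alternating_def
proof (intro allI impI)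
  fix us :: "'a list" and a b and ws :: "'a list"
  assume *: "\<forall>us a b ws. length us + length ws + 2 = Suc m \<longrightarrow> \<phi> (us @ a # b # ws) = - \<phi> (us @ b # a # ws)"
    and "length us + length ws + 2 = m"
  thus "\<phi> (v # us @ a # b # ws) = - \<phi> (v # us @ b # a # ws)"
    using *[rule_format, of "v # us" ws a b] by simp
qed

text \<open>The ordering that \<open>hilbert_fill\<close> uses for the facet \<open>\<tau>\<close>.\<close>
definition chosen_order :: "'v set \<Rightarrow> 'v list" where
  "chosen_order \<tau> = (SOME vs. distinct vs \<and> set vs = \<tau>)"

lemma chosen_order_props: assumes "finite \<tau>"
  shows "distinct (chosen_order \<tau>)" "set (chosen_order \<tau>) = \<tau>" "length (chosen_order \<tau>) = card \<tau>"
proof -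
  have "distinct (chosen_order \<tau>) \<and> set (chosen_order \<tau>) = \<tau>"
  proof -
    obtain xs where "set xs = \<tau>" "distinct xs" using finite_distinct_list[OF assms] by blast
    thus ?thesis unfolding chosen_order_def by (intro someI[of "\<lambda>vs. distinct vs \<and> set vs = \<tau>" xs]) simp
  qed
  thus "distinct (chosen_order \<tau>)" "set (chosen_order \<tau>) = \<tau>" "length (chosen_order \<tau>) = card \<tau>"
    using distinct_card by force+
qed

lemma mset_chosen_order: "distinct vs \<Longrightarrow> mset vs = mset (chosen_order (set vs))"
  using chosen_order_props[of "set vs"] set_eq_iff_mset_eq_distinct[of vs "chosen_order (set vs)"] by simp

lemma chosen_order_ordered:
  assumes "\<tau> \<in> X" "finite \<tau>" "card \<tau> = Suc i"
  shows "chosen_order \<tau> \<in> ordered_simplices i X"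
  using chosen_order_props[OF assms(2)] assms by (simp add: ordered_simplices_def)

lemma cochain_alternating:
  assumes "\<phi> \<in> cochains i X"
  shows "alternating (Suc i) \<phi>"
  unfolding alternating_def
proof (intro allI impI)
  fix us :: "'a list" and a b and ws :: "'a list"
  assume len: "length us + length ws + 2 = Suc i"
  let ?x = "us @ a # b # ws" and ?y = "us @ b # a # ws"
  let ?t = "Transposition.transpose (length us) (Suc (length us))"
  show "\<phi> ?x = - \<phi> ?y"
  proof (cases "?y \<in> ordered_simplices i X")
    case True
    have t: "?t permutes {..<Suc i}" by (rule permutes_swap_id) (use len in auto)
    have "permute_list ?t ?y = ?x"
    proof (rule nth_equalityI)
      fix j assume j: "j < length (permute_list ?t ?y)"
      have "permute_list ?t ?y ! j = ?y ! ?t j" by (rule permute_list_nth) (use t len j in auto)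
      also have "\<dots> = ?x ! j"
      proof -
        consider "j = length us" | "j = Suc (length us)" | "j < length us" | "j \<ge> length us + 2" by linarith
        thus ?thesis by cases (auto simp: Transposition.transpose_def nth_append nth_Cons')
      qed
      finally show "permute_list ?t ?y ! j = ?x ! j" .
    qed simp
    moreover have "\<phi> (permute_list ?t ?y) = of_int (sign ?t) * \<phi> ?y"
      using assms True t unfolding cochains_def by blast
    ultimately show ?thesis by (simp add: sign_swap_id)
  next
    case False
    hence "?x \<notin> ordered_simplices i X" by (auto simp: ordered_simplices_def insert_commute)
    thus ?thesis using False assms by (simp add: cochains_def)
  qed
qed

text \<open>The cochain with prescribed values on the chosen orderings; on any other ordering its value is multiplied by
the sign of the rearrangement.\<close>
definition antisymmetric_extension :: "nat \<Rightarrow> 'v set set \<Rightarrow> ('v set \<Rightarrow> real) \<Rightarrow> 'v list \<Rightarrow> real" where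
  "antisymmetric_extension i X g vs = (if vs \<in> ordered_simplices i X
     then of_int (sign (SOME \<pi>. \<pi> permutes {..<Suc i} \<and> permute_list \<pi> (chosen_order (set vs)) = vs)) * g (set vs)
     else 0)"

lemma permute_list_inj:
  assumes "distinct xs" "p permutes {..<length xs}" "q permutes {..<length xs}" "permute_list p xs = permute_list q xs"
  shows "p = q"
proof
  fix j show "p j = q j"
  proof (cases "j < length xs")
    case True
    hence "xs ! p j = xs ! q j" using permute_list_nth[OF assms(2)] permute_list_nth[OF assms(3)] assms(4) by metis
    moreover have "p j < length xs" "q j < length xs" using True permutes_in_image[OF assms(2)] permutes_in_image[OF assms(3)] by auto
    ultimately show ?thesis using assms(1) by (simp add: nth_eq_iff_index_eq)
  next
    case False thus ?thesis using assms(2,3) by (simp add: permutes_not_in)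
  qed
qed

lemma antisymmetric_extension_permuted:
  assumes "\<tau> \<in> X" "finite \<tau>" "card \<tau> = Suc i" "\<pi> permutes {..<Suc i}"
  shows "antisymmetric_extension i X g (permute_list \<pi> (chosen_order \<tau>)) = of_int (sign \<pi>) * g \<tau>"
proof -
  let ?c = "chosen_order \<tau>"
  note c = chosen_order_props[OF assms(2)]
  have p: "\<pi> permutes {..<length ?c}" using assms c by simp
  have "permute_list \<pi> ?c \<in> ordered_simplices i X" using c assms p by (simp add: ordered_simplices_def)
  moreover have "(SOME \<pi>'. \<pi>' permutes {..<Suc i} \<and> permute_list \<pi>' ?c = permute_list \<pi> ?c) = \<pi>"
    using permute_list_inj[OF c(1) _ p] assms(3,4) c(3) by (intro some_equality) auto
  ultimately show ?thesis using c p by (simp add: antisymmetric_extension_def)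
qed

lemma antisymmetric_extension_chosen:
  assumes "\<tau> \<in> X" "finite \<tau>" "card \<tau> = Suc i"
  shows "antisymmetric_extension i X g (chosen_order \<tau>) = g \<tau>"
  using antisymmetric_extension_permuted[OF assms permutes_id, of g] by simp

lemma antisymmetric_extension_cochain: "antisymmetric_extension i X g \<in> cochains i X"
  unfolding cochains_def
proof (intro CollectI conjI ballI allI impI)
  fix vs \<pi> assume vs: "vs \<in> ordered_simplices i X" and \<pi>: "\<pi> permutes {..<Suc i}"
  have v: "distinct vs" "length vs = Suc i" "set vs \<in> X" using vs by (auto simp: ordered_simplices_def)
  have v': "card (set vs) = Suc i" using distinct_card[OF v(1)] v(2) by simp
  note o = chosen_order_props[OF finite_set[of vs]]
  obtain \<sigma> where \<sigma>: "\<sigma> permutes {..<Suc i}" "permute_list \<sigma> (chosen_order (set vs)) = vs"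
    using mset_eq_permutation[OF mset_chosen_order[OF v(1)]] o(3) v' by metis
  have "permute_list \<pi> vs = permute_list (\<sigma> \<circ> \<pi>) (chosen_order (set vs))"
    using permute_list_compose[of \<pi> "chosen_order (set vs)" \<sigma>] \<pi> o(3) v' \<sigma>(2) by simp
  moreover have "(\<sigma> \<circ> \<pi>) permutes {..<Suc i}" using \<sigma>(1) \<pi> by (rule permutes_compose[rotated])
  ultimately have "antisymmetric_extension i X g (permute_list \<pi> vs) = of_int (sign (\<sigma> \<circ> \<pi>)) * g (set vs)"
    using antisymmetric_extension_permuted[OF v(3) finite_set v'] by simp
  moreover have "antisymmetric_extension i X g vs = of_int (sign \<sigma>) * g (set vs)"
    using antisymmetric_extension_permuted[OF v(3) finite_set v' \<sigma>(1), of g] \<sigma>(2) by simp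
  moreover have "sign (\<sigma> \<circ> \<pi>) = sign \<sigma> * sign \<pi>"
    using \<sigma>(1) \<pi> by (intro sign_compose) (auto intro: permutes_imp_permutation[of "{..<Suc i}"])
  ultimately show "antisymmetric_extension i X g (permute_list \<pi> vs) = of_int (sign \<pi>) * antisymmetric_extension i X g vs"
    by simp
qed (simp add: antisymmetric_extension_def)

lemma orientation_sign_alternating:
  fixes r :: "'v \<Rightarrow> real^'d::{finite,linorder}"
  shows "alternating CARD('d) (orientation_sign S r)"
proof -
  obtain c where o: "\<And>vs. orientation_sign S r vs = sgn (det (cone_matrix c r vs))"
    using orientation_sign_eq_sgn_det[of S r] by metis
  show ?thesis unfolding alternating_def
  proof (intro allI impI)
    fix us ws :: "'v list" and a b
    assume "length us + length ws + 2 = CARD('d)"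
    from det_cone_matrix_swap[OF this, of c r a b]
    show "orientation_sign S r (us @ a # b # ws) = - orientation_sign S r (us @ b # a # ws)"
      by (simp only: o sgn_minus)
  qed
qed

context polytope_sphere begin

text \<open>The pairing of a cochain with the fundamental cycle of the sphere.\<close>
definition facet_pairing :: "('v list \<Rightarrow> real) \<Rightarrow> real" where
  "facet_pairing \<phi> = (\<Sum>\<tau>\<in>simplices k S. orientation_sign S r (chosen_order \<tau>) * \<phi> (chosen_order \<tau>))"

lemma orientation_alternating: "alternating (Suc k) (orientation_sign S r)"
  using orientation_sign_alternating[of S r] dim by simp

text \<open>Moving the omitted vertex to the front turns each term \<open>(-1)\<^sup>i \<eta> (v\<^sub>0, \<dots>, omit v\<^sub>i, \<dots>)\<close>, multiplied by the orientation of
the facet, into \<open>orientation (v\<^sub>i, \<rho>) * \<eta> \<rho>\<close>, where \<open>\<rho>\<close> is the opposite ridge. Collect the terms by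
ridges: each ridge receives the two opposite orientations of its facets.\<close>
lemma stokes:
  assumes "finite S" "S \<subseteq> X" "k = Suc j" "\<eta> \<in> cochains j X"
  shows "facet_pairing (coboundary X j \<eta>) = 0"
proof -
  let ?o = "orientation_sign S r"
  define G where "G v \<rho> = ?o (v # chosen_order \<rho>) * \<eta> (chosen_order \<rho>)" for v \<rho>
  have alt\<eta>: "alternating k \<eta>" using cochain_alternating[OF assms(4)] assms(3) by simp
  have facet: "?o (chosen_order \<tau>) * coboundary X j \<eta> (chosen_order \<tau>) = (\<Sum>v\<in>\<tau>. G v (\<tau> - {v}))" if \<tau>: "\<tau> \<in> simplices k S" for \<tau>
  proof -
    have t: "\<tau> \<in> S" "card \<tau> = Suc k" "finite \<tau>" using \<tau> simplex_finite by (auto simp: simplices_def)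
    let ?vs = "chosen_order \<tau>"
    note o = chosen_order_props[OF t(3)]
    have "?vs \<in> ordered_simplices (Suc j) X"
      using chosen_order_ordered[of \<tau> X "Suc j"] t assms(2,3) by auto
    hence "coboundary X j \<eta> ?vs = (\<Sum>i\<le>k. (-1) ^ i * \<eta> (take i ?vs @ drop (Suc i) ?vs))"
      using assms(3) by (simp add: coboundary_def del: sum.atMost_Suc)
    hence "?o ?vs * coboundary X j \<eta> ?vs = (\<Sum>i\<le>k. ?o ?vs * ((-1) ^ i * \<eta> (take i ?vs @ drop (Suc i) ?vs)))"
      by (simp only: sum_distrib_left)
    also have "\<dots> = (\<Sum>i\<le>k. G (?vs ! i) (\<tau> - {?vs ! i}))"
    proof (rule sum.cong[OF refl])
      fix i assume "i \<in> {..k}"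
      hence i: "i < length ?vs" using o(3) t(2) by simp
      let ?us = "take i ?vs" and ?ws = "drop (Suc i) ?vs"
      have split: "?vs = ?us @ ?vs ! i # ?ws" using i by (simp add: id_take_nth_drop[symmetric])
      \<comment> \<open>The sign of moving the i-th vertex to the front cancels the sign of the coboundary.\<close>
      have "?o ?vs = (-1) ^ i * ?o (?vs ! i # ?us @ ?ws)"
        using alternating_move_front[OF orientation_alternating, of ?us ?ws "?vs ! i"] split i o(3) t(2) by simp
      hence "?o ?vs * ((-1) ^ i * \<eta> (?us @ ?ws)) = ?o (?vs ! i # ?us @ ?ws) * \<eta> (?us @ ?ws) * ((-1)^i * (-1)^i)"
        by simp
      also have "(-1)^i * (-1)^i = (1::real)" by (simp flip: power_mult_distrib)
      also have "?o (?vs ! i # ?us @ ?ws) * \<eta> (?us @ ?ws) * 1 = G (?vs ! i) (\<tau> - {?vs ! i})"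
      proof -
        have d: "distinct (?us @ ?vs ! i # ?ws)" using o(1) split by metis
        have s: "\<tau> = set (?us @ ?vs ! i # ?ws)" using o(2) split by metis
        have "set (?us @ ?ws) = \<tau> - {?vs ! i}" using d by (subst s) auto
        moreover have "distinct (?us @ ?ws)" using d by auto
        ultimately have "mset (?us @ ?ws) = mset (chosen_order (\<tau> - {?vs ! i}))" by (metis mset_chosen_order)
        thus ?thesis unfolding G_def mult_1_right
          by (intro alternating_mult_mset[OF alternating_Cons[OF orientation_alternating] alt\<eta>]) (use i o(3) t(2) in auto)
      qed
      finally show "?o ?vs * ((-1) ^ i * \<eta> (?us @ ?ws)) = G (?vs ! i) (\<tau> - {?vs ! i})" .
    qed
    also have "\<dots> = (\<Sum>v\<in>\<tau>. G v (\<tau> - {v}))"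
      by (rule sum.reindex_bij_betw, rule bij_betw_nth) (use o t(2) in auto)
    finally show ?thesis .
  qed
  have fS: "finite (simplices k S)" "finite (simplices j S)" using assms(1) by (simp_all add: simplices_def)
  let ?N = "\<lambda>\<rho>. {u. u \<notin> \<rho> \<and> insert u \<rho> \<in> S}"
  have "facet_pairing (coboundary X j \<eta>) = (\<Sum>\<tau>\<in>simplices k S. \<Sum>v\<in>\<tau>. G v (\<tau> - {v}))"
    unfolding facet_pairing_def by (rule sum.cong[OF refl facet])
  also have "\<dots> = (\<Sum>(\<tau>,v)\<in>Sigma (simplices k S) (\<lambda>\<tau>. \<tau>). G v (\<tau> - {v}))"
    by (rule sum.Sigma) (use fS simplex_finite in \<open>auto simp: simplices_def\<close>)
  also have "\<dots> = (\<Sum>(\<rho>,v)\<in>Sigma (simplices j S) ?N. G v \<rho>)"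
  proof (rule sum.reindex_bij_witness[where i = "\<lambda>(\<rho>,v). (insert v \<rho>, v)" and j = "\<lambda>(\<tau>,v). (\<tau> - {v}, v)"])
    fix a assume "a \<in> Sigma (simplices k S) (\<lambda>\<tau>. \<tau>)"
    then obtain \<tau> v where a: "a = (\<tau>, v)" "\<tau> \<in> S" "card \<tau> = Suc k" "v \<in> \<tau>" by (auto simp: simplices_def)
    have ins: "insert v (\<tau> - {v}) = \<tau>" using a by auto
    have "card (\<tau> - {v}) = k" using a simplex_finite by simp
    moreover from this have "\<tau> - {v} \<noteq> {}" using assms(3) by (metis card.empty nat.distinct(1))
    hence "\<tau> - {v} \<in> S" by (intro simplex_subset[OF a(2)]) auto
    ultimately show "(case a of (\<tau>,v) \<Rightarrow> (\<tau> - {v}, v)) \<in> Sigma (simplices j S) ?N"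
      using a ins assms(3) by (simp add: simplices_def)
    show "(case (case a of (\<tau>,v) \<Rightarrow> (\<tau> - {v}, v)) of (\<rho>,v) \<Rightarrow> (insert v \<rho>, v)) = a" using a ins by simp
  next
    fix b assume "b \<in> Sigma (simplices j S) ?N"
    then obtain \<rho> v where b: "b = (\<rho>, v)" "\<rho> \<in> S" "card \<rho> = Suc j" "v \<notin> \<rho>" "insert v \<rho> \<in> S" by (auto simp: simplices_def)
    show "(case b of (\<rho>,v) \<Rightarrow> (insert v \<rho>, v)) \<in> Sigma (simplices k S) (\<lambda>\<tau>. \<tau>)"
      using b simplex_finite[OF b(2)] assms(3) by (simp add: simplices_def)
    show "(case (case b of (\<rho>,v) \<Rightarrow> (insert v \<rho>, v)) of (\<tau>,v) \<Rightarrow> (\<tau> - {v}, v)) = b" using b by simp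
  qed auto
  also have "\<dots> = (\<Sum>\<rho>\<in>simplices j S. \<Sum>v\<in>?N \<rho>. G v \<rho>)"
  proof (rule sum.Sigma[symmetric])
    have "?N \<rho> \<subseteq> \<Union>S" for \<rho> by blast
    moreover have "finite (\<Union>S)" using assms(1) simplex_finite by blast
    ultimately show "\<forall>\<rho>\<in>simplices j S. finite (?N \<rho>)" by (meson finite_subset)
  qed (fact fS)
  also have "\<dots> = 0"
  proof (rule sum.neutral, rule ballI)
    fix \<rho> assume "\<rho> \<in> simplices j S"
    hence \<rho>: "\<rho> \<in> S" "card \<rho> = k" using assms(3) by (simp_all add: simplices_def)
    note o = chosen_order_props[OF simplex_finite[OF \<rho>(1)]]
    obtain v w where vw: "v \<noteq> w" "?N \<rho> = {v, w}" "?o (v # chosen_order \<rho>) + ?o (w # chosen_order \<rho>) = 0"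
      using ridge_facets[of "chosen_order \<rho>"] o \<rho> by auto
    have "(\<Sum>v\<in>?N \<rho>. G v \<rho>) = (?o (v # chosen_order \<rho>) + ?o (w # chosen_order \<rho>)) * \<eta> (chosen_order \<rho>)"
      unfolding vw(2) using vw(1) by (simp add: G_def distrib_right)
    thus "(\<Sum>v\<in>?N \<rho>. G v \<rho>) = 0" unfolding vw(3) by simp
  qed
  finally show ?thesis .
qed

end

text \<open>The faces \<open>F i\<close> and \<open>F (i+1)\<close> of an ordered simplex have the ridge without \<open>v\<^sub>i\<close> and \<open>v\<^sub>i\<^sub>+\<^sub>1\<close> in common.
Opposite orientations at this ridge force their signs to alternate, so the boundary orientation is
\<open>(-1)\<^sup>i\<close> up to one global sign.\<close>
lemma facet_pairing_simplex_boundary: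
  fixes r :: "'v \<Rightarrow> real^'d::{finite,linorder}"
  assumes sph: "polytope_sphere (simplex_boundary \<sigma>) r k" and "k \<ge> 1"
    and vs: "vs \<in> ordered_simplices (Suc k) X" "set vs = \<sigma>" and \<phi>: "\<phi> \<in> cochains k X"
  shows "(polytope_sphere.facet_pairing (simplex_boundary \<sigma>) r k \<phi>)\<^sup>2 = (coboundary X k \<phi> vs)\<^sup>2"
proof -
  let ?S = "simplex_boundary \<sigma>"
  interpret polytope_sphere ?S r k by fact
  let ?o = "orientation_sign ?S r"
  have v: "distinct vs" "length vs = Suc (Suc k)" using vs(1) by (auto simp: ordered_simplices_def)
  have card\<sigma>: "card \<sigma> = Suc (Suc k)" using distinct_card[OF v(1)] v(2) vs(2) by simp
  have fin\<sigma>: "finite \<sigma>" using vs(2) by auto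
  define F where "F i = take i vs @ drop (Suc i) vs" for i
  have split: "vs = take i vs @ vs ! i # drop (Suc i) vs" if "i \<le> Suc k" for i
    using that v by (simp add: id_take_nth_drop[symmetric])
  have F: "distinct (F i)" "length (F i) = Suc k" "set (F i) = \<sigma> - {vs ! i}" if "i \<le> Suc k" for i
  proof -
    have d: "distinct (take i vs @ vs ! i # drop (Suc i) vs)" using v(1) split[OF that] by metis
    have s: "\<sigma> = set (take i vs @ vs ! i # drop (Suc i) vs)" using vs(2) split[OF that] by metis
    show "distinct (F i)" "set (F i) = \<sigma> - {vs ! i}" unfolding F_def using d by (auto simp: s)
    show "length (F i) = Suc k" unfolding F_def using that v by simp
  qed
  have facets: "simplices k ?S = (\<lambda>v. \<sigma> - {v}) ` \<sigma>"
  proof (intro equalityI subsetI)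
    fix \<tau> assume "\<tau> \<in> simplices k ?S"
    hence \<tau>: "\<tau> \<subset> \<sigma>" "card \<tau> = Suc k" by (auto simp: simplices_def simplex_boundary_def)
    have "finite \<tau>" using \<tau>(1) fin\<sigma> finite_subset by blast
    hence "card (\<sigma> - \<tau>) = 1" using card\<sigma> \<tau> by (simp add: card_Diff_subset psubset_imp_subset)
    then obtain v where "\<sigma> - \<tau> = {v}" by (auto simp: card_1_singleton_iff)
    hence "v \<in> \<sigma>" "\<tau> = \<sigma> - {v}" using \<tau>(1) by auto
    thus "\<tau> \<in> (\<lambda>v. \<sigma> - {v}) ` \<sigma>" by blast
  next
    fix \<tau> assume "\<tau> \<in> (\<lambda>v. \<sigma> - {v}) ` \<sigma>"
    then obtain v where "v \<in> \<sigma>" "\<tau> = \<sigma> - {v}" by blast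
    moreover from this have "card \<tau> = Suc k" using card\<sigma> by simp
    moreover from this have "\<tau> \<noteq> {}" by auto
    ultimately show "\<tau> \<in> simplices k ?S" by (auto simp: simplices_def simplex_boundary_def)
  qed
  have bij: "bij_betw (\<lambda>i. \<sigma> - {vs ! i}) {..Suc k} (simplices k ?S)"
  proof -
    have "bij_betw (\<lambda>i. vs ! i) {..Suc k} \<sigma>" by (rule bij_betw_nth) (use v vs in auto)
    moreover have "bij_betw (\<lambda>v. \<sigma> - {v}) \<sigma> (simplices k ?S)"
      unfolding facets by (rule inj_on_imp_bij_betw) (auto simp: inj_on_def)
    ultimately show ?thesis using bij_betw_trans by (fastforce simp: o_def)
  qed
  have pair: "facet_pairing \<phi> = (\<Sum>i\<le>Suc k. ?o (F i) * \<phi> (F i))"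
    unfolding facet_pairing_def sum.reindex_bij_betw[OF bij, symmetric]
  proof (rule sum.cong[OF refl])
    fix i assume "i \<in> {..Suc k}"
    hence i: "i \<le> Suc k" by simp
    have "mset (F i) = mset (chosen_order (\<sigma> - {vs ! i}))" using mset_chosen_order F[OF i] by metis
    thus "?o (chosen_order (\<sigma> - {vs ! i})) * \<phi> (chosen_order (\<sigma> - {vs ! i})) = ?o (F i) * \<phi> (F i)"
      using alternating_mult_mset[OF orientation_alternating cochain_alternating[OF \<phi>]] F(2)[OF i] by metis
  qed
  have step: "?o (F (Suc i)) = - ?o (F i)" if i: "i \<le> k" for i
  proof -
    let ?us = "take i vs" and ?ws = "drop (Suc (Suc i)) vs"
    have l: "i < length vs" "Suc i < length vs" using i v by auto
    have F0: "F i = ?us @ vs ! Suc i # ?ws" unfolding F_def using Cons_nth_drop_Suc[OF l(2)] by simp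
    have F1: "F (Suc i) = ?us @ vs ! i # ?ws" unfolding F_def using take_Suc_conv_app_nth[OF l(1)] by simp
    have sp: "vs = ?us @ vs ! i # vs ! Suc i # ?ws"
      using split[of i] i Cons_nth_drop_Suc[OF l(2)] by simp
    let ?\<rho> = "?us @ ?ws"
    have d: "distinct (?us @ vs ! i # vs ! Suc i # ?ws)" using v(1) sp by metis
    have s: "\<sigma> = set (?us @ vs ! i # vs ! Suc i # ?ws)" using vs(2) sp by metis
    have \<rho>: "distinct ?\<rho>" "length ?\<rho> = k" "vs ! i \<notin> set ?\<rho>" "vs ! Suc i \<notin> set ?\<rho>" "vs ! i \<noteq> vs ! Suc i"
      using d i v(2) by auto
    have psub: "R \<subset> insert x (insert y R) \<and> insert x R \<subset> insert x (insert y R) \<and> insert y R \<subset> insert x (insert y R)"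
      if "x \<notin> R" "y \<notin> R" "x \<noteq> y" for x y :: 'v and R
      using that unfolding less_le_not_le by blast
    have s': "\<sigma> = insert (vs ! i) (insert (vs ! Suc i) (set ?\<rho>))" unfolding s by auto
    have \<rho>': "set ?\<rho> \<subset> \<sigma>" "insert (vs ! i) (set ?\<rho>) \<subset> \<sigma>" "insert (vs ! Suc i) (set ?\<rho>) \<subset> \<sigma>"
      using psub[OF \<rho>(3-5)] unfolding s' by blast+
    have "set ?\<rho> \<noteq> {}" using \<rho>(2) assms(2) by (metis list.size(3) not_one_le_zero set_empty)
    hence "set ?\<rho> \<in> ?S" using \<rho>'(1) by (simp add: simplex_boundary_def)
    then obtain v w where vw: "{u. u \<notin> set ?\<rho> \<and> insert u (set ?\<rho>) \<in> ?S} = {v, w}"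
        "?o (v # ?\<rho>) + ?o (w # ?\<rho>) = 0" using ridge_facets[OF _ \<rho>(1,2)] by blast
    have "vs ! i \<in> {v, w}" "vs ! Suc i \<in> {v, w}" using \<rho>(3,4) \<rho>'(2,3) unfolding vw(1)[symmetric] simplex_boundary_def by auto
    hence "?o (vs ! i # ?\<rho>) + ?o (vs ! Suc i # ?\<rho>) = 0" using vw(2) \<rho>(5) by (auto simp: add.commute)
    moreover have "?o (F i) = (-1) ^ length ?us * ?o (vs ! Suc i # ?\<rho>)"
      unfolding F0 by (rule alternating_move_front[OF orientation_alternating]) (use i v in simp)
    moreover have "?o (F (Suc i)) = (-1) ^ length ?us * ?o (vs ! i # ?\<rho>)"
      unfolding F1 by (rule alternating_move_front[OF orientation_alternating]) (use i v in simp)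
    ultimately show ?thesis by (simp add: eq_neg_iff_add_eq_0 flip: distrib_left)
  qed
  have sgnF: "?o (F i) = (-1) ^ i * ?o (F 0)" if "i \<le> Suc k" for i
    using that by (induction i) (simp_all add: step)
  have "facet_pairing \<phi> = ?o (F 0) * (\<Sum>i\<le>Suc k. (-1) ^ i * \<phi> (F i))"
    unfolding pair sum_distrib_left
  proof (rule sum.cong[OF refl])
    fix i assume "i \<in> {..Suc k}"
    hence "?o (F i) = (-1) ^ i * ?o (F 0)" by (intro sgnF) simp
    thus "?o (F i) * \<phi> (F i) = ?o (F 0) * ((-1) ^ i * \<phi> (F i))" by (simp only: mult_ac)
  qed
  also have "(\<Sum>i\<le>Suc k. (-1) ^ i * \<phi> (F i)) = coboundary X k \<phi> vs"
    using vs(1) by (simp add: coboundary_def F_def del: sum.atMost_Suc)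
  finally have eq: "facet_pairing \<phi> = ?o (F 0) * coboundary X k \<phi> vs" .
  obtain c where c: "c \<in> interior P" "\<And>vs. ?o vs = sgn (det (cone_matrix c r vs))"
    using orientation_sign_eq_sgn_det[of ?S r] interior_P by metis
  have "set (F 0) \<in> simplices k ?S" using F(3)[of 0] bij by (auto simp: bij_betw_def)
  hence "det (cone_matrix c r (F 0)) \<noteq> 0" using det_cone_matrix_nonzero[of "F 0" c] F(2)[of 0] c(1) by simp
  hence "(?o (F 0))\<^sup>2 = 1" unfolding c(2) by (simp add: sgn_if)
  thus ?thesis unfolding eq by (simp add: power_mult_distrib)
qed

section \<open>Spectral gap\<close>

definition weighted_inner :: "'a set \<Rightarrow> ('a \<Rightarrow> real) \<Rightarrow> ('a \<Rightarrow> real) \<Rightarrow> ('a \<Rightarrow> real) \<Rightarrow> real" where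
  "weighted_inner Z w f g = (\<Sum>z\<in>Z. w z * f z * g z)"

definition function_subspace :: "('a \<Rightarrow> real) set \<Rightarrow> bool" where
  "function_subspace V \<longleftrightarrow> (\<lambda>_. 0) \<in> V \<and> (\<forall>f\<in>V. \<forall>g\<in>V. \<forall>c. (\<lambda>z. f z + c * g z) \<in> V)"

lemma function_subspace_add: "function_subspace V \<Longrightarrow> f \<in> V \<Longrightarrow> g \<in> V \<Longrightarrow> (\<lambda>z. f z + c * g z) \<in> V"
  unfolding function_subspace_def by blast

lemma function_subspace_diff: "function_subspace V \<Longrightarrow> f \<in> V \<Longrightarrow> g \<in> V \<Longrightarrow> (\<lambda>z. f z - g z) \<in> V"
  using function_subspace_add[of V f g "-1"] by simp

lemma function_subspace_scale: "function_subspace V \<Longrightarrow> f \<in> V \<Longrightarrow> (\<lambda>z. c * f z) \<in> V"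
  using function_subspace_add[of V "\<lambda>_. 0" f c] unfolding function_subspace_def by simp

lemma weighted_inner_commute: "weighted_inner Z w f g = weighted_inner Z w g f"
  unfolding weighted_inner_def by (simp add: mult_ac)

lemma weighted_inner_add_right: "weighted_inner Z w f (\<lambda>z. g z + c * h z) = weighted_inner Z w f g + c * weighted_inner Z w f h"
  unfolding weighted_inner_def by (simp add: algebra_simps sum.distrib sum_distrib_left)

lemma weighted_inner_add_left: "weighted_inner Z w (\<lambda>z. g z + c * h z) f = weighted_inner Z w g f + c * weighted_inner Z w h f"
  unfolding weighted_inner_def by (simp add: algebra_simps sum.distrib sum_distrib_left)

lemma weighted_inner_expand:
  "weighted_inner Z w (\<lambda>z. f z + t * g z) (\<lambda>z. f z + t * g z) = weighted_inner Z w f f + 2 * t * weighted_inner Z w f g + t * t * weighted_inner Z w g g"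
  using weighted_inner_commute[of Z w g f] by (simp add: weighted_inner_add_left weighted_inner_add_right algebra_simps)

lemma weighted_inner_nonneg: "(\<And>z. z \<in> Z \<Longrightarrow> w z \<ge> 0) \<Longrightarrow> weighted_inner Z w f f \<ge> 0"
  unfolding weighted_inner_def by (intro sum_nonneg) (simp add: mult.assoc)

lemma weighted_inner_eq_0_iff:
  assumes "finite Z" "\<forall>z\<in>Z. w z > 0"
  shows "weighted_inner Z w f f = 0 \<longleftrightarrow> (\<forall>z\<in>Z. f z = 0)"
proof -
  have "weighted_inner Z w f f = (\<Sum>z\<in>Z. w z * (f z * f z))" unfolding weighted_inner_def by (simp add: mult.assoc)
  also have "\<dots> = 0 \<longleftrightarrow> (\<forall>z\<in>Z. w z * (f z * f z) = 0)"
    by (rule sum_nonneg_eq_0_iff) (auto simp: assms less_imp_le)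
  finally show ?thesis using assms(2) by force
qed

lemma weighted_inner_coordinate_bound:
  assumes "finite Z" "\<forall>z\<in>Z. w z > 0" "z \<in> Z" "weighted_inner Z w f f \<le> B"
  shows "\<bar>f z\<bar> \<le> sqrt (B / w z)"
proof -
  have "w z * f z * f z \<le> weighted_inner Z w f f" unfolding weighted_inner_def
    by (rule member_le_sum) (use assms(1,3) in \<open>auto simp: mult.assoc assms(2) less_imp_le\<close>)
  hence "(f z)\<^sup>2 \<le> B / w z" using bspec[OF assms(2,3)] assms(4) by (simp add: pos_le_divide_eq power2_eq_square mult_ac)
  thus ?thesis using real_le_rsqrt[of "\<bar>f z\<bar>"] by simp
qed

text \<open>The first-order condition at a minimum.\<close>
lemma nonneg_quadratic_linear_term:
  fixes a b :: real
  assumes "\<And>t. 2 * t * b + t * t * a \<ge> 0"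
  shows "b = 0"
proof (rule ccontr)
  assume "b \<noteq> 0"
  define e where "e = \<bar>a\<bar> + 1"
  have e: "e > 0" "a < e" by (auto simp: e_def)
  have "2 * (-b/e) * b + (-b/e) * (-b/e) * a = (b * b / e) * (a / e - 2)"
    using e by (simp add: field_simps)
  moreover have "b * b / e > 0" using \<open>b \<noteq> 0\<close> e by (simp add: zero_less_mult_iff zero_less_divide_iff) linarith
  moreover have "a / e < 1" using e by simp
  hence "(b * b / e) * (a / e - 2) < 0" by (intro mult_pos_neg) (use \<open>b * b / e > 0\<close> in auto)
  ultimately have "2 * (-b/e) * b + (-b/e) * (-b/e) * a < 0" by (simp only:)
  thus False using assms[of "-b/e"] by linarith
qed

lemma compact_function_box: "compact {f :: 'a \<Rightarrow> real. \<forall>z. f z \<in> (if z \<in> Z then {-C..C} else {0})}"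
proof -
  have "{f :: 'a \<Rightarrow> real. \<forall>z. f z \<in> (if z \<in> Z then {-C..C} else {0})} = (\<Pi>\<^sub>E z\<in>UNIV. if z \<in> Z then {-C..C} else {0})"
    by (auto simp: PiE_def Pi_def extensional_def)
  moreover have "compactin (product_topology (\<lambda>_. euclidean) UNIV) (\<Pi>\<^sub>E z\<in>(UNIV :: 'a set). if z \<in> Z then {-C..C::real} else {0})"
    unfolding compactin_PiE by auto
  ultimately show ?thesis by (simp add: euclidean_product_topology)
qed

lemma continuous_weighted_inner:
  "continuous_on UNIV (\<lambda>f. weighted_inner Z w f g)" "continuous_on UNIV (\<lambda>f. weighted_inner Z w f f)"
  unfolding weighted_inner_def by (intro continuous_intros continuous_on_product_coordinates)+

text \<open>Functions with support in the finite set \<open>Z\<close> and bounded norm lie in a cube, which is compact in the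
product topology. This yields minimisers in function spaces that carry no norm.\<close>
lemma compact_bounded_section:
  fixes Z :: "'a set" and V A :: "('a \<Rightarrow> real) set"
  assumes "finite Z" "\<forall>z\<in>Z. w z > 0" "closed V" "\<forall>f\<in>V. \<forall>z. z \<notin> Z \<longrightarrow> f z = 0"
    and "closed A" "\<And>f. f \<in> V \<Longrightarrow> f \<in> A \<Longrightarrow> weighted_inner Z w f f \<le> B"
  shows "compact (V \<inter> A)"
proof -
  define C where "C = (\<Sum>z\<in>Z. sqrt (\<bar>B\<bar> / w z))"
  let ?box = "{f :: 'a \<Rightarrow> real. \<forall>z. f z \<in> (if z \<in> Z then {-C..C} else {0})}"
  have "V \<inter> A \<subseteq> ?box"
  proof
    fix f assume f: "f \<in> V \<inter> A"
    have "\<bar>f z\<bar> \<le> C" if z: "z \<in> Z" for z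
    proof -
      have "\<bar>f z\<bar> \<le> sqrt (\<bar>B\<bar> / w z)"
        using weighted_inner_coordinate_bound[where f = f and B = "\<bar>B\<bar>", OF assms(1,2) z] assms(6)[of f] f by force
      also have "\<dots> \<le> C" unfolding C_def
        by (rule member_le_sum[OF z]) (auto simp: assms(1,2) less_imp_le)
      finally show ?thesis .
    qed
    thus "f \<in> ?box" using f assms(4) by (force simp: abs_le_iff)
  qed
  hence "V \<inter> A = ?box \<inter> (V \<inter> A)" by blast
  moreover have "compact (?box \<inter> (V \<inter> A))"
    by (rule compact_Int_closed[OF compact_function_box closed_Int[OF assms(3,5)]])
  ultimately show ?thesis by simp
qed

text \<open>The point of \<open>U\<close> nearest to \<open>\<phi>\<close>, which exists by compactness.\<close>
lemma orthogonal_projection: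
  assumes Z: "finite Z" "\<forall>z\<in>Z. w z > 0" and U: "closed U" "function_subspace U" "\<forall>f\<in>U. \<forall>z. z \<notin> Z \<longrightarrow> f z = 0"
  shows "\<exists>p\<in>U. \<forall>u\<in>U. weighted_inner Z w (\<lambda>z. \<phi> z - p z) u = 0"
proof -
  define N where "N f = weighted_inner Z w (\<lambda>z. \<phi> z - f z) (\<lambda>z. \<phi> z - f z)" for f
  have contN: "continuous_on UNIV N"
    unfolding N_def weighted_inner_def by (intro continuous_intros continuous_on_product_coordinates)
  let ?A = "{f. N f \<le> N (\<lambda>_. 0)}"
  have zero: "(\<lambda>_. 0) \<in> U \<inter> ?A" using U(2) by (simp add: function_subspace_def)
  have "compact (U \<inter> ?A)"
  proof (rule compact_bounded_section[where V = U and Z = Z and w = w, OF Z U(1,3), where B = "4 * N (\<lambda>_. 0)"])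
    show "closed ?A" using contN by (intro closed_Collect_le continuous_on_const) auto
    fix f assume "f \<in> ?A"
    hence f: "N f \<le> N (\<lambda>_. 0)" by simp
    \<comment> \<open>\<open>|f|^2 + |2 \<phi> - f|^2 = 2 |\<phi> - f|^2 + 2 |\<phi>|^2\<close>\<close>
    have "weighted_inner Z w f f + weighted_inner Z w (\<lambda>z. 2 * \<phi> z - f z) (\<lambda>z. 2 * \<phi> z - f z) = 2 * N f + 2 * N (\<lambda>_. 0)"
      unfolding N_def weighted_inner_def sum_distrib_left sum.distrib[symmetric]
      by (rule sum.cong) (auto simp: algebra_simps)
    moreover have "weighted_inner Z w (\<lambda>z. 2 * \<phi> z - f z) (\<lambda>z. 2 * \<phi> z - f z) \<ge> 0"
      by (rule weighted_inner_nonneg) (use Z(2) less_imp_le in blast)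
    ultimately show "weighted_inner Z w f f \<le> 4 * N (\<lambda>_. 0)" using f by linarith
  qed
  then obtain p where p: "p \<in> U \<inter> ?A" "\<And>f. f \<in> U \<inter> ?A \<Longrightarrow> N p \<le> N f"
    using continuous_attains_inf[of "U \<inter> ?A" N] zero continuous_on_subset[OF contN] by blast
  have min: "N p \<le> N f" if "f \<in> U" for f using p(1) p(2)[of f] that by (cases "f \<in> ?A") auto
  have "weighted_inner Z w (\<lambda>z. \<phi> z - p z) u = 0" if u: "u \<in> U" for u
  proof (rule nonneg_quadratic_linear_term)
    fix t
    have "N (\<lambda>z. p z + (-t) * u z) = N p + 2 * t * weighted_inner Z w (\<lambda>z. \<phi> z - p z) u + t * t * weighted_inner Z w u u"
      using weighted_inner_expand[of Z w "\<lambda>z. \<phi> z - p z" t u] unfolding N_def by (simp add: algebra_simps)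
    moreover have "N p \<le> N (\<lambda>z. p z + (-t) * u z)"
      by (rule min[OF function_subspace_add[OF U(2) _ u]]) (use p(1) in blast)
    ultimately show "2 * t * weighted_inner Z w (\<lambda>z. \<phi> z - p z) u + t * t * weighted_inner Z w u u \<ge> 0" by linarith
  qed
  thus ?thesis using p(1) by blast
qed

text \<open>The Rayleigh quotient of \<open>B f f = |L f|\<^sup>2\<close> on the orthogonal complement \<open>W\<close> of the kernel attains its minimum \<open>\<mu>\<close>. The
minimiser is an eigenvector: the first variation vanishes in the directions of \<open>W\<close> by minimality, and both
forms vanish in the directions of the kernel. Since the minimiser is not in the kernel, \<open>\<mu>\<close> is a
nonzero eigenvalue.\<close>
lemma spectral_gap_of_eigenvalues:
  fixes L :: "('a \<Rightarrow> real) \<Rightarrow> 'b \<Rightarrow> real"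
  assumes Z: "finite Z" "\<forall>z\<in>Z. w z > 0"
    and V: "closed V" "function_subspace V" "\<forall>f\<in>V. \<forall>z. z \<notin> Z \<longrightarrow> f z = 0"
    and Y: "finite Y" "\<forall>y\<in>Y. v y > 0"
    and L: "\<And>y. continuous_on UNIV (\<lambda>f. L f y)" "\<And>f g c. L (\<lambda>z. f z + c * g z) = (\<lambda>y. L f y + c * L g y)"
    and eig: "\<And>\<mu> f. f \<in> V \<Longrightarrow> f \<noteq> (\<lambda>_. 0) \<Longrightarrow>
      (\<And>g. g \<in> V \<Longrightarrow> weighted_inner Y v (L f) (L g) = \<mu> * weighted_inner Z w f g) \<Longrightarrow> \<mu> \<noteq> 0 \<Longrightarrow> \<mu> \<ge> lam"
    and \<phi>: "\<phi> \<in> V"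
  shows "\<exists>p\<in>V. (\<forall>y\<in>Y. L p y = 0) \<and>
    lam * weighted_inner Z w (\<lambda>z. \<phi> z - p z) (\<lambda>z. \<phi> z - p z) \<le> weighted_inner Y v (L \<phi>) (L \<phi>)"
proof -
  let ?I = "weighted_inner Z w" and ?B = "\<lambda>f g. weighted_inner Y v (L f) (L g)"
  have contB: "continuous_on UNIV (\<lambda>f. ?B f f)" unfolding weighted_inner_def by (intro continuous_intros L(1))
  have L0: "L (\<lambda>_. 0) = (\<lambda>_. 0)" using L(2)[of "\<lambda>_. 0" "-1" "\<lambda>_. 0"] by (simp add: fun_eq_iff)
  define U where "U = {f \<in> V. \<forall>y\<in>Y. L f y = 0}"
  define W where "W = {f \<in> V. \<forall>u\<in>U. ?I f u = 0}"
  have U_eq: "U = V \<inter> (\<Inter>y\<in>Y. {f. L f y = 0})" by (auto simp: U_def)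
  have W_eq: "W = V \<inter> (\<Inter>u\<in>U. {f. ?I f u = 0})" by (auto simp: W_def)
  have clU: "closed U" unfolding U_eq
    by (intro closed_Int V(1) closed_INT ballI closed_Collect_eq L(1) continuous_on_const)
  have clW: "closed W" unfolding W_eq
    by (intro closed_Int V(1) closed_INT ballI closed_Collect_eq continuous_weighted_inner continuous_on_const)
  have sU: "function_subspace U" using V(2) unfolding function_subspace_def U_def by (auto simp: L(2) L0)
  have sW: "function_subspace W"
    using V(2) unfolding function_subspace_def W_def by (auto simp: weighted_inner_add_left) (simp add: weighted_inner_def)
  have suppU: "\<forall>f\<in>U. \<forall>z. z \<notin> Z \<longrightarrow> f z = 0" and suppW: "\<forall>f\<in>W. \<forall>z. z \<notin> Z \<longrightarrow> f z = 0"
    using V(3) unfolding U_def W_def by blast+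
  have decomp: "\<exists>p\<in>U. (\<lambda>z. f z - p z) \<in> W" if f: "f \<in> V" for f
  proof -
    obtain p where p: "p \<in> U" "\<forall>u\<in>U. ?I (\<lambda>z. f z - p z) u = 0"
      using orthogonal_projection[OF Z clU sU suppU] by blast
    hence "(\<lambda>z. f z - p z) \<in> W" using function_subspace_diff[OF V(2) f, of p] by (simp add: W_def U_def)
    thus ?thesis using p(1) by blast
  qed
  have BU: "?B f u = 0" if "u \<in> U" for f u using that unfolding U_def weighted_inner_def by simp
  obtain p where p: "p \<in> U" "(\<lambda>z. \<phi> z - p z) \<in> W" using decomp[OF \<phi>] by blast
  let ?\<chi> = "\<lambda>z. \<phi> z - p z"
  have L\<chi>: "\<forall>y\<in>Y. L ?\<chi> y = L \<phi> y" using L(2)[of \<phi> "-1" p] p(1) by (simp add: U_def)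
  have B\<chi>: "?B ?\<chi> ?\<chi> = ?B \<phi> \<phi>" unfolding weighted_inner_def using L\<chi> by simp
  have gap: "lam * ?I f f \<le> ?B f f" if fW: "f \<in> W" for f
  proof (cases "?I f f = 0")
    case True
    thus ?thesis using weighted_inner_nonneg[of Y v "L f"] Y(2) less_imp_le by auto
  next
    case False
    have pos: "?I g g \<ge> 0" for g by (rule weighted_inner_nonneg) (use Z(2) less_imp_le in blast)
    let ?A = "{g. ?I g g = 1}"
    have compact: "compact (W \<inter> ?A)"
      by (rule compact_bounded_section[where V = W and Z = Z and w = w, OF Z clW suppW, where B = 1])
        (auto intro!: closed_Collect_eq continuous_weighted_inner continuous_on_const)
    have scaleI: "?I (\<lambda>z. c * g z) (\<lambda>z. c * g z) = c * c * ?I g g" for c g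
      unfolding weighted_inner_def by (simp add: sum_distrib_left mult_ac)
    have Lscale: "L (\<lambda>z. c * g z) = (\<lambda>y. c * L g y)" for c g using L(2)[of "\<lambda>_. 0" c g] L0 by simp
    have scaleB: "?B (\<lambda>z. c * g z) (\<lambda>z. c * g z) = c * c * ?B g g" for c g
      unfolding weighted_inner_def Lscale by (simp add: sum_distrib_left mult_ac)
    have normalise: "\<exists>c. c * c * ?I g g = 1 \<and> (\<lambda>z. c * g z) \<in> W \<inter> ?A" if g: "g \<in> W" "?I g g \<noteq> 0" for g
    proof -
      have "1 / sqrt (?I g g) * (1 / sqrt (?I g g)) * ?I g g = 1"
        using pos[of g] g(2) by (simp add: real_sqrt_mult[symmetric] field_simps)
      then obtain c where c: "c * c * ?I g g = 1" by blast
      hence "(\<lambda>z. c * g z) \<in> W \<inter> ?A" using function_subspace_scale[OF sW g(1), of c] scaleI[of c g] by simp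
      thus ?thesis using c by blast
    qed
    have "W \<inter> ?A \<noteq> {}" using normalise[OF fW False] by blast
    then obtain e where e: "e \<in> W \<inter> ?A" "\<And>g. g \<in> W \<inter> ?A \<Longrightarrow> ?B e e \<le> ?B g g"
      using continuous_attains_inf[OF compact, of "\<lambda>f. ?B f f"] continuous_on_subset[OF contB] by blast
    define \<mu> where "\<mu> = ?B e e"
    have eV: "e \<in> V" and eW: "e \<in> W" and e1: "?I e e = 1" using e(1) by (auto simp: W_def)
    have ray: "\<mu> * ?I g g \<le> ?B g g" if g: "g \<in> W" for g
    proof (cases "?I g g = 0")
      case True thus ?thesis using weighted_inner_nonneg[of Y v "L g"] Y(2) less_imp_le by auto
    next
      case False
      then obtain c where c: "c * c * ?I g g = 1" "(\<lambda>z. c * g z) \<in> W \<inter> ?A" using normalise[OF g] by blast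
      have "\<mu> \<le> c * c * ?B g g" using e(2)[OF c(2)] by (simp add: \<mu>_def scaleB)
      hence "\<mu> * ?I g g \<le> c * c * ?B g g * ?I g g" using pos by (intro mult_right_mono) auto
      also have "\<dots> = (c * c * ?I g g) * ?B g g" by (simp add: mult_ac)
      finally show ?thesis unfolding c(1) by simp
    qed
    have critW: "?B e g - \<mu> * ?I e g = 0" if g: "g \<in> W" for g
    proof (rule nonneg_quadratic_linear_term)
      fix t
      have "\<mu> * ?I (\<lambda>z. e z + t * g z) (\<lambda>z. e z + t * g z) \<le> ?B (\<lambda>z. e z + t * g z) (\<lambda>z. e z + t * g z)"
        by (rule ray[OF function_subspace_add[OF sW eW g]])
      hence "\<mu> * (1 + 2 * t * ?I e g + t * t * ?I g g) \<le> \<mu> + 2 * t * ?B e g + t * t * ?B g g"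
        unfolding L(2) weighted_inner_expand e1 \<mu>_def .
      thus "2 * t * (?B e g - \<mu> * ?I e g) + t * t * (?B g g - \<mu> * ?I g g) \<ge> 0"
        by (simp add: algebra_simps)
    qed
    have crit: "?B e g = \<mu> * ?I e g" if g: "g \<in> V" for g
    proof -
      obtain u where u: "u \<in> U" "(\<lambda>z. g z - u z) \<in> W" using decomp[OF g] by blast
      have g_eq: "g = (\<lambda>z. (g z - u z) + 1 * u z)" by simp
      have "?B e g = ?B e (\<lambda>z. g z - u z) + 1 * ?B e u" by (subst g_eq, subst L(2), rule weighted_inner_add_right)
      moreover have "?I e g = ?I e (\<lambda>z. g z - u z) + 1 * ?I e u" by (subst g_eq, rule weighted_inner_add_right)
      moreover have "?I e u = 0" using eW u(1) by (simp add: W_def)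
      ultimately show ?thesis using critW[OF u(2)] BU[OF u(1)] by simp
    qed
    have "\<mu> \<noteq> 0"
    proof
      assume "\<mu> = 0"
      hence "\<forall>y\<in>Y. L e y = 0" using weighted_inner_eq_0_iff[OF Y, of "L e"] by (simp add: \<mu>_def)
      hence "e \<in> U" using eV by (simp add: U_def)
      hence "?I e e = 0" using eW by (simp add: W_def)
      thus False using e1 by simp
    qed
    moreover have "e \<noteq> (\<lambda>_. 0)" using e1 by (auto simp: weighted_inner_def)
    ultimately have "\<mu> \<ge> lam" using eig[OF eV _ crit] by blast
    hence "lam * ?I f f \<le> \<mu> * ?I f f" using pos by (intro mult_right_mono)
    thus ?thesis using ray[OF fW] by linarith
  qed
  show ?thesis using gap[OF p(2)] p(1) unfolding B\<chi> U_def by blast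
qed

lemma closed_cochains: "closed (cochains i X)"
proof -
  have eq: "cochains i X = (\<Inter>vs\<in>- ordered_simplices i X. {\<phi>. \<phi> vs = 0}) \<inter>
      (\<Inter>vs\<in>ordered_simplices i X. \<Inter>\<pi>\<in>{\<pi>. \<pi> permutes {..<Suc i}}.
        {\<phi>. \<phi> (permute_list \<pi> vs) = of_int (sign \<pi>) * \<phi> vs})"
    unfolding cochains_def by auto
  show ?thesis unfolding eq
    by (intro closed_Int closed_INT ballI closed_Collect_eq continuous_intros continuous_on_product_coordinates)
qed

lemma function_subspace_cochains: "function_subspace (cochains i X)"
  unfolding function_subspace_def cochains_def by (auto simp: algebra_simps)

lemma coboundary_linear:
  "coboundary X i (\<lambda>z. f z + c * g z) = (\<lambda>y. coboundary X i f y + c * coboundary X i g y)"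
  unfolding coboundary_def
  by (rule ext) (simp add: sum.distrib sum_distrib_left algebra_simps del: sum.atMost_Suc)

lemma continuous_coboundary: "continuous_on UNIV (\<lambda>\<phi>. coboundary X i \<phi> vs)"
proof (cases "vs \<in> ordered_simplices (Suc i) X")
  case True
  thus ?thesis unfolding coboundary_def
    by (simp del: sum.atMost_Suc) (intro continuous_intros continuous_on_product_coordinates)
qed (simp add: coboundary_def)

lemma finite_ordered_simplices:
  assumes "finite X" "abstract_complex X"
  shows "finite (ordered_simplices i X)"
proof (rule finite_subset)
  show "ordered_simplices i X \<subseteq> {vs. set vs \<subseteq> \<Union>X \<and> length vs = Suc i}" by (auto simp: ordered_simplices_def)
  have "finite (\<Union>X)" using assms by (auto simp: abstract_complex_def)
  thus "finite {vs. set vs \<subseteq> \<Union>X \<and> length vs = Suc i}" by (rule finite_lists_length_eq)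
qed

lemma simplex_weight_pos:
  assumes "finite X" "pure_complex n X" "\<tau> \<in> X"
  shows "simplex_weight n X \<tau> > 0"
proof -
  have "{\<sigma> \<in> simplices n X. \<tau> \<subseteq> \<sigma>} \<noteq> {}" using assms(2,3) by (auto simp: pure_complex_def)
  moreover have "finite {\<sigma> \<in> simplices n X. \<tau> \<subseteq> \<sigma>}" using assms(1) by (simp add: simplices_def)
  ultimately show ?thesis by (simp add: simplex_weight_def card_gt_0_iff)
qed

lemma cochain_inner_eq_weighted_inner:
  "cochain_inner n X i = weighted_inner (ordered_simplices i X) (\<lambda>vs. simplex_weight n X (set vs) / fact (i + 1))"
  by (simp add: fun_eq_iff cochain_inner_def weighted_inner_def)

text \<open>Modulo cocycles the coboundary is bounded below by the spectral gap. The positive weights make the inner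
product definite, so that the adjoint is uniquely determined and the minimiser of the Rayleigh quotient is an
eigenvector of \<open>up_laplacian\<close>.\<close>
lemma up_spectrum_gap:
  assumes X: "finite X" "pure_complex n X"
    and spec: "up_spectrum n X k - {0} \<subseteq> {lam..}" and \<phi>: "\<phi> \<in> cochains k X"
  shows "\<exists>\<psi>\<in>cocycles X k. lam * cochain_inner n X k (\<lambda>vs. \<phi> vs - \<psi> vs) (\<lambda>vs. \<phi> vs - \<psi> vs)
    \<le> cochain_inner n X (Suc k) (coboundary X k \<phi>) (coboundary X k \<phi>)"
proof -
  let ?Z = "\<lambda>i. ordered_simplices i X" and ?w = "\<lambda>i vs. simplex_weight n X (set vs) / fact (i + 1)"
  have "abstract_complex X" using X(2) by (simp add: pure_complex_def)
  hence fin: "finite (?Z i)" for i using finite_ordered_simplices X(1) by blast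
  have pos: "\<forall>vs\<in>?Z i. ?w i vs > 0" for i
    using simplex_weight_pos[OF X] by (simp add: ordered_simplices_def)
  have supp: "\<forall>f\<in>cochains k X. \<forall>z. z \<notin> ?Z k \<longrightarrow> f z = 0" by (simp add: cochains_def)
  have eig: "\<mu> \<ge> lam" if f: "f \<in> cochains k X" "f \<noteq> (\<lambda>_. 0)"
    and ev: "\<And>g. g \<in> cochains k X \<Longrightarrow> cochain_inner n X (Suc k) (coboundary X k f) (coboundary X k g) = \<mu> * cochain_inner n X k f g"
    and nz: "\<mu> \<noteq> 0" for \<mu> f
  proof -
    let ?\<theta> = "\<lambda>vs. \<mu> * f vs"
    let ?P = "\<lambda>\<theta>. \<theta> \<in> cochains k X \<and> (\<forall>\<phi>\<in>cochains k X.
        cochain_inner n X (Suc k) (coboundary X k \<phi>) (coboundary X k f) = cochain_inner n X k \<phi> \<theta>)"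
    have comm: "cochain_inner n X i g h = cochain_inner n X i h g" for i g h
      unfolding cochain_inner_eq_weighted_inner by (rule weighted_inner_commute)
    have "cochain_inner n X k \<phi> ?\<theta> = \<mu> * cochain_inner n X k f \<phi>" for \<phi>
      unfolding cochain_inner_def by (simp add: sum_distrib_left mult_ac)
    hence P: "?P ?\<theta>" using function_subspace_scale[OF function_subspace_cochains f(1)] ev comm by metis
    have unique: "\<theta> = ?\<theta>" if "?P \<theta>" for \<theta>
    proof -
      let ?\<delta> = "\<lambda>vs. \<theta> vs - ?\<theta> vs"
      have \<delta>: "?\<delta> \<in> cochains k X" using function_subspace_diff[OF function_subspace_cochains] that P by blast
      have "cochain_inner n X k ?\<delta> \<theta> = cochain_inner n X k ?\<delta> ?\<theta>" using that P \<delta> by metis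
      moreover have "cochain_inner n X k ?\<delta> ?\<delta> = cochain_inner n X k ?\<delta> \<theta> + (-1) * cochain_inner n X k ?\<delta> ?\<theta>"
        unfolding cochain_inner_eq_weighted_inner weighted_inner_add_right[symmetric] by simp
      ultimately have "weighted_inner (?Z k) (?w k) ?\<delta> ?\<delta> = 0" by (simp add: cochain_inner_eq_weighted_inner)
      hence "\<forall>vs\<in>?Z k. ?\<delta> vs = 0" using weighted_inner_eq_0_iff[OF fin pos, of k ?\<delta>] by simp
      hence "?\<delta> vs = 0" for vs using bspec[OF supp \<delta>] by (cases "vs \<in> ?Z k") simp_all
      thus ?thesis by (simp add: fun_eq_iff)
    qed
    have "up_laplacian n X k f = ?\<theta>"
      unfolding up_laplacian_def coboundary_adjoint_def
    proof (rule the_equality)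
      show "?P ?\<theta>" by (rule P)
      show "\<theta> = ?\<theta>" if "?P \<theta>" for \<theta> using that by (rule unique)
    qed
    hence "\<mu> \<in> up_spectrum n X k" using f by (auto simp: up_spectrum_def)
    thus ?thesis using spec nz by auto
  qed
  obtain p where p: "p \<in> cochains k X" "\<forall>y\<in>?Z (Suc k). coboundary X k p y = 0"
    "lam * cochain_inner n X k (\<lambda>vs. \<phi> vs - p vs) (\<lambda>vs. \<phi> vs - p vs) \<le> cochain_inner n X (Suc k) (coboundary X k \<phi>) (coboundary X k \<phi>)"
    using spectral_gap_of_eigenvalues[of "?Z k" "?w k" "cochains k X" "?Z (Suc k)" "?w (Suc k)" "coboundary X k" lam \<phi>,
        OF fin pos closed_cochains function_subspace_cochains supp fin pos continuous_coboundary coboundary_linear _ \<phi>]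
      eig unfolding cochain_inner_eq_weighted_inner by blast
  have "coboundary X k p = (\<lambda>_. 0)" using p(2) by (auto simp: coboundary_def fun_eq_iff)
  thus ?thesis using p(1,3) by (auto simp: cocycles_def)
qed

section \<open>Balls in the gallery metric\<close>

text \<open>One step of a gallery, seen from the \<open>k\<close>-simplices through which it passes.\<close>
definition joined :: "'v set set \<Rightarrow> 'v set set \<Rightarrow> ('v set \<times> 'v set) set" where
  "joined V F = {(\<tau>, \<tau>'). \<tau> \<in> V \<and> \<tau>' \<in> V \<and> (\<exists>\<sigma>\<in>F. \<tau> \<subseteq> \<sigma> \<and> \<tau>' \<subseteq> \<sigma>)}"

text \<open>The graph distance; meaningful for pairs in the reflexive transitive closure of \<open>R\<close>.\<close>
definition steps :: "('a \<times> 'a) set \<Rightarrow> 'a \<Rightarrow> 'a \<Rightarrow> nat" where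
  "steps R x y = (LEAST j. (x, y) \<in> R ^^ j)"

lemma steps_le: "(x, y) \<in> R ^^ j \<Longrightarrow> steps R x y \<le> j"
  unfolding steps_def by (rule Least_le)

lemma steps_attained: "(x, y) \<in> R\<^sup>* \<Longrightarrow> (x, y) \<in> R ^^ steps R x y"
  unfolding steps_def by (rule LeastI_ex) (rule rtrancl_imp_relpow)

lemma steps_triangle:
  assumes "(x, y) \<in> R ^^ i" "(y, z) \<in> R ^^ j"
  shows "steps R x z \<le> i + j"
  by (rule steps_le) (use assms in \<open>auto simp: relpow_add\<close>)

lemma geodesic:
  assumes "(x, y) \<in> R\<^sup>*" "steps R x y = m"
  obtains t where "t 0 = x" "t m = y" "\<And>i. i < m \<Longrightarrow> (t i, t (Suc i)) \<in> R"
    "\<And>i j. i \<le> j \<Longrightarrow> j \<le> m \<Longrightarrow> (t i, t j) \<in> R ^^ (j - i)" "\<And>i. i \<le> m \<Longrightarrow> steps R x (t i) = i"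
proof -
  have "(x, y) \<in> R ^^ m" using steps_attained[OF assms(1)] assms(2) by simp
  then obtain t where t: "t 0 = x" "t m = y" "\<And>i. i < m \<Longrightarrow> (t i, t (Suc i)) \<in> R"
    unfolding relpow_fun_conv by blast
  have seg: "(t i, t j) \<in> R ^^ (j - i)" if "i \<le> j" "j \<le> m" for i j
    unfolding relpow_fun_conv
    by (rule exI[of _ "\<lambda>l. t (i + l)"]) (use that t(3) in auto)
  have "steps R x (t i) = i" if i: "i \<le> m" for i
  proof (rule antisym)
    show "steps R x (t i) \<le> i" using steps_le[OF seg[of 0 i]] i t(1) by simp
    have "(x, t i) \<in> R\<^sup>*" using seg[of 0 i] i t(1) relpow_imp_rtrancl by fastforce
    hence "m \<le> steps R x (t i) + (m - i)"
      using steps_triangle[OF steps_attained seg[of i m], of x] i t(2) assms(2) by simp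
    thus "i \<le> steps R x (t i)" using i by linarith
  qed
  thus ?thesis using that t seg by blast
qed

lemma relpow_subset:
  fixes R R' :: "('a \<times> 'a) set"
  shows "R \<subseteq> R' \<Longrightarrow> R ^^ m \<subseteq> R' ^^ m"
  by (induction m) (auto intro!: relcomp_mono)

lemma sym_joined: "sym (joined V F)"
  unfolding sym_def joined_def by blast

lemma joinedD: "(\<tau>, \<tau>') \<in> joined V F \<Longrightarrow> \<exists>\<sigma>\<in>F. \<tau> \<subseteq> \<sigma> \<and> \<tau>' \<subseteq> \<sigma>"
  unfolding joined_def by blast

text \<open>A connected graph with radius \<open>r\<close> has many nodes. Let \<open>c\<close> be a centre, and follow a geodesic from \<open>c\<close> to some \<open>v\<close>
at distance \<open>r\<close>. The first vertex \<open>t 1\<close> on it also has some \<open>w\<close> at distance at least \<open>r\<close>, so \<open>w\<close> has distance at least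
\<open>r - 1\<close> from \<open>c\<close>. The geodesic from \<open>c\<close> to \<open>w\<close> cannot share a simplex of \<open>F\<close> with the first one, except perhaps the
initial simplex, since this would be a shortcut from \<open>t 1\<close> to \<open>w\<close>. Hence \<open>F\<close> has at least \<open>2 r - 1\<close> elements.\<close>
lemma centre_exists:
  assumes fin: "finite V" "finite F" and \<tau>0: "\<tau>0 \<in> V"
  defines "R \<equiv> joined V F"
  shows "\<exists>c\<in>V. \<forall>\<tau>. (\<tau>0, \<tau>) \<in> R\<^sup>* \<longrightarrow> (c, \<tau>) \<in> R\<^sup>* \<and> steps R c \<tau> \<le> (card F + 1) div 2"
proof -
  define C where "C = R\<^sup>* `` {\<tau>0}"
  have RV: "R \<subseteq> V \<times> V" by (auto simp: R_def joined_def)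
  have CV: "C \<subseteq> V"
  proof
    fix x assume "x \<in> C"
    hence "(\<tau>0, x) \<in> R\<^sup>*" by (simp add: C_def)
    thus "x \<in> V" by (cases rule: rtranclE) (use \<tau>0 RV in auto)
  qed
  have finC: "finite C" using CV fin(1) finite_subset by blast
  have \<tau>0C: "\<tau>0 \<in> C" by (simp add: C_def)
  have symR: "sym (R\<^sup>*)" unfolding R_def by (rule sym_rtrancl[OF sym_joined])
  have conn: "(x, y) \<in> R\<^sup>*" if "x \<in> C" "y \<in> C" for x y
    using that symR unfolding C_def by (auto dest: symD intro: rtrancl_trans)
  have closed: "y \<in> C" if "x \<in> C" "(x, y) \<in> R" for x y
    using that unfolding C_def by (auto intro: rtrancl_into_rtrancl)
  define ecc where "ecc x = Max (steps R x ` C)" for x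
  define r where "r = Min (ecc ` C)"
  have "r \<in> ecc ` C" unfolding r_def using finC \<tau>0C by (intro Min_in) auto
  then obtain c where c: "c \<in> C" "ecc c = r" by blast
  have r_min: "r \<le> ecc x" if "x \<in> C" for x unfolding r_def using finC that by (intro Min_le) auto
  have ecc_ub: "steps R x y \<le> ecc x" if "y \<in> C" for x y unfolding ecc_def using finC that by (intro Max_ge) auto
  have ecc_at: "\<exists>y\<in>C. steps R x y = ecc x" for x
  proof -
    have "ecc x \<in> steps R x ` C" unfolding ecc_def using finC \<tau>0C by (intro Max_in) auto
    thus ?thesis by force
  qed
  have "2 * r \<le> card F + 1"
  proof (cases "r = 0")
    case False
    obtain v where v: "v \<in> C" "steps R c v = r" using ecc_at[of c] c(2) by metis
    obtain t where t: "t 0 = c" "t r = v" "\<And>i. i < r \<Longrightarrow> (t i, t (Suc i)) \<in> R"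
        "\<And>i j. i \<le> j \<Longrightarrow> j \<le> r \<Longrightarrow> (t i, t j) \<in> R ^^ (j - i)" "\<And>i. i \<le> r \<Longrightarrow> steps R c (t i) = i"
      using geodesic[OF conn[OF c(1) v(1)] v(2)] by metis
    have ct: "(c, t 1) \<in> R" using t(1) t(3)[of 0] False by simp
    have t1: "t 1 \<in> C" by (rule closed[OF c(1) ct])
    obtain w where w: "w \<in> C" "steps R (t 1) w \<ge> r" using ecc_at[of "t 1"] r_min[OF t1] by metis
    define d where "d = steps R c w"
    have dr: "d \<le> r" using ecc_ub[OF w(1), of c] c(2) by (simp add: d_def)
    have "(t 1, c) \<in> R ^^ 1" using ct sym_joined[of V F] by (simp add: R_def sym_def)
    hence "steps R (t 1) w \<le> 1 + d"
      unfolding d_def by (rule steps_triangle) (rule steps_attained[OF conn[OF c(1) w(1)]])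
    hence dr': "r \<le> d + 1" using w(2) by linarith
    obtain u where u: "u 0 = c" "u d = w" "\<And>i. i < d \<Longrightarrow> (u i, u (Suc i)) \<in> R"
        "\<And>i j. i \<le> j \<Longrightarrow> j \<le> d \<Longrightarrow> (u i, u j) \<in> R ^^ (j - i)" "\<And>i. i \<le> d \<Longrightarrow> steps R c (u i) = i"
      using geodesic[OF conn[OF c(1) w(1)] d_def[symmetric]] by metis
    have "\<forall>i\<in>{..<r}. \<exists>\<sigma>\<in>F. t i \<subseteq> \<sigma> \<and> t (Suc i) \<subseteq> \<sigma>" using t(3) joinedD unfolding R_def by blast
    then obtain \<sigma> where \<sigma>: "\<And>i. i < r \<Longrightarrow> \<sigma> i \<in> F \<and> t i \<subseteq> \<sigma> i \<and> t (Suc i) \<subseteq> \<sigma> i" by (metis lessThan_iff)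
    have "\<forall>i\<in>{..<d}. \<exists>\<sigma>\<in>F. u i \<subseteq> \<sigma> \<and> u (Suc i) \<subseteq> \<sigma>" using u(3) joinedD unfolding R_def by blast
    then obtain \<sigma>' where \<sigma>': "\<And>i. i < d \<Longrightarrow> \<sigma>' i \<in> F \<and> u i \<subseteq> \<sigma>' i \<and> u (Suc i) \<subseteq> \<sigma>' i" by (metis lessThan_iff)
    have tV: "t i \<in> V" if "i \<le> r" for i using that t(1) t(3)[of "i - 1"] CV c(1) RV by (cases i) auto
    have uV: "u i \<in> V" if "i \<le> d" for i using that u(1) u(3)[of "i - 1"] CV c(1) RV by (cases i) auto
    have level: "steps R c y \<le> Suc (steps R c x)" if "x \<in> V" "y \<in> V" "s \<in> F" "x \<subseteq> s" "y \<subseteq> s" "(c, x) \<in> R\<^sup>*" for x y s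
    proof -
      have "(x, y) \<in> R ^^ 1" using that by (auto simp: R_def joined_def)
      from steps_triangle[OF steps_attained[OF that(6)] this] show ?thesis by simp
    qed
    have ctR: "(c, t i) \<in> R\<^sup>*" if "i \<le> r" for i using t(4)[of 0 i] that t(1) relpow_imp_rtrancl by fastforce
    have cuR: "(c, u i) \<in> R\<^sup>*" if "i \<le> d" for i using u(4)[of 0 i] that u(1) relpow_imp_rtrancl by fastforce
    have inj\<sigma>: "inj_on \<sigma> {..<r}"
    proof (rule linorder_inj_onI)
      fix i j assume ij: "i < j" "i \<in> {..<r}" "j \<in> {..<r}"
      show "\<sigma> i \<noteq> \<sigma> j"
      proof
        assume eq: "\<sigma> i = \<sigma> j"
        have "steps R c (t (Suc j)) \<le> Suc (steps R c (t i))"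
          by (rule level[where s = "\<sigma> j"]) (use \<sigma>[of i] \<sigma>[of j] ij eq tV ctR in auto)
        thus False using t(5)[of i] t(5)[of "Suc j"] ij by simp
      qed
    qed auto
    have inj\<sigma>': "inj_on \<sigma>' {..<d}"
    proof (rule linorder_inj_onI)
      fix i j assume ij: "i < j" "i \<in> {..<d}" "j \<in> {..<d}"
      show "\<sigma>' i \<noteq> \<sigma>' j"
      proof
        assume eq: "\<sigma>' i = \<sigma>' j"
        have "steps R c (u (Suc j)) \<le> Suc (steps R c (u i))"
          by (rule level[where s = "\<sigma>' j"]) (use \<sigma>'[of i] \<sigma>'[of j] ij eq uV cuR in auto)
        thus False using u(5)[of i] u(5)[of "Suc j"] ij by simp
      qed
    qed auto
    have meet: "d = r \<and> j = 0" if ij: "i < r" "j < d" "\<sigma> i = \<sigma>' j" for i j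
    proof -
      have "steps R c (u (Suc j)) \<le> Suc (steps R c (t i))"
        by (rule level[where s = "\<sigma> i"]) (use \<sigma>[of i] \<sigma>'[of j] ij tV uV ctR in auto)
      moreover have "steps R c (t (Suc i)) \<le> Suc (steps R c (u j))"
        by (rule level[where s = "\<sigma> i"]) (use \<sigma>[of i] \<sigma>'[of j] ij tV uV cuR in auto)
      ultimately have eq: "i = j" using t(5)[of i] t(5)[of "Suc i"] u(5)[of j] u(5)[of "Suc j"] ij by simp
      have tu: "(t a, u (Suc j)) \<in> R ^^ 1" if "a = i \<or> a = Suc i" for a
        using that \<sigma>[of i] \<sigma>'[of j] ij tV[of a] uV[of "Suc j"] by (auto simp: R_def joined_def)
      have uw: "(u (Suc j), w) \<in> R ^^ (d - Suc j)" using u(4)[of "Suc j" d] ij u(2) by simp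
      show ?thesis
      proof (cases "j = 0")
        case True
        have "steps R (t 1) w \<le> 1 + (d - Suc j)" by (rule steps_triangle[OF tu uw]) (use eq True in simp)
        thus ?thesis using w(2) dr True ij by simp
      next
        case False
        have "(t 1, t i) \<in> R ^^ (i - 1)" using t(4)[of 1 i] False eq ij by simp
        moreover have "(t i, w) \<in> R ^^ (1 + (d - Suc j))" unfolding relpow_add using tu[of i] uw by auto
        ultimately have "steps R (t 1) w \<le> (i - 1) + (1 + (d - Suc j))" by (rule steps_triangle)
        thus ?thesis using w(2) dr False eq ij by simp
      qed
    qed
    \<comment> \<open>The initial simplices of the two geodesics can agree only if d = r, and then there is one to spare.\<close>
    define J where "J = (if d < r then {..<d} else {1..<d})"
    have "\<sigma> ` {..<r} \<inter> \<sigma>' ` J = {}" using meet by (force simp: J_def split: if_splits)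
    moreover have "card (\<sigma> ` {..<r}) = r" using inj\<sigma> by (simp add: card_image)
    moreover have "card (\<sigma>' ` J) = card J" by (rule card_image, rule inj_on_subset[OF inj\<sigma>']) (auto simp: J_def)
    moreover have "card J \<ge> r - 1" using dr dr' by (auto simp: J_def)
    ultimately have "card (\<sigma> ` {..<r} \<union> \<sigma>' ` J) \<ge> r + (r - 1)" by (subst card_Un_disjoint) (auto simp: J_def)
    moreover have "\<sigma> ` {..<r} \<union> \<sigma>' ` J \<subseteq> F" using \<sigma> \<sigma>' by (auto simp: J_def split: if_splits)
    hence "card (\<sigma> ` {..<r} \<union> \<sigma>' ` J) \<le> card F" using fin(2) by (rule card_mono[rotated])
    ultimately show ?thesis by linarith
  qed simp
  hence rF: "r \<le> (card F + 1) div 2" by linarith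
  show ?thesis
  proof (rule bexI[of _ c], intro allI impI)
    fix \<tau> assume "(\<tau>0, \<tau>) \<in> R\<^sup>*"
    hence \<tau>: "\<tau> \<in> C" by (simp add: C_def)
    show "(c, \<tau>) \<in> R\<^sup>* \<and> steps R c \<tau> \<le> (card F + 1) div 2"
      using conn[OF c(1) \<tau>] ecc_ub[OF \<tau>, of c] c(2) rF by simp
  qed (use c CV in blast)
qed

text \<open>Consecutive simplices of a gallery meet in a \<open>k\<close>-simplex, and these intersections are the stations of the path.\<close>
lemma gallery_joined:
  assumes "gallery X k gs" "set gs \<subseteq> F" "\<eta>\<^sub>0 \<in> simplices k X" "\<eta>\<^sub>1 \<in> simplices k X" "gallery_connects gs \<eta>\<^sub>0 \<eta>\<^sub>1"
  shows "(\<eta>\<^sub>0, \<eta>\<^sub>1) \<in> (joined (simplices k X) F)\<^sup>*"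
  using assms
proof (induction gs arbitrary: \<eta>\<^sub>0)
  case (Cons g gs)
  show ?case
  proof (cases gs)
    case Nil
    thus ?thesis using Cons.prems by (auto simp: joined_def gallery_connects_def)
  next
    case (Cons h gs')
    let ?m = "g \<inter> h"
    have m: "?m \<in> simplices k X" using Cons.prems(1) Cons by (auto simp: gallery_def)
    have "gallery X k gs" unfolding gallery_def
    proof (intro conjI allI impI)
      show "gs \<noteq> []" using Cons by simp
      show "set gs \<subseteq> simplices (k + 1) X" using Cons.prems(1) by (auto simp: gallery_def)
      fix i assume "Suc i < length gs"
      thus "gs ! i \<inter> gs ! Suc i \<in> simplices k X" using Cons.prems(1) unfolding gallery_def by (metis Suc_less_eq length_Cons nth_Cons_Suc)
    qed
    moreover have "gallery_connects gs ?m \<eta>\<^sub>1" using Cons.prems(5) Cons by (auto simp: gallery_connects_def)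
    ultimately have "(?m, \<eta>\<^sub>1) \<in> (joined (simplices k X) F)\<^sup>*" using Cons.IH[of ?m] Cons.prems m by simp
    moreover have "(\<eta>\<^sub>0, ?m) \<in> joined (simplices k X) F"
      using Cons.prems m by (auto simp: joined_def gallery_connects_def)
    ultimately show ?thesis by (rule converse_rtrancl_into_rtrancl[rotated])
  qed
qed (simp add: gallery_def)

lemma joined_mono: "F \<subseteq> G \<Longrightarrow> joined V F \<subseteq> joined V G"
  unfolding joined_def by blast

lemma card_codim_one_faces:
  assumes "finite \<sigma>" "card \<sigma> = Suc (Suc k)"
  shows "finite {\<tau>. \<tau> \<subseteq> \<sigma> \<and> card \<tau> = Suc k}" "card {\<tau>. \<tau> \<subseteq> \<sigma> \<and> card \<tau> = Suc k} = Suc (Suc k)"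
proof -
  show "finite {\<tau>. \<tau> \<subseteq> \<sigma> \<and> card \<tau> = Suc k}" using assms(1) by simp
  have "card {\<tau>. \<tau> \<subseteq> \<sigma> \<and> card \<tau> = Suc k} = Suc (Suc k) choose Suc k"
    using n_subsets[OF assms(1), of "Suc k"] assms(2) by simp
  thus "card {\<tau>. \<tau> \<subseteq> \<sigma> \<and> card \<tau> = Suc k} = Suc (Suc k)" by (simp add: binomial_symmetric[of "Suc k" "Suc (Suc k)"])
qed

text \<open>Let \<open>E\<close> be the set of \<open>(k+1)\<close>-simplices that meet the ball of radius \<open>\<rho>\<close>. Attach to every element of the ball the
simplex by which it is reached from a point closer to \<open>c\<close>: at most \<open>D - 1\<close> others remain, and every simplex of \<open>E\<close>
occurs among those of its face closest to \<open>c\<close>. This bounds \<open>E\<close> by \<open>1 + (D - 1) * card (B \<rho>)\<close>. Each simplex of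
\<open>E\<close> has \<open>k + 2\<close> faces, of which the closest one contributes nothing new to the next ball.\<close>
lemma ball_growth:
  fixes X :: "'v set set"
  assumes X: "finite X" "abstract_complex X" and c: "c \<in> simplices k X"
    and deg: "\<And>\<tau>. \<tau> \<in> simplices k X \<Longrightarrow> {\<sigma> \<in> simplices (k+1) X. \<tau> \<subseteq> \<sigma>} \<noteq> {} \<and> card {\<sigma> \<in> simplices (k+1) X. \<tau> \<subseteq> \<sigma>} \<le> D"
  defines "R \<equiv> joined (simplices k X) (simplices (k+1) X)"
  defines "B \<equiv> \<lambda>\<rho>. {\<tau>. (c, \<tau>) \<in> R\<^sup>* \<and> steps R c \<tau> \<le> \<rho>}"
  shows "finite (B \<rho>)" "card (B (Suc \<rho>)) \<le> (k + 1) * (D - 1) * card (B \<rho>) + (k + 2)" "B 0 = {c}"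
proof -
  let ?V = "simplices k X" and ?T = "simplices (k+1) X"
  have fin: "finite ?V" "finite ?T" using X(1) by (simp_all add: simplices_def)
  have BV: "B \<rho> \<subseteq> ?V" for \<rho>
  proof
    fix x assume "x \<in> B \<rho>"
    hence "(c, x) \<in> R\<^sup>*" by (simp add: B_def)
    thus "x \<in> ?V" by (cases rule: rtranclE) (use c in \<open>auto simp: R_def joined_def\<close>)
  qed
  show finB: "finite (B \<rho>)" for \<rho> using BV fin(1) finite_subset by blast
  have reach0: "\<tau> = c" if "(c, \<tau>) \<in> R\<^sup>*" "steps R c \<tau> = 0" for \<tau> using steps_attained[OF that(1)] that(2) by simp
  have "steps R c c = 0" using steps_le[where x = c and y = c and R = R and j = 0] by simp
  thus "B 0 = {c}" using reach0 by (auto simp: B_def)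
  define star where "star \<tau> = {\<sigma> \<in> ?T. \<tau> \<subseteq> \<sigma>}" for \<tau>
  \<comment> \<open>The simplex by which \<open>\<tau>\<close> is reached from a point closer to c; any simplex at c for c itself.\<close>
  define parent where "parent \<tau> = (SOME \<sigma>. \<sigma> \<in> star \<tau> \<and> (\<tau> \<noteq> c \<longrightarrow>
     (\<exists>x\<in>?V. x \<subseteq> \<sigma> \<and> (c, x) \<in> R\<^sup>* \<and> steps R c x < steps R c \<tau>)))" for \<tau>
  have parent: "parent \<tau> \<in> star \<tau> \<and> (\<tau> \<noteq> c \<longrightarrow>
     (\<exists>x\<in>?V. x \<subseteq> parent \<tau> \<and> (c, x) \<in> R\<^sup>* \<and> steps R c x < steps R c \<tau>))" if \<tau>: "(c, \<tau>) \<in> R\<^sup>*" "\<tau> \<in> ?V" for \<tau>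
    unfolding parent_def
  proof (rule someI_ex, cases "\<tau> = c")
    case True thus "\<exists>\<sigma>. \<sigma> \<in> star \<tau> \<and> (\<tau> \<noteq> c \<longrightarrow> (\<exists>x\<in>?V. x \<subseteq> \<sigma> \<and> (c, x) \<in> R\<^sup>* \<and> steps R c x < steps R c \<tau>))"
      using deg[OF \<tau>(2)] by (auto simp: star_def)
  next
    case False
    then obtain m where m: "steps R c \<tau> = Suc m" using reach0[OF \<tau>(1)] not0_implies_Suc by blast
    hence "(c, \<tau>) \<in> R ^^ Suc m" using steps_attained[OF \<tau>(1)] by simp
    then obtain x where x: "(c, x) \<in> R ^^ m" "(x, \<tau>) \<in> R" by (rule relpow_Suc_E)
    obtain \<sigma> where "\<sigma> \<in> ?T" "x \<subseteq> \<sigma>" "\<tau> \<subseteq> \<sigma>" "x \<in> ?V" using x(2) by (auto simp: R_def joined_def)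
    moreover have "(c, x) \<in> R\<^sup>*" using x(1) relpow_imp_rtrancl by blast
    moreover have "steps R c x < steps R c \<tau>" using steps_le[OF x(1)] m by simp
    ultimately show "\<exists>\<sigma>. \<sigma> \<in> star \<tau> \<and> (\<tau> \<noteq> c \<longrightarrow> (\<exists>x\<in>?V. x \<subseteq> \<sigma> \<and> (c, x) \<in> R\<^sup>* \<and> steps R c x < steps R c \<tau>))"
      by (auto simp: star_def)
  qed
  define E where "E = {\<sigma> \<in> ?T. \<exists>\<tau>\<in>B \<rho>. \<tau> \<subseteq> \<sigma>}"
  \<comment> \<open>The face of a simplex that is closest to c.\<close>
  define low where "low \<sigma> = arg_min_on (steps R c) {\<tau> \<in> ?V. \<tau> \<subseteq> \<sigma> \<and> (c, \<tau>) \<in> R\<^sup>*}" for \<sigma>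
  have finE: "finite E" using fin by (simp add: E_def)
  have low: "low \<sigma> \<in> ?V" "low \<sigma> \<subseteq> \<sigma>" "(c, low \<sigma>) \<in> R\<^sup>*"
      "\<And>x. x \<in> ?V \<Longrightarrow> x \<subseteq> \<sigma> \<Longrightarrow> (c, x) \<in> R\<^sup>* \<Longrightarrow> steps R c (low \<sigma>) \<le> steps R c x"
    if \<tau>: "\<tau> \<in> ?V" "\<tau> \<subseteq> \<sigma>" "(c, \<tau>) \<in> R\<^sup>*" for \<tau> \<sigma>
  proof -
    let ?Q = "{\<tau> \<in> ?V. \<tau> \<subseteq> \<sigma> \<and> (c, \<tau>) \<in> R\<^sup>*}"
    have Q: "finite ?Q" "?Q \<noteq> {}" using fin \<tau> by auto
    have "low \<sigma> \<in> ?Q" unfolding low_def by (rule arg_min_if_finite(1)[OF Q])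
    thus "low \<sigma> \<in> ?V" "low \<sigma> \<subseteq> \<sigma>" "(c, low \<sigma>) \<in> R\<^sup>*" by auto
    show "steps R c (low \<sigma>) \<le> steps R c x" if "x \<in> ?V" "x \<subseteq> \<sigma>" "(c, x) \<in> R\<^sup>*" for x
      unfolding low_def by (rule arg_min_least[OF Q]) (use that in simp)
  qed
  have cardE: "card E \<le> 1 + (D - 1) * card (B \<rho>)"
  proof -
    have "E \<subseteq> insert (parent c) (\<Union>\<tau>\<in>B \<rho>. star \<tau> - {parent \<tau>})"
    proof
      fix \<sigma> assume "\<sigma> \<in> E"
      then obtain \<tau> where \<tau>: "\<sigma> \<in> ?T" "\<tau> \<in> B \<rho>" "\<tau> \<subseteq> \<sigma>" by (auto simp: E_def)
      hence \<tau>': "\<tau> \<in> ?V" "(c, \<tau>) \<in> R\<^sup>*" "steps R c \<tau> \<le> \<rho>" using BV by (auto simp: B_def)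
      note l = low[OF \<tau>'(1) \<tau>(3) \<tau>'(2)]
      have lB: "low \<sigma> \<in> B \<rho>" using l(3) l(4)[OF \<tau>'(1) \<tau>(3) \<tau>'(2)] \<tau>'(3) by (simp add: B_def)
      show "\<sigma> \<in> insert (parent c) (\<Union>\<tau>\<in>B \<rho>. star \<tau> - {parent \<tau>})"
      proof (cases "\<sigma> = parent (low \<sigma>)")
        case True
        have "low \<sigma> = c"
        proof (rule ccontr)
          assume "low \<sigma> \<noteq> c"
          then obtain x where "x \<in> ?V" "x \<subseteq> \<sigma>" "(c, x) \<in> R\<^sup>*" "steps R c x < steps R c (low \<sigma>)"
            using parent[OF l(3,1)] True by metis
          thus False using l(4)[of x] by simp
        qed
        thus ?thesis using True by simp
      next
        case False
        thus ?thesis using lB l(2) \<tau>(1) by (auto simp: star_def)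
      qed
    qed
    hence "card E \<le> card (insert (parent c) (\<Union>\<tau>\<in>B \<rho>. star \<tau> - {parent \<tau>}))"
      by (rule card_mono[rotated]) (use finB fin in \<open>auto simp: star_def\<close>)
    also have "\<dots> \<le> 1 + card (\<Union>\<tau>\<in>B \<rho>. star \<tau> - {parent \<tau>})"
      by (simp add: card_insert_le_m1 card_insert_if finB fin star_def)
    also have "card (\<Union>\<tau>\<in>B \<rho>. star \<tau> - {parent \<tau>}) \<le> (\<Sum>\<tau>\<in>B \<rho>. card (star \<tau> - {parent \<tau>}))"
      by (rule card_UN_le[OF finB])
    also have "\<dots> \<le> (\<Sum>\<tau>\<in>B \<rho>. D - 1)"
    proof (rule sum_mono)
      fix \<tau> assume "\<tau> \<in> B \<rho>"
      hence \<tau>: "\<tau> \<in> ?V" "(c, \<tau>) \<in> R\<^sup>*" using BV by (auto simp: B_def)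
      have "card (star \<tau> - {parent \<tau>}) = card (star \<tau>) - 1"
        using parent[OF \<tau>(2,1)] by (intro card_Diff_singleton) auto
      thus "card (star \<tau> - {parent \<tau>}) \<le> D - 1" using deg[OF \<tau>(1)] by (simp add: star_def diff_le_mono)
    qed
    finally show ?thesis by (simp add: mult.commute)
  qed
  have cardB: "card (B (Suc \<rho>)) \<le> 1 + (k + 1) * card E"
  proof -
    let ?f = "\<lambda>\<sigma>. {\<tau>. \<tau> \<subseteq> \<sigma> \<and> card \<tau> = Suc k} - {low \<sigma>}"
    have T: "finite \<sigma> \<and> card \<sigma> = Suc (Suc k)" if "\<sigma> \<in> ?T" for \<sigma>
      using that X(2) by (simp add: simplices_def abstract_complex_def)
    have "B (Suc \<rho>) \<subseteq> insert c (\<Union>\<sigma>\<in>E. ?f \<sigma>)"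
    proof
      fix \<tau> assume "\<tau> \<in> B (Suc \<rho>)"
      hence \<tau>: "\<tau> \<in> ?V" "(c, \<tau>) \<in> R\<^sup>*" "steps R c \<tau> \<le> Suc \<rho>" using BV by (auto simp: B_def)
      show "\<tau> \<in> insert c (\<Union>\<sigma>\<in>E. ?f \<sigma>)"
      proof (cases "\<tau> = c")
        case False
        let ?\<sigma> = "parent \<tau>"
        have p: "?\<sigma> \<in> ?T" "\<tau> \<subseteq> ?\<sigma>" using parent[OF \<tau>(2,1)] by (auto simp: star_def)
        obtain x where x: "x \<in> ?V" "x \<subseteq> ?\<sigma>" "(c, x) \<in> R\<^sup>*" "steps R c x < steps R c \<tau>" using parent[OF \<tau>(2,1)] False by blast
        have "x \<in> B \<rho>" using x \<tau>(3) by (simp add: B_def)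
        hence "?\<sigma> \<in> E" using p x(2) by (auto simp: E_def)
        moreover have "low ?\<sigma> \<noteq> \<tau>" using low(4)[OF x(1-3) x(1-3)] x(4) by auto
        moreover have "card \<tau> = Suc k" using \<tau>(1) by (simp add: simplices_def)
        ultimately show ?thesis using p(2) by blast
      qed simp
    qed
    hence "card (B (Suc \<rho>)) \<le> card (insert c (\<Union>\<sigma>\<in>E. ?f \<sigma>))"
      by (rule card_mono[rotated]) (use finE T card_codim_one_faces(1) in \<open>auto simp: E_def\<close>)
    also have "\<dots> \<le> 1 + card (\<Union>\<sigma>\<in>E. ?f \<sigma>)" 
      using card_insert_le_m1[of "Suc (card (\<Union>\<sigma>\<in>E. ?f \<sigma>))" "\<Union>\<sigma>\<in>E. ?f \<sigma>" c] by simp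
    also have "card (\<Union>\<sigma>\<in>E. ?f \<sigma>) \<le> (\<Sum>\<sigma>\<in>E. card (?f \<sigma>))" by (rule card_UN_le[OF finE])
    also have "\<dots> \<le> (\<Sum>\<sigma>\<in>E. k + 1)"
    proof (rule sum_mono)
      fix \<sigma> assume "\<sigma> \<in> E"
      then obtain \<tau> where \<tau>: "\<sigma> \<in> ?T" "\<tau> \<in> B \<rho>" "\<tau> \<subseteq> \<sigma>" by (auto simp: E_def)
      hence \<tau>': "\<tau> \<in> ?V" "(c, \<tau>) \<in> R\<^sup>*" using BV by (auto simp: B_def)
      have "low \<sigma> \<in> {\<tau>. \<tau> \<subseteq> \<sigma> \<and> card \<tau> = Suc k}"
        using low(1,2)[OF \<tau>'(1) \<tau>(3) \<tau>'(2)] by (simp add: simplices_def)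
      thus "card (?f \<sigma>) \<le> k + 1" using T[OF \<tau>(1)] card_codim_one_faces[of \<sigma> k] by (simp add: card_Diff_singleton)
    qed
    finally show ?thesis by (simp add: mult.commute)
  qed
  have "(k + 1) * card E \<le> (k + 1) * (1 + (D - 1) * card (B \<rho>))" using cardE by (rule mult_le_mono2)
  hence "card (B (Suc \<rho>)) \<le> 1 + (k + 1) * (1 + (D - 1) * card (B \<rho>))" using cardB by linarith
  thus "card (B (Suc \<rho>)) \<le> (k + 1) * (D - 1) * card (B \<rho>) + (k + 2)" by (simp add: algebra_simps)
qed

lemma card_small_subsets_le:
  assumes "finite B"
  shows "finite {Y. Y \<subseteq> B \<and> Y \<noteq> {} \<and> card Y \<le> m}" "card {Y. Y \<subseteq> B \<and> Y \<noteq> {} \<and> card Y \<le> m} \<le> card B ^ m"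
proof -
  have "{Y. Y \<subseteq> B \<and> Y \<noteq> {} \<and> card Y \<le> m} \<subseteq> (\<lambda>g. g ` {..<m}) ` ({..<m} \<rightarrow>\<^sub>E B)"
  proof
    fix Y assume "Y \<in> {Y. Y \<subseteq> B \<and> Y \<noteq> {} \<and> card Y \<le> m}"
    hence Y: "Y \<subseteq> B" "Y \<noteq> {}" "card Y \<le> m" by auto
    have finY: "finite Y" using Y(1) assms finite_subset by blast
    obtain e where e: "bij_betw e {0..<card Y} Y" using ex_bij_betw_nat_finite[OF finY] by blast
    obtain y where y: "y \<in> Y" using Y(2) by blast
    define g where "g = (\<lambda>i\<in>{..<m}. if i < card Y then e i else y)"
    have "g \<in> {..<m} \<rightarrow>\<^sub>E B" unfolding g_def using bij_betwE[OF e] Y(1) y by auto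
    moreover have "g ` {..<m} = Y"
    proof
      show "g ` {..<m} \<subseteq> Y" unfolding g_def using bij_betwE[OF e] y by auto
      show "Y \<subseteq> g ` {..<m}"
      proof
        fix x assume "x \<in> Y"
        hence "x \<in> e ` {0..<card Y}" using e by (simp add: bij_betw_def)
        then obtain i where "i < card Y" "x = e i" by auto
        thus "x \<in> g ` {..<m}" using Y(3) by (intro image_eqI[of _ _ i]) (auto simp: g_def)
      qed
    qed
    ultimately show "Y \<in> (\<lambda>g. g ` {..<m}) ` ({..<m} \<rightarrow>\<^sub>E B)" by (metis image_eqI)
  qed
  moreover have fin: "finite ({..<m} \<rightarrow>\<^sub>E B)" using assms by (intro finite_PiE) auto
  ultimately have "card {Y. Y \<subseteq> B \<and> Y \<noteq> {} \<and> card Y \<le> m} \<le> card ({..<m} \<rightarrow>\<^sub>E B)"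
    using surj_card_le by blast
  thus "card {Y. Y \<subseteq> B \<and> Y \<noteq> {} \<and> card Y \<le> m} \<le> card B ^ m" by (simp add: card_PiE)
  show "finite {Y. Y \<subseteq> B \<and> Y \<noteq> {} \<and> card Y \<le> m}" using assms by simp
qed

text \<open>Map a pair of some \<open>S\<close> and one of its facets to the centre of \<open>S\<close> together with the set of remaining facets. The map is
injective, and every element of \<open>N\<close> occurs in at least three pairs.\<close>
lemma card_by_punctured_facets:
  fixes fac :: "'a \<Rightarrow> 'b set"
  assumes fin: "finite N" "finite V" and c: "\<And>S. S \<in> N \<Longrightarrow> c S \<in> V" "\<And>S. S \<in> N \<Longrightarrow> fac S \<subseteq> nbh (c S)"
    and ball: "\<And>x. x \<in> V \<Longrightarrow> finite (nbh x) \<and> card (nbh x) \<le> b"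
    and card: "\<And>S. S \<in> N \<Longrightarrow> 3 \<le> card (fac S) \<and> card (fac S) \<le> s"
    and det: "\<And>S S' \<tau> \<tau>'. S \<in> N \<Longrightarrow> S' \<in> N \<Longrightarrow> \<tau> \<in> fac S \<Longrightarrow> \<tau>' \<in> fac S' \<Longrightarrow>
      fac S - {\<tau>} = fac S' - {\<tau>'} \<Longrightarrow> S = S' \<and> \<tau> = \<tau>'"
  shows "3 * card N \<le> card V * b ^ (s - 1)"
proof -
  let ?W = "\<lambda>x. {Y. Y \<subseteq> nbh x \<and> Y \<noteq> {} \<and> card Y \<le> s - 1}"
  let ?g = "\<lambda>(S, \<tau>). (c S, fac S - {\<tau>})"
  have finf: "finite (fac S)" if "S \<in> N" for S using card[OF that] by (intro card_ge_0_finite) linarith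
  have inj: "inj_on ?g (Sigma N fac)" using det by (fastforce simp: inj_on_def)
  have "?g ` Sigma N fac \<subseteq> Sigma V ?W"
  proof (rule image_subsetI)
    fix p assume "p \<in> Sigma N fac"
    then obtain S \<tau> where p: "p = (S, \<tau>)" and S: "S \<in> N" "\<tau> \<in> fac S" by blast
    have cd: "card (fac S - {\<tau>}) = card (fac S) - 1" using S(2) by simp
    have "card (fac S - {\<tau>}) \<noteq> 0" using cd card[OF S(1)] by linarith
    hence "fac S - {\<tau>} \<noteq> {}" by force
    moreover have "card (fac S - {\<tau>}) \<le> s - 1" using cd card[OF S(1)] by linarith
    ultimately show "?g p \<in> Sigma V ?W" unfolding p using c[OF S(1)] by auto
  qed
  moreover have finW: "finite (Sigma V ?W)" using fin(2) ball card_small_subsets_le(1) by blast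
  ultimately have "card (Sigma N fac) \<le> card (Sigma V ?W)" using card_inj_on_le[OF inj] by blast
  also have "\<dots> = (\<Sum>x\<in>V. card (?W x))" using fin(2) ball card_small_subsets_le(1) by (intro card_SigmaI) auto
  also have "\<dots> \<le> (\<Sum>x\<in>V. b ^ (s - 1))"
  proof (rule sum_mono)
    fix x assume x: "x \<in> V"
    have "card (?W x) \<le> card (nbh x) ^ (s - 1)" using ball[OF x] card_small_subsets_le(2) by blast
    also have "\<dots> \<le> b ^ (s - 1)" using ball[OF x] by (intro power_mono) auto
    finally show "card (?W x) \<le> b ^ (s - 1)" .
  qed
  finally have "card (Sigma N fac) \<le> card V * b ^ (s - 1)" by simp
  moreover have "3 * card N \<le> card (Sigma N fac)"
  proof -
    have "3 * card N = (\<Sum>S\<in>N. 3)" by simp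
    also have "\<dots> \<le> (\<Sum>S\<in>N. card (fac S))" using card by (intro sum_mono) auto
    also have "\<dots> = card (Sigma N fac)" using fin(1) finf by (simp add: card_SigmaI)
    finally show ?thesis .
  qed
  ultimately show ?thesis by linarith
qed

text \<open>Write \<open>D * k = y\<^sup>3\<close>. Since \<open>D\<close> and \<open>k\<close> are at least \<open>1\<close>, the recursion is dominated by its case \<open>k = 1\<close>, that is
by \<open>b' = 2 (y\<^sup>3 - 1) b + 3\<close>. The sequence \<open>2 y\<^bsup>4\<rho>+1\<^esup>\<close> grows at least as fast because
\<open>2 (y\<^sup>4 - 2 y\<^sup>3 + 2) y\<^sup>5 \<ge> 3\<close>; the estimate is close at \<open>y\<^sup>3 = 2\<close>, which is treated separately.\<close>
lemma ball_size_bound: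
  fixes b :: "nat \<Rightarrow> nat"
  assumes a: "D * k > 1" and b0: "b 0 = 1" and pos: "\<And>\<rho>. b \<rho> \<ge> 1"
    and step: "\<And>\<rho>. b (Suc \<rho>) \<le> (k + 1) * (D - 1) * b \<rho> + (k + 2)"
  shows "real (b \<rho>) \<le> 2 * real (D * k) powr ((4 * real \<rho> + 1) / 3)"
proof -
  have Dk: "D \<ge> 1" "k \<ge> 1" using a by (cases D; cases k; simp)+
  define y where "y = real (D * k) powr (1 / 3)"
  have cube: "(x powr (1 / 3)) ^ 3 = x" if "x > 0" for x :: real using that by (simp add: powr_power)
  have y3: "y ^ 3 = real (D * k)" unfolding y_def by (rule cube) (use Dk in simp)
  have y0: "y > 0" unfolding y_def using Dk by simp
  have pw: "real (D * k) powr ((4 * real \<rho> + 1) / 3) = y ^ (4 * \<rho> + 1)" for \<rho>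
  proof -
    have "(x powr (1 / 3)) ^ m = x powr (real m / 3)" if "x > 0" for x :: real and m using that by (simp add: powr_power)
    moreover have "real (D * k) > 0" using Dk by simp
    ultimately have "y ^ (4 * \<rho> + 1) = real (D * k) powr (real (4 * \<rho> + 1) / 3)" unfolding y_def by blast
    moreover have "real (4 * \<rho> + 1) / 3 = (4 * real \<rho> + 1) / 3" by simp
    ultimately show ?thesis by (simp only:)
  qed
  have rstep: "real (b (Suc \<rho>)) \<le> 2 * (y ^ 3 - 1) * real (b \<rho>) + 3" for \<rho>
  proof -
    have D1: "real (D - 1) = real D - 1" using Dk by (simp add: of_nat_diff)
    have "real (b (Suc \<rho>)) \<le> real ((k + 1) * (D - 1) * b \<rho> + (k + 2))" using step[of \<rho>] by (simp only: of_nat_le_iff)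
    also have "\<dots> = (real k + 1) * (real D - 1) * real (b \<rho>) + (real k + 2)" 
      by (simp only: of_nat_add of_nat_mult of_nat_1 of_nat_numeral D1)
    finally have 1: "real (b (Suc \<rho>)) \<le> (real k + 1) * (real D - 1) * real (b \<rho>) + (real k + 2)" .
    have "0 \<le> (real D + 1) * (real k - 1)" using Dk by simp
    hence "0 \<le> (real D + 1) * (real k - 1) * (real (b \<rho>) - 1)" using pos[of \<rho>] by simp
    moreover have "0 \<le> real D * (real k - 1)" using Dk by simp
    moreover have "2 * (real D * real k - 1) * real (b \<rho>) + 3 - ((real k + 1) * (real D - 1) * real (b \<rho>) + (real k + 2))
       = (real D + 1) * (real k - 1) * (real (b \<rho>) - 1) + real D * (real k - 1)"
      by (simp add: algebra_simps)
    ultimately show ?thesis using 1 unfolding y3 by simp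
  qed
  have y1: "y \<ge> 5/4"
  proof (rule ccontr)
    assume "\<not> y \<ge> 5/4"
    hence "y ^ 3 \<le> (5/4) ^ 3" using y0 by (intro power_mono) auto
    thus False using a y3 by (simp add: power3_eq_cube del: of_nat_mult)
  qed
  have key: "3 \<le> 2 * (y ^ 4 - 2 * y ^ 3 + 2) * y ^ 5"
  proof (cases "D * k = 2")
    case True
    hence y2: "y ^ 3 = 2" using y3 by simp
    have "y \<le> 127/100"
    proof (rule ccontr)
      assume "\<not> y \<le> 127/100"
      hence "(127/100) ^ 3 \<le> y ^ 3" by (intro power_mono) auto
      thus False using y2 by (simp add: power3_eq_cube)
    qed
    hence "y\<^sup>2 \<le> (127/100)\<^sup>2" using y0 by (intro power_mono) auto
    moreover have "y ^ 4 = 2 * y" "y ^ 5 = 2 * y\<^sup>2"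
      using y2 by (simp_all add: power_numeral_reduce eval_nat_numeral)
    hence "2 * (y ^ 4 - 2 * y ^ 3 + 2) * y ^ 5 = 8 * y ^ 3 - 8 * y\<^sup>2" using y2
      by (simp add: algebra_simps power2_eq_square power3_eq_cube)
    ultimately show ?thesis using y2 by (simp add: power2_eq_square)
  next
    case False
    hence "D * k \<ge> 3" using a by linarith
    hence y3': "y ^ 3 \<ge> 3" using y3 by (simp del: of_nat_mult)
    \<comment> \<open>1.44 is a lower bound for the cube root of 3, as 1.27 above is an upper bound for that of 2.\<close>
    have "y \<ge> 144/100"
    proof (rule ccontr)
      assume "\<not> y \<ge> 144/100"
      hence "y ^ 3 \<le> (144/100) ^ 3" using y0 by (intro power_mono) auto
      thus False using y3' by (simp add: power3_eq_cube)
    qed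
    hence "y\<^sup>2 \<ge> (144/100)\<^sup>2" by (intro power_mono) auto
    hence "y\<^sup>2 \<ge> 2" by (simp add: power2_eq_square)
    hence "3 * 2 \<le> y ^ 3 * y\<^sup>2" using y3' y0 by (intro mult_mono) auto
    hence y5: "y ^ 5 \<ge> 6" by (simp flip: power_add)
    \<comment> \<open>The quartic has its minimum at 3/2.\<close>
    have "y ^ 4 - 2 * y ^ 3 + 27/16 = (y - 3/2)\<^sup>2 * (y\<^sup>2 + y + 3/4)"
      by (simp add: algebra_simps power2_eq_square eval_nat_numeral)
    moreover have "(y - 3/2)\<^sup>2 * (y\<^sup>2 + y + 3/4) \<ge> 0" using y0 by simp
    ultimately have g: "y ^ 4 - 2 * y ^ 3 + 2 \<ge> 5/16" by linarith
    have "5/16 * 6 \<le> (y ^ 4 - 2 * y ^ 3 + 2) * y ^ 5" using g y5 by (intro mult_mono) auto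
    thus ?thesis unfolding mult.assoc by linarith
  qed
  have base: "2 * y ^ 3 + 1 \<le> 2 * y ^ 5"
  proof -
    have "y\<^sup>2 \<ge> (5/4)\<^sup>2" using y1 by (intro power_mono) auto
    hence "y\<^sup>2 - 1 \<ge> 9/16" by (simp add: power2_eq_square)
    moreover have "y ^ 3 \<ge> 2" using a y3 by (simp del: of_nat_mult)
    ultimately have "2 * (9/16) \<le> y ^ 3 * (y\<^sup>2 - 1)" using y0 by (intro mult_mono) auto
    also have "\<dots> = y ^ 5 - y ^ 3" by (simp add: algebra_simps flip: power_add)
    finally show ?thesis by simp
  qed
  have "real (b (Suc \<rho>)) \<le> 2 * y ^ (4 * Suc \<rho> + 1)" for \<rho>
  proof (induction \<rho>)
    case 0
    thus ?case using rstep[of 0] b0 base by simp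
  next
    case (Suc \<rho>)
    let ?p = "y ^ (4 * Suc \<rho> + 1)"
    have "?p = y ^ 5 * y ^ (4 * \<rho>)" by (simp flip: power_add)
    moreover have "y ^ (4 * \<rho>) \<ge> 1" using y1 by (intro one_le_power) auto
    ultimately have p5: "?p \<ge> y ^ 5" using y0 by simp
    have "0 \<le> y ^ 4 - 2 * y ^ 3 + 2"
    proof (rule ccontr)
      assume "\<not> ?thesis"
      hence "(y ^ 4 - 2 * y ^ 3 + 2) * y ^ 5 \<le> 0" using y0 by (intro mult_nonpos_nonneg) auto
      thus False using key by linarith
    qed
    hence "2 * (y ^ 4 - 2 * y ^ 3 + 2) * y ^ 5 \<le> 2 * (y ^ 4 - 2 * y ^ 3 + 2) * ?p" using p5 by (intro mult_left_mono) auto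
    hence k2: "3 \<le> 2 * (y ^ 4 - 2 * y ^ 3 + 2) * ?p" using key by linarith
    have "y ^ 3 \<ge> 1" using y1 by (intro one_le_power) auto
    hence "2 * (y ^ 3 - 1) * real (b (Suc \<rho>)) \<le> 2 * (y ^ 3 - 1) * (2 * ?p)" using Suc by (intro mult_left_mono) auto
    hence "real (b (Suc (Suc \<rho>))) \<le> 2 * (y ^ 3 - 1) * (2 * ?p) + 3" using rstep[of "Suc \<rho>"] by linarith
    also have "\<dots> \<le> 2 * (y ^ 3 - 1) * (2 * ?p) + 2 * (y ^ 4 - 2 * y ^ 3 + 2) * ?p" using k2 by linarith
    also have "\<dots> = 2 * (y ^ 4 * ?p)" by (simp only: algebra_simps)
    also have "y ^ 4 * ?p = y ^ (4 * Suc (Suc \<rho>) + 1)" unfolding power_add[symmetric] by simp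
    finally show ?case .
  qed
  moreover have "real (b 0) \<le> 2 * y ^ (4 * 0 + 1)" using b0 y1 by simp
  ultimately show ?thesis unfolding pw by (cases \<rho>) (simp_all only:)
qed

section \<open>Energy of a family of cochains on a family of spheres\<close>

text \<open>A simplex of dimension \<open>i\<close> has \<open>(i+1)!\<close> orderings.\<close>
lemma sum_ordered_simplices:
  fixes F :: "'v set \<Rightarrow> real"
  assumes "finite X" "abstract_complex X"
  shows "(\<Sum>vs\<in>ordered_simplices i X. F (set vs)) = fact (i + 1) * (\<Sum>\<tau>\<in>simplices i X. F \<tau>)"
proof -
  have fin: "finite (simplices i X)" using assms(1) by (simp add: simplices_def)
  have eq: "ordered_simplices i X = (\<Union>\<tau>\<in>simplices i X. permutations_of_set \<tau>)"
    using distinct_card by (fastforce simp: ordered_simplices_def simplices_def permutations_of_set_def)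
  have "(\<Sum>vs\<in>ordered_simplices i X. F (set vs)) = (\<Sum>\<tau>\<in>simplices i X. \<Sum>vs\<in>permutations_of_set \<tau>. F (set vs))"
    unfolding eq by (rule sum.UNION_disjoint[OF fin], simp) (auto simp: permutations_of_set_def)
  also have "\<dots> = (\<Sum>\<tau>\<in>simplices i X. fact (i + 1) * F \<tau>)"
  proof (rule sum.cong[OF refl])
    fix \<tau> assume "\<tau> \<in> simplices i X"
    hence \<tau>: "finite \<tau>" "card \<tau> = i + 1" using assms(2) by (auto simp: simplices_def abstract_complex_def)
    have "(\<Sum>vs\<in>permutations_of_set \<tau>. F (set vs)) = (\<Sum>vs\<in>permutations_of_set \<tau>. F \<tau>)"
      by (rule sum.cong) (auto simp: permutations_of_set_def)
    thus "(\<Sum>vs\<in>permutations_of_set \<tau>. F (set vs)) = fact (i + 1) * F \<tau>" using \<tau> by (simp del: fact_Suc)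
  qed
  finally show ?thesis by (simp add: sum_distrib_left)
qed

lemma cochain_norm_eq:
  assumes "finite X" "abstract_complex X" "\<phi> \<in> cochains i X"
  shows "cochain_inner n X i \<phi> \<phi> = (\<Sum>\<tau>\<in>simplices i X. simplex_weight n X \<tau> * (\<phi> (chosen_order \<tau>))\<^sup>2)"
proof -
  have "cochain_inner n X i \<phi> \<phi> =
      (\<Sum>vs\<in>ordered_simplices i X. (\<lambda>\<tau>. simplex_weight n X \<tau> / fact (i + 1) * (\<phi> (chosen_order \<tau>))\<^sup>2) (set vs))"
    unfolding cochain_inner_def
  proof (rule sum.cong[OF refl])
    fix vs assume "vs \<in> ordered_simplices i X"
    hence vs: "distinct vs" "length vs = Suc i" by (auto simp: ordered_simplices_def)
    have "\<phi> vs * \<phi> vs = (\<phi> (chosen_order (set vs)))\<^sup>2"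
      using alternating_mult_mset[OF cochain_alternating[OF assms(3)] cochain_alternating[OF assms(3)]
        mset_chosen_order[OF vs(1)] vs(2)] by (simp add: power2_eq_square)
    thus "simplex_weight n X (set vs) / fact (i + 1) * \<phi> vs * \<phi> vs =
      (\<lambda>\<tau>. simplex_weight n X \<tau> / fact (i + 1) * (\<phi> (chosen_order \<tau>))\<^sup>2) (set vs)" by (simp add: mult.assoc)
  qed
  also have "\<dots> = fact (i + 1) * (\<Sum>\<tau>\<in>simplices i X. simplex_weight n X \<tau> / fact (i + 1) * (\<phi> (chosen_order \<tau>))\<^sup>2)"
    by (rule sum_ordered_simplices[OF assms(1,2)])
  finally show ?thesis by (simp add: sum_distrib_left)
qed

text \<open>Double counting of pairs of a \<open>(k+1)\<close>-simplex and an \<open>n\<close>-simplex that contains it.\<close>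
lemma total_weight:
  assumes "finite X" "abstract_complex X" "k < n"
  shows "(\<Sum>\<sigma>\<in>simplices (Suc k) X. simplex_weight n X \<sigma>) = fact (n + 1) / fact (k + 2) * real (card (simplices n X))"
proof -
  have fin: "finite (simplices i X)" for i using assms(1) by (simp add: simplices_def)
  have div: "x = y / K" if "K \<noteq> 0" "K * x = y" for K x y :: real using that by (simp add: field_simps)
  have "(\<Sum>\<sigma>\<in>simplices (Suc k) X. simplex_weight n X \<sigma>)
     = (\<Sum>\<sigma>\<in>simplices (Suc k) X. fact (n - Suc k) * real (card {\<rho> \<in> simplices n X. \<sigma> \<subseteq> \<rho>}))"
    by (rule sum.cong) (auto simp: simplex_weight_def simplices_def)
  also have "\<dots> = fact (n - Suc k) * real (\<Sum>\<sigma>\<in>simplices (Suc k) X. card {\<rho> \<in> simplices n X. \<sigma> \<subseteq> \<rho>})"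
    by (simp add: sum_distrib_left)
  also have "(\<Sum>\<sigma>\<in>simplices (Suc k) X. card {\<rho> \<in> simplices n X. \<sigma> \<subseteq> \<rho>}) = (\<Sum>\<rho>\<in>simplices n X. card {\<sigma> \<in> simplices (Suc k) X. \<sigma> \<subseteq> \<rho>})"
    using sum.swap_restrict[OF fin[of "Suc k"] fin[of n], of "\<lambda>_ _. 1::nat" "\<lambda>\<sigma> \<rho>. \<sigma> \<subseteq> \<rho>"] by simp
  also have "\<dots> = (\<Sum>\<rho>\<in>simplices n X. (n + 1) choose (k + 2))"
  proof (rule sum.cong[OF refl])
    fix \<rho> assume "\<rho> \<in> simplices n X"
    hence \<rho>: "\<rho> \<in> X" "card \<rho> = n + 1" "finite \<rho>" using assms(2) by (auto simp: simplices_def abstract_complex_def)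
    have "\<sigma> \<in> X" if "\<sigma> \<subseteq> \<rho>" "card \<sigma> = k + 2" for \<sigma>
    proof -
      have "\<sigma> \<noteq> {}" using that(2) by auto
      thus ?thesis using assms(2) \<rho>(1) that(1) unfolding abstract_complex_def by blast
    qed
    hence "{\<sigma> \<in> simplices (Suc k) X. \<sigma> \<subseteq> \<rho>} = {\<sigma>. \<sigma> \<subseteq> \<rho> \<and> card \<sigma> = k + 2}" by (auto simp: simplices_def)
    thus "card {\<sigma> \<in> simplices (Suc k) X. \<sigma> \<subseteq> \<rho>} = (n + 1) choose (k + 2)" using n_subsets[OF \<rho>(3)] \<rho>(2) by simp
  qed
  finally have "(\<Sum>\<sigma>\<in>simplices (Suc k) X. simplex_weight n X \<sigma>) =
      (fact (n - Suc k) * real ((n + 1) choose (k + 2))) * real (card (simplices n X))" by simp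
  moreover {
  have "fact (k + 2) * fact (n - Suc k) * real ((n + 1) choose (k + 2)) = fact (n + 1)"
  proof -
    have "fact (k + 2) * fact (n + 1 - (k + 2)) * ((n + 1) choose (k + 2)) = (fact (n + 1) :: nat)"
      by (rule binomial_fact_lemma) (use assms(3) in simp)
    moreover have "n + 1 - (k + 2) = n - Suc k" by simp
    ultimately show ?thesis by (metis of_nat_fact of_nat_mult)
  qed
  hence "fact (n - Suc k) * real ((n + 1) choose (k + 2)) = fact (n + 1) / fact (k + 2)"
    using div[of "fact (k + 2)" "fact (n - Suc k) * real ((n + 1) choose (k + 2))"] by (simp only: mult.assoc fact_nonzero not_False_eq_True) }
  ultimately show ?thesis by (simp only:)
qed

text \<open>Subtract from \<open>\<phi>\<close> the cocycle given by the spectral gap. As the cohomology vanishes, this cocycle is a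
coboundary and pairs to zero with all spheres. For the difference \<open>\<theta>\<close>, the Cauchy--Schwarz inequality bounds the square of
each pairing by \<open>s\<close> times the sum of \<open>\<theta>\<^sup>2\<close> over the facets, and a simplex \<open>\<tau>\<close> is counted at most
\<open>m(\<tau>) / l\<close> times when the spheres are summed.\<close>
lemma facet_pairing_poincare:
  fixes r :: "'v set set \<Rightarrow> 'v \<Rightarrow> real^'d::{finite,linorder}"
  assumes X: "finite X" "pure_complex n X" and k: "k \<ge> 1"
    and H: "cohomology_vanishes X k" and spec: "up_spectrum n X k - {0} \<subseteq> {lam..}" and lam: "lam > 0"
    and A: "finite A" "\<And>S. S \<in> A \<Longrightarrow> S \<subseteq> X \<and> polytope_sphere S (r S) k \<and> card (simplices k S) \<le> s"
    and l: "l > 0" "\<And>\<tau>. \<tau> \<in> simplices k X \<Longrightarrow> l * real (card {S \<in> A. \<tau> \<in> S}) \<le> simplex_weight n X \<tau>"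
    and \<phi>: "\<phi> \<in> cochains k X"
  shows "(\<Sum>S\<in>A. (polytope_sphere.facet_pairing S (r S) k \<phi>)\<^sup>2)
     \<le> real s / (l * lam) * cochain_inner n X (Suc k) (coboundary X k \<phi>) (coboundary X k \<phi>)"
proof -
  have acX: "abstract_complex X" using X(2) by (simp add: pure_complex_def)
  obtain j where j: "k = Suc j" using k by (cases k) auto
  obtain \<psi> where \<psi>: "\<psi> \<in> cocycles X k" and gap: "lam * cochain_inner n X k (\<lambda>vs. \<phi> vs - \<psi> vs) (\<lambda>vs. \<phi> vs - \<psi> vs)
    \<le> cochain_inner n X (Suc k) (coboundary X k \<phi>) (coboundary X k \<phi>)"
    using up_spectrum_gap[OF X spec \<phi>] by blast
  have "\<psi> \<in> coboundary X j ` cochains j X" using \<psi> H j by (simp add: cohomology_vanishes_def coboundaries_def)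
  then obtain \<eta> where \<eta>: "\<eta> \<in> cochains j X" "\<psi> = coboundary X j \<eta>" by blast
  define \<theta> where "\<theta> = (\<lambda>vs. \<phi> vs - \<psi> vs)"
  have \<theta>: "\<theta> \<in> cochains k X" unfolding \<theta>_def
    by (rule function_subspace_diff[OF function_subspace_cochains \<phi>]) (use \<psi> in \<open>simp add: cocycles_def\<close>)
  have finV: "finite (simplices k X)" using X(1) by (simp add: simplices_def)
  let ?x = "\<lambda>\<tau>. (\<theta> (chosen_order \<tau>))\<^sup>2"
  have one: "(polytope_sphere.facet_pairing S (r S) k \<phi>)\<^sup>2 \<le> real s * (\<Sum>\<tau>\<in>simplices k S. ?x \<tau>)" if S: "S \<in> A" for S
  proof -
    interpret polytope_sphere S "r S" k using A(2)[OF S] by blast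
    have SX: "S \<subseteq> X" and finS: "finite S" using A(2)[OF S] X(1) finite_subset by blast+
    let ?o = "orientation_sign S (r S)"
    have "facet_pairing \<phi> = facet_pairing \<theta> + facet_pairing \<psi>"
      unfolding facet_pairing_def \<theta>_def sum.distrib[symmetric] by (rule sum.cong) (auto simp: algebra_simps)
    hence "facet_pairing \<phi> = facet_pairing \<theta>" using stokes[OF finS SX j \<eta>(1)] \<eta>(2) by simp
    hence "(facet_pairing \<phi>)\<^sup>2 \<le> (\<Sum>\<tau>\<in>simplices k S. (?o (chosen_order \<tau>))\<^sup>2) * (\<Sum>\<tau>\<in>simplices k S. ?x \<tau>)"
      unfolding facet_pairing_def by (simp only: Cauchy_Schwarz_ineq_sum)
    also have "(\<Sum>\<tau>\<in>simplices k S. (?o (chosen_order \<tau>))\<^sup>2) \<le> (\<Sum>\<tau>\<in>simplices k S. 1)"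
      by (rule sum_mono) (simp add: orientation_sign_def Let_def sgn_if)
    also have "\<dots> \<le> real s" using A(2)[OF S] by simp
    finally show ?thesis by (simp add: mult_right_mono sum_nonneg)
  qed
  have "(\<Sum>S\<in>A. \<Sum>\<tau>\<in>simplices k S. ?x \<tau>) = (\<Sum>S\<in>A. \<Sum>\<tau>\<in>{\<tau>\<in>simplices k X. \<tau> \<in> S}. ?x \<tau>)"
  proof (rule sum.cong[OF refl])
    fix S assume "S \<in> A"
    hence "simplices k S = {\<tau>\<in>simplices k X. \<tau> \<in> S}" using A(2) by (auto simp: simplices_def)
    thus "(\<Sum>\<tau>\<in>simplices k S. ?x \<tau>) = (\<Sum>\<tau>\<in>{\<tau>\<in>simplices k X. \<tau> \<in> S}. ?x \<tau>)" by simp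
  qed
  also have "\<dots> = (\<Sum>\<tau>\<in>simplices k X. \<Sum>S\<in>{S\<in>A. \<tau> \<in> S}. ?x \<tau>)"
    by (rule sum.swap_restrict[OF A(1) finV])
  also have "\<dots> = (\<Sum>\<tau>\<in>simplices k X. real (card {S\<in>A. \<tau> \<in> S}) * ?x \<tau>)" by simp
  also have "\<dots> \<le> (\<Sum>\<tau>\<in>simplices k X. simplex_weight n X \<tau> / l * ?x \<tau>)"
    by (intro sum_mono mult_right_mono) (use l in \<open>simp_all add: pos_le_divide_eq mult.commute\<close>)
  also have "\<dots> = cochain_inner n X k \<theta> \<theta> / l"
    unfolding cochain_norm_eq[OF X(1) acX \<theta>] by (simp add: sum_divide_distrib)
  also have "\<dots> \<le> cochain_inner n X (Suc k) (coboundary X k \<phi>) (coboundary X k \<phi>) / lam / l"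
    using gap lam l(1) unfolding \<theta>_def[symmetric] by (intro divide_right_mono) (simp_all add: pos_le_divide_eq mult.commute)
  finally have inner: "(\<Sum>S\<in>A. \<Sum>\<tau>\<in>simplices k S. ?x \<tau>)
    \<le> cochain_inner n X (Suc k) (coboundary X k \<phi>) (coboundary X k \<phi>) / lam / l" .
  have "(\<Sum>S\<in>A. (polytope_sphere.facet_pairing S (r S) k \<phi>)\<^sup>2) \<le> (\<Sum>S\<in>A. real s * (\<Sum>\<tau>\<in>simplices k S. ?x \<tau>))"
    by (rule sum_mono[OF one])
  also have "\<dots> = real s * (\<Sum>S\<in>A. \<Sum>\<tau>\<in>simplices k S. ?x \<tau>)" by (rule sum_distrib_left[symmetric])
  also have "\<dots> \<le> real s * (cochain_inner n X (Suc k) (coboundary X k \<phi>) (coboundary X k \<phi>) / lam / l)"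
    by (rule mult_left_mono[OF inner]) simp
  finally show ?thesis by (simp add: mult.commute)
qed

text \<open>The pairing with the boundary of \<open>\<sigma>\<close> is the coboundary evaluated on \<open>\<sigma>\<close>, so \<open>M\<close> bounds the total energy density.\<close>
lemma sum_facet_pairings_le:
  fixes r :: "'v set set \<Rightarrow> 'v \<Rightarrow> real^'d::{finite,linorder}" and \<phi> :: "'i \<Rightarrow> 'v list \<Rightarrow> real"
  assumes X: "finite X" "pure_complex n X" and k: "k \<ge> 1" "k < n"
    and H: "cohomology_vanishes X k" and spec: "up_spectrum n X k - {0} \<subseteq> {lam..}" and lam: "lam > 0"
    and A: "finite A" "\<And>S. S \<in> A \<Longrightarrow> S \<subseteq> X \<and> polytope_sphere S (r S) k \<and> card (simplices k S) \<le> s"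
    and l: "l > 0" "\<And>\<tau>. \<tau> \<in> simplices k X \<Longrightarrow> l * real (card {S \<in> A. \<tau> \<in> S}) \<le> simplex_weight n X \<tau>"
    and \<phi>: "\<And>i. i \<in> I \<Longrightarrow> \<phi> i \<in> cochains k X"
    and M: "\<And>\<sigma>. \<sigma> \<in> simplices (Suc k) X \<Longrightarrow> polytope_sphere (simplex_boundary \<sigma>) (r (simplex_boundary \<sigma>)) k \<and>
      (\<Sum>i\<in>I. (polytope_sphere.facet_pairing (simplex_boundary \<sigma>) (r (simplex_boundary \<sigma>)) k (\<phi> i))\<^sup>2) \<le> M"
  shows "(\<Sum>S\<in>A. \<Sum>i\<in>I. (polytope_sphere.facet_pairing S (r S) k (\<phi> i))\<^sup>2)
     \<le> real s / (l * lam) * (M * (fact (n + 1) / fact (k + 2) * real (card (simplices n X))))"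
proof -
  have acX: "abstract_complex X" using X(2) by (simp add: pure_complex_def)
  let ?d = "\<lambda>i. coboundary X k (\<phi> i)"
  have "(\<Sum>i\<in>I. cochain_inner n X (Suc k) (?d i) (?d i)) =
      (\<Sum>vs\<in>ordered_simplices (Suc k) X. simplex_weight n X (set vs) / fact (Suc k + 1) * (\<Sum>i\<in>I. (?d i vs)\<^sup>2))"
    unfolding cochain_inner_def sum_distrib_left by (subst sum.swap) (simp add: power2_eq_square mult.assoc)
  also have "\<dots> \<le> (\<Sum>vs\<in>ordered_simplices (Suc k) X. (\<lambda>\<sigma>. simplex_weight n X \<sigma> / fact (Suc k + 1) * M) (set vs))"
  proof (rule sum_mono)
    fix vs assume vs: "vs \<in> ordered_simplices (Suc k) X"
    let ?\<sigma> = "set vs"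
    have \<sigma>: "?\<sigma> \<in> simplices (Suc k) X" using vs by (auto simp: ordered_simplices_def simplices_def distinct_card)
    note m = M[OF \<sigma>]
    have "(\<Sum>i\<in>I. (?d i vs)\<^sup>2) = (\<Sum>i\<in>I. (polytope_sphere.facet_pairing (simplex_boundary ?\<sigma>) (r (simplex_boundary ?\<sigma>)) k (\<phi> i))\<^sup>2)"
      by (rule sum.cong[OF refl]) (use facet_pairing_simplex_boundary[OF conjunct1[OF m] k(1) vs refl \<phi>] in simp)
    hence "(\<Sum>i\<in>I. (?d i vs)\<^sup>2) \<le> M" using m by simp
    moreover have "simplex_weight n X ?\<sigma> \<ge> 0" by (simp add: simplex_weight_def)
    ultimately show "simplex_weight n X ?\<sigma> / fact (Suc k + 1) * (\<Sum>i\<in>I. (?d i vs)\<^sup>2)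
      \<le> (\<lambda>\<sigma>. simplex_weight n X \<sigma> / fact (Suc k + 1) * M) ?\<sigma>" by (intro mult_left_mono) auto
  qed
  also have "\<dots> = fact (Suc k + 1) * (\<Sum>\<sigma>\<in>simplices (Suc k) X. simplex_weight n X \<sigma> / fact (Suc k + 1) * M)"
    by (rule sum_ordered_simplices[OF X(1) acX])
  also have "\<dots> = M * (\<Sum>\<sigma>\<in>simplices (Suc k) X. simplex_weight n X \<sigma>)"
    by (simp add: sum_distrib_left mult.commute)
  also have "\<dots> = M * (fact (n + 1) / fact (k + 2) * real (card (simplices n X)))"
    unfolding total_weight[OF X(1) acX k(2)] ..
  finally have inner: "(\<Sum>i\<in>I. cochain_inner n X (Suc k) (?d i) (?d i))
    \<le> M * (fact (n + 1) / fact (k + 2) * real (card (simplices n X)))" .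
  have "(\<Sum>S\<in>A. \<Sum>i\<in>I. (polytope_sphere.facet_pairing S (r S) k (\<phi> i))\<^sup>2)
      = (\<Sum>i\<in>I. \<Sum>S\<in>A. (polytope_sphere.facet_pairing S (r S) k (\<phi> i))\<^sup>2)" by (rule sum.swap)
  also have "\<dots> \<le> (\<Sum>i\<in>I. real s / (l * lam) * cochain_inner n X (Suc k) (?d i) (?d i))"
    by (rule sum_mono, rule facet_pairing_poincare[OF X k(1) H spec lam A l \<phi>])
  also have "\<dots> = real s / (l * lam) * (\<Sum>i\<in>I. cochain_inner n X (Suc k) (?d i) (?d i))" by (rule sum_distrib_left[symmetric])
  also have "\<dots> \<le> real s / (l * lam) * (M * (fact (n + 1) / fact (k + 2) * real (card (simplices n X))))"
    by (rule mult_left_mono[OF inner]) (use l(1) lam in simp)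
  finally show ?thesis .
qed

text \<open>The sums in \<open>hilbert_fill\<close> evaluate the integrals on one ordering of each facet, and by antisymmetry these
values define cochains on all of \<open>X\<close>.\<close>
lemma hilbert_fill_eq_facet_pairings:
  fixes r :: "'v \<Rightarrow> real ^ 'd::{finite,linorder}"
  assumes "polytope_sphere S r k" "S \<subseteq> X"
  shows "(hilbert_fill bs r k f S)\<^sup>2 =
    (\<Sum>is | length is = k + 1 \<and> sorted_wrt (<) is \<and> set is \<subseteq> {..<length bs}.
      (polytope_sphere.facet_pairing S r k
        (antisymmetric_extension k X (\<lambda>\<tau>. form_integral bs k f is (chosen_order \<tau>))))\<^sup>2)"
proof -
  interpret polytope_sphere S r k by fact
  have "facet_pairing (antisymmetric_extension k X (\<lambda>\<tau>. form_integral bs k f is (chosen_order \<tau>))) =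
    (\<Sum>\<tau>\<in>simplices k S. let vs = (SOME vs. distinct vs \<and> set vs = \<tau>) in orientation_sign S r vs * form_integral bs k f is vs)" for "is"
    unfolding facet_pairing_def
  proof (rule sum.cong[OF refl])
    fix \<tau> assume "\<tau> \<in> simplices k S"
    hence \<tau>: "\<tau> \<in> X" "finite \<tau>" "card \<tau> = Suc k" using assms(2) simplex_finite by (auto simp: simplices_def)
    show "orientation_sign S r (chosen_order \<tau>) * antisymmetric_extension k X (\<lambda>\<tau>. form_integral bs k f is (chosen_order \<tau>)) (chosen_order \<tau>)
      = (let vs = (SOME vs. distinct vs \<and> set vs = \<tau>) in orientation_sign S r vs * form_integral bs k f is vs)"
      unfolding antisymmetric_extension_chosen[OF \<tau>] by (simp add: chosen_order_def Let_def)
  qed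
  thus ?thesis unfolding hilbert_fill_def by (simp add: sum_nonneg)
qed

section \<open>Spheres with small gallery filling\<close>

lemma gallery_fill_attained:
  assumes "gallery_connected X k" "S \<subseteq> X"
  obtains F where "gallery_filling X k S F" "card F = gallery_fill X k S"
proof -
  have SV: "simplices k S \<subseteq> simplices k X" using assms(2) by (auto simp: simplices_def)
  have "gallery_filling X k S (simplices (k + 1) X)"
    unfolding gallery_filling_def
  proof (intro conjI ballI subset_refl)
    fix \<eta>0 \<eta>1 assume "\<eta>0 \<in> simplices k S" "\<eta>1 \<in> simplices k S"
    then obtain gs where gs: "gallery X k gs" "gallery_connects gs \<eta>0 \<eta>1"
      using assms(1) SV unfolding gallery_connected_def by blast
    thus "\<exists>gs. gallery X k gs \<and> set gs \<subseteq> simplices (k + 1) X \<and> gallery_connects gs \<eta>0 \<eta>1" by (auto simp: gallery_def)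
  qed
  hence "\<exists>c F. gallery_filling X k S F \<and> card F = c" by blast
  hence "\<exists>F. gallery_filling X k S F \<and> card F = gallery_fill X k S"
    unfolding gallery_fill_def by (rule LeastI_ex)
  thus ?thesis using that by blast
qed

lemma gallery_fill_pos:
  assumes "finite X" "gallery_connected X k" "S \<subseteq> X" "simplices k S \<noteq> {}"
  shows "gallery_fill X k S \<ge> 1"
proof -
  obtain F where F: "gallery_filling X k S F" "card F = gallery_fill X k S"
    by (rule gallery_fill_attained[OF assms(2,3)])
  have "finite (simplices (k + 1) X)" using assms(1) by (simp add: simplices_def)
  hence finF: "finite F" using F(1) finite_subset unfolding gallery_filling_def by blast
  obtain \<tau> where "\<tau> \<in> simplices k S" using assms(4) by blast
  then obtain gs where "gallery X k gs" "set gs \<subseteq> F" using F(1) unfolding gallery_filling_def by blast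
  hence "F \<noteq> {}" by (auto simp: gallery_def)
  thus ?thesis using finF F(2) by (metis One_nat_def Suc_le_eq card_gt_0_iff)
qed

text \<open>The simplex itself is a filling.\<close>
lemma gallery_fill_simplex_boundary:
  assumes "\<sigma> \<in> simplices (k + 1) X"
  shows "gallery_fill X k (simplex_boundary \<sigma>) \<le> 1"
  unfolding gallery_fill_def
proof (rule Least_le)
  have "gallery_filling X k (simplex_boundary \<sigma>) {\<sigma>}"
    unfolding gallery_filling_def
  proof (intro conjI ballI)
    fix \<eta>0 \<eta>1 assume "\<eta>0 \<in> simplices k (simplex_boundary \<sigma>)" "\<eta>1 \<in> simplices k (simplex_boundary \<sigma>)"
    hence "gallery X k [\<sigma>] \<and> set [\<sigma>] \<subseteq> {\<sigma>} \<and> gallery_connects [\<sigma>] \<eta>0 \<eta>1"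
      using assms by (auto simp: gallery_def gallery_connects_def simplices_def simplex_boundary_def)
    thus "\<exists>gs. gallery X k gs \<and> set gs \<subseteq> {\<sigma>} \<and> gallery_connects gs \<eta>0 \<eta>1" by blast
  qed (use assms in simp)
  thus "\<exists>F. gallery_filling X k (simplex_boundary \<sigma>) F \<and> card F = 1" by (intro exI[of _ "{\<sigma>}"]) simp
qed

text \<open>All facets of a sphere in \<open>N\<close> lie in the ball of radius \<open>\<rho>\<close>, about \<open>3/4 * R\<close>, around some centre, and the ball has at most
\<open>2 * (D * k) powr (R + 1)\<close> elements.\<close>
lemma card_small_filling_le:
  fixes r :: "'v set set \<Rightarrow> 'v \<Rightarrow> real^'d::{finite,linorder}"
  assumes X: "finite X" "pure_complex n X" and k: "k \<ge> 1" "k < n" and conn: "gallery_connected X k"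
    and D: "\<And>\<tau>. \<tau> \<in> simplices k X \<Longrightarrow> card {\<sigma> \<in> simplices (k + 1) X. \<tau> \<subseteq> \<sigma>} \<le> D" and a: "D * k > 1"
    and N: "finite N" "\<And>S. S \<in> N \<Longrightarrow> S \<subseteq> X \<and> polytope_sphere S (r S) k \<and> card (simplices k S) \<le> s"
    and R: "R \<ge> 0" "\<And>S. S \<in> N \<Longrightarrow> 2 * real (gallery_fill X k S) \<le> 3 * R"
  shows "3 * real (card N) \<le> real (card (simplices k X)) * (2 * real (D * k) powr (R + 1)) ^ (s - 1)"
proof -
  have acX: "abstract_complex X" using X(2) by (simp add: pure_complex_def)
  let ?V = "simplices k X" and ?T = "simplices (k + 1) X"
  have finVT: "finite ?V" "finite ?T" using X(1) by (simp_all add: simplices_def)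
  define Rl where "Rl = joined ?V ?T"
  define B where "B c \<rho> = {\<tau>. (c, \<tau>) \<in> Rl\<^sup>* \<and> steps Rl c \<tau> \<le> \<rho>}" for c \<rho>
  \<comment> \<open>At least \<open>(q + 1) div 2\<close>, the radius of a filling with q elements, whenever \<open>q \<le> 3/2 * R\<close>.\<close>
  define \<rho> where "\<rho> = nat \<lfloor>(3 * R / 2 + 1) / 2\<rfloor>"
  define b where "b = nat \<lfloor>2 * real (D * k) powr (R + 1)\<rfloor>"
  have deg: "{\<sigma> \<in> ?T. \<tau> \<subseteq> \<sigma>} \<noteq> {} \<and> card {\<sigma> \<in> ?T. \<tau> \<subseteq> \<sigma>} \<le> D" if \<tau>: "\<tau> \<in> ?V" for \<tau>
  proof -
    have t: "\<tau> \<in> X" "card \<tau> = Suc k" "finite \<tau>" using \<tau> acX by (auto simp: simplices_def abstract_complex_def)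
    obtain \<rho> where \<rho>: "\<rho> \<in> simplices n X" "\<tau> \<subseteq> \<rho>" using X(2) t(1) by (auto simp: pure_complex_def)
    hence "card \<rho> \<noteq> card \<tau>" using t(2) k(2) by (simp add: simplices_def)
    hence "\<rho> \<noteq> \<tau>" by blast
    then obtain v where v: "v \<in> \<rho>" "v \<notin> \<tau>" using \<rho>(2) by blast
    have "insert v \<tau> \<subseteq> \<rho>" using v \<rho>(2) by simp
    hence "insert v \<tau> \<in> X" using acX \<rho>(1) unfolding abstract_complex_def simplices_def by blast
    hence "insert v \<tau> \<in> {\<sigma> \<in> ?T. \<tau> \<subseteq> \<sigma>}" using t v by (auto simp: simplices_def)
    thus ?thesis using D[OF \<tau>] by blast
  qed
  note growth0 = ball_growth[OF X(1) acX _ deg, folded Rl_def]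
  have ball: "finite (B c \<rho>) \<and> card (B c \<rho>) \<le> b" if c: "c \<in> ?V" for c
  proof -
    note growth = growth0[OF c, folded B_def]
    have cB: "c \<in> B c \<rho>" for \<rho> using steps_le[where x = c and y = c and R = Rl and j = 0] by (simp add: B_def)
    have "real (card (B c \<rho>)) \<le> 2 * real (D * k) powr ((4 * real \<rho> + 1) / 3)"
    proof (rule ball_size_bound[OF a])
      show "card (B c 0) = 1" using growth(3) by simp
      show "card (B c \<rho>) \<ge> 1" for \<rho> using card_mono[OF growth(1)[of \<rho>], of "{c}"] cB[of \<rho>] by simp
      show "card (B c (Suc \<rho>)) \<le> (k + 1) * (D - 1) * card (B c \<rho>) + (k + 2)" for \<rho> by (rule growth(2))
    qed
    also have "\<dots> \<le> 2 * real (D * k) powr (R + 1)"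
    proof -
      have "real \<rho> \<le> (3 * R / 2 + 1) / 2" unfolding \<rho>_def by (rule of_nat_floor) (use R(1) in simp)
      hence "(4 * real \<rho> + 1) / 3 \<le> R + 1" by simp
      moreover have "1 \<le> real (D * k)" using a by linarith
      ultimately show ?thesis by (intro mult_left_mono powr_mono) auto
    qed
    finally show ?thesis using growth(1) by (simp add: b_def le_nat_floor)
  qed
  have centre: "\<exists>c\<in>?V. simplices k S \<subseteq> B c \<rho>" if S: "S \<in> N" for S
  proof -
    interpret polytope_sphere S "r S" k using N(2)[OF S] by blast
    have SV: "simplices k S \<subseteq> ?V" using N(2)[OF S] by (auto simp: simplices_def)
    obtain F where F: "gallery_filling X k S F" "card F = gallery_fill X k S"
      using gallery_fill_attained[OF conn] N(2)[OF S] by blast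
    have FT: "F \<subseteq> ?T" using F(1) by (simp add: gallery_filling_def)
    have finF: "finite F" using FT finVT(2) finite_subset by blast
    obtain \<tau>0 where \<tau>0: "\<tau>0 \<in> simplices k S" using facets_nonempty by blast
    obtain c where c: "c \<in> ?V" "\<And>\<tau>. (\<tau>0, \<tau>) \<in> (joined ?V F)\<^sup>* \<Longrightarrow>
        (c, \<tau>) \<in> (joined ?V F)\<^sup>* \<and> steps (joined ?V F) c \<tau> \<le> (card F + 1) div 2"
      using centre_exists[OF finVT(1) finF, of \<tau>0] \<tau>0 SV by blast
    have "\<tau> \<in> B c \<rho>" if \<tau>: "\<tau> \<in> simplices k S" for \<tau>
    proof -
      obtain gs where gs: "gallery X k gs" "set gs \<subseteq> F" "gallery_connects gs \<tau>0 \<tau>"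
        using F(1) \<tau>0 \<tau> unfolding gallery_filling_def by blast
      have "(\<tau>0, \<tau>) \<in> (joined ?V F)\<^sup>*"
        by (rule gallery_joined[OF gs(1,2) _ _ gs(3)]) (use \<tau>0 \<tau> SV in auto)
      note c' = c(2)[OF this]
      have mono: "joined ?V F \<subseteq> Rl" unfolding Rl_def by (rule joined_mono[OF FT])
      have "(c, \<tau>) \<in> joined ?V F ^^ steps (joined ?V F) c \<tau>" using c' by (intro steps_attained) blast
      hence cR: "(c, \<tau>) \<in> Rl ^^ steps (joined ?V F) c \<tau>" using relpow_subset[OF mono] by blast
      have "steps Rl c \<tau> \<le> (card F + 1) div 2" using steps_le[OF cR] c' by linarith
      also have "\<dots> \<le> \<rho>"
      proof -
        have "2 * ((card F + 1) div 2) \<le> card F + 1" by simp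
        hence "real (2 * ((card F + 1) div 2)) \<le> real (card F + 1)" by (simp only: of_nat_le_iff)
        hence "real ((card F + 1) div 2) \<le> (real (card F) + 1) / 2" by simp
        also have "\<dots> \<le> (3 * R / 2 + 1) / 2" using R(2)[OF S] F(2) by simp
        finally show ?thesis unfolding \<rho>_def by (rule le_nat_floor)
      qed
      finally show ?thesis using relpow_imp_rtrancl[OF cR] by (simp add: B_def)
    qed
    thus ?thesis using c(1) by blast
  qed
  have "\<exists>cc. \<forall>S\<in>N. cc S \<in> ?V \<and> simplices k S \<subseteq> B (cc S) \<rho>" using centre by (intro bchoice) blast
  then obtain cc where cc: "\<And>S. S \<in> N \<Longrightarrow> cc S \<in> ?V" "\<And>S. S \<in> N \<Longrightarrow> simplices k S \<subseteq> B (cc S) \<rho>" by blast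
  have "3 * card N \<le> card ?V * b ^ (s - 1)"
  proof (rule card_by_punctured_facets[where fac = "simplices k" and c = cc and nbh = "\<lambda>c. B c \<rho>", OF N(1) finVT(1) cc ball])
    fix S assume S: "S \<in> N"
    have finS: "finite S" using N(2)[OF S] X(1) finite_subset by blast
    show "3 \<le> card (simplices k S) \<and> card (simplices k S) \<le> s"
      using polytope_sphere.three_facets[of S "r S" k] N(2)[OF S] k(1) finS by blast
  next
    fix S S' \<tau> \<tau>' assume *: "S \<in> N" "S' \<in> N" "\<tau> \<in> simplices k S" "\<tau>' \<in> simplices k S'"
      "simplices k S - {\<tau>} = simplices k S' - {\<tau>'}"
    have p: "polytope_sphere S (r S) k" "polytope_sphere S' (r S') k" using N(2) * by blast+
    have t: "\<tau> = \<tau>'" by (rule facet_determined_by_others[OF p k(1) *(3-5)])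
    hence f: "simplices k S = simplices k S'" using *(3-5) by blast
    have "S = S'"
      using polytope_sphere.facet_set_determines[OF p(1)] polytope_sphere.facet_set_determines[OF p(2)] unfolding f by simp
    thus "S = S' \<and> \<tau> = \<tau>'" using t by simp
  qed
  hence "real (3 * card N) \<le> real (card ?V * b ^ (s - 1))" by (simp only: of_nat_le_iff)
  also have "\<dots> = real (card ?V) * real b ^ (s - 1)" by simp
  also have "\<dots> \<le> real (card ?V) * (2 * real (D * k) powr (R + 1)) ^ (s - 1)"
    by (intro mult_left_mono power_mono) (auto simp: b_def)
  finally show ?thesis by simp
qed

text \<open>\<open>11/12\<close> of the terms are at least \<open>(3/2 * R)\<^sup>2\<close>, and \<open>11/12 * 9/4 > 2\<close>.\<close>
lemma sum_squares_fill_ge: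
  fixes g :: "'a \<Rightarrow> real"
  assumes "finite A" "R \<ge> 0" and few: "12 * real (card {S \<in> A. 2 * g S < 3 * R}) \<le> real (card A)"
  shows "2 * R\<^sup>2 * real (card A) \<le> (\<Sum>S\<in>A. (g S)\<^sup>2)"
proof -
  let ?N = "{S \<in> A. 2 * g S < 3 * R}"
  have c: "real (card (A - ?N)) = real (card A) - real (card ?N)"
    using assms(1) by (simp add: card_Diff_subset of_nat_diff card_mono)
  have "2 * R\<^sup>2 * real (card A) \<le> 9/4 * R\<^sup>2 * real (card (A - ?N))"
  proof -
    have "2 * a \<le> 9/4 * (a - m)" if "12 * m \<le> a" "0 \<le> a" for a m :: real using that by simp
    hence "2 * real (card A) \<le> 9/4 * real (card (A - ?N))" unfolding c using few by simp
    hence "R\<^sup>2 * (2 * real (card A)) \<le> R\<^sup>2 * (9/4 * real (card (A - ?N)))" by (intro mult_left_mono) auto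
    thus ?thesis by (simp add: mult_ac)
  qed
  also have "\<dots> = (\<Sum>S\<in>A - ?N. 9/4 * R\<^sup>2)" by simp
  also have "\<dots> \<le> (\<Sum>S\<in>A - ?N. (g S)\<^sup>2)"
  proof (rule sum_mono)
    fix S assume "S \<in> A - ?N"
    hence "3 / 2 * R \<le> g S" by auto
    hence "(3 / 2 * R)\<^sup>2 \<le> (g S)\<^sup>2" using assms(2) by (intro power_mono) auto
    thus "9/4 * R\<^sup>2 \<le> (g S)\<^sup>2" by (simp add: power_mult_distrib power2_eq_square)
  qed
  also have "\<dots> \<le> (\<Sum>S\<in>A. (g S)\<^sup>2)" using assms(1) by (intro sum_mono2) auto
  finally show ?thesis .
qed

section \<open>The distortion bound\<close>

lemma SUP_ereal_finite:
  assumes "finite A" "A \<noteq> {}"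
  shows "(SUP x\<in>A. ereal (h x)) = ereal (Max (h ` A))"
proof (rule antisym)
  show "(SUP x\<in>A. ereal (h x)) \<le> ereal (Max (h ` A))" using assms by (intro SUP_least) simp
  have "Max (h ` A) \<in> h ` A" using assms by (intro Max_in) auto
  then obtain x where "x \<in> A" "Max (h ` A) = h x" by blast
  thus "ereal (Max (h ` A)) \<le> (SUP x\<in>A. ereal (h x))" using SUP_upper[of x A "\<lambda>x. ereal (h x)"] by simp
qed


theorem theorem5p3:
  fixes X :: "'v set set"
    and n k s D :: nat
    and A T \<S> :: "'v set set set"
    and l lam :: real
    and f :: "('v \<Rightarrow> real) \<Rightarrow> 'h::{real_inner, complete_space}"
    and r :: "'v set set \<Rightarrow> 'v \<Rightarrow> real ^ 'd::{finite,linorder}"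
    and bs :: "'h list"
  assumes "finite X" and "pure_complex n X" and "k < n"
    and "CARD('d) = k + 1"
    and "gallery_connected X k"
    and "cohomology_vanishes X k"
    and "\<forall>S\<in>A. polytope_boundary_in TYPE('d) X S"
    and "card A \<ge> 2"
    and "l > 0" and "lam > 0"
    and "(INF \<tau>\<in>simplices k X.
            if card {S \<in> A. \<tau> \<in> S} = 0 then \<infinity>
            else ereal (simplex_weight n X \<tau> / real (card {S \<in> A. \<tau> \<in> S}))) \<ge> ereal l"
    and "(SUP S\<in>A. card (simplices k S)) \<le> s"
    and "up_spectrum n X k - {0} \<subseteq> {lam..}"
    and "D = Max ((\<lambda>\<tau>. card {\<sigma> \<in> simplices (k + 1) X. \<tau> \<subseteq> \<sigma>}) ` simplices k X)"
    and "s > 1" and "D * k > 1"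
    and "T = simplex_boundary ` simplices (k + 1) X"
    and "\<S> = A \<union> T"
    and "admissible TYPE('d) \<S> f"
    and "\<forall>S\<in>\<S>. polytope_realisation S (r S)"
    and "orthonormal_list bs"
    and "\<forall>S\<in>\<S>. f ` geometric_realisation S \<subseteq> span (set bs)"
  shows "distortion bs r X k \<S> f \<ge>
    ereal (((ln (real_of_int \<lfloor>real (card A) / 2\<rfloor> / real (card (simplices k X))) - real s * ln 2)
              / ((real s - 1) * ln (real (D * k))) - 1)
           * inverse (sqrt (fact (n + 1) * real s / (2 * fact (k + 2) * l * lam)
                            * (real (card (simplices n X)) / real (card A)))))"
proof -
  define R where "R = (ln (real_of_int \<lfloor>real (card A) / 2\<rfloor> / real (card (simplices k X))) - real s * ln 2)
              / ((real s - 1) * ln (real (D * k))) - 1"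
  define Q where "Q = fact (n + 1) * real s / (2 * fact (k + 2) * l * lam) * (real (card (simplices n X)) / real (card A))"
  define h where "h S = hilbert_fill bs (r S) k f S" for S
  define g where "g S = real (gallery_fill X k S)" for S
  note X = assms(1,2) and l = assms(9) and lam = assms(10)
  have acX: "abstract_complex X" using X(2) by (simp add: pure_complex_def)
  have k1: "k \<ge> 1" using assms(16) by (cases k) auto
  have finA: "finite A" using assms(8) by (intro card_ge_0_finite) linarith
  have AS: "S \<subseteq> X" "abstract_complex S" if "S \<in> A" for S using assms(7) that by (auto simp: polytope_boundary_in_def)
  have sphA: "polytope_sphere S (r S) k" if "S \<in> A" for S
    by unfold_locales (use that AS assms(4,18,20) in auto)
  have TX: "simplex_boundary \<sigma> \<subseteq> X" "abstract_complex (simplex_boundary \<sigma>)" if "\<sigma> \<in> simplices (k + 1) X" for \<sigma>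
  proof -
    have \<sigma>: "\<sigma> \<in> X" "finite \<sigma>" using that acX by (auto simp: simplices_def abstract_complex_def)
    show "simplex_boundary \<sigma> \<subseteq> X"
      using acX \<sigma>(1) unfolding simplex_boundary_def abstract_complex_def by blast
    show "abstract_complex (simplex_boundary \<sigma>)"
      using \<sigma>(2) finite_subset unfolding simplex_boundary_def abstract_complex_def by blast
  qed
  have sphT: "polytope_sphere (simplex_boundary \<sigma>) (r (simplex_boundary \<sigma>)) k" if "\<sigma> \<in> simplices (k + 1) X" for \<sigma>
    by unfold_locales (use that TX assms(4,17,18,20) in auto)
  have finS: "finite \<S>" using finA X(1) assms(17,18) by (simp add: simplices_def)
  have neA: "A \<noteq> {}" using assms(8) by auto
  have neS: "\<S> \<noteq> {}" using neA assms(18) by blast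
  have sph: "S \<subseteq> X \<and> polytope_sphere S (r S) k" if "S \<in> \<S>" for S
    using that AS(1) sphA TX(1) sphT assms(17,18) by blast
  have g1: "g S \<ge> 1" if "S \<in> \<S>" for S
    using gallery_fill_pos[OF X(1) assms(5)] sph[OF that] polytope_sphere.facets_nonempty by (simp add: g_def) blast
  have h0: "h S \<ge> 0" for S unfolding h_def hilbert_fill_def by (intro real_sqrt_ge_zero sum_nonneg) simp
  show ?thesis
  proof (cases "\<exists>S\<in>\<S>. h S = 0")
    case True
    thus ?thesis unfolding distortion_def h_def by simp
  next
    case False
    hence hpos: "h S > 0" if "S \<in> \<S>" for S using h0[of S] that by force
    define M1 where "M1 = Max ((\<lambda>S. h S / g S) ` \<S>)"
    define M2 where "M2 = Max ((\<lambda>S. g S / h S) ` \<S>)"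
    have dist: "distortion bs r X k \<S> f = ereal (M1 * M2)"
      using False unfolding distortion_def h_def[symmetric] g_def[symmetric] SUP_ereal_finite[OF finS neS] M1_def M2_def by simp
    have M1: "h S \<le> M1 * g S" if "S \<in> \<S>" for S
    proof -
      have "h S / g S \<le> M1" unfolding M1_def using finS that by (intro Max_ge) auto
      thus ?thesis using g1[OF that] by (simp add: pos_divide_le_eq)
    qed
    have M2: "g S \<le> M2 * h S" if "S \<in> \<S>" for S
    proof -
      have "g S / h S \<le> M2" unfolding M2_def using finS that by (intro Max_ge) auto
      thus ?thesis using hpos[OF that] by (simp add: pos_divide_le_eq)
    qed
    obtain S0 where S0: "S0 \<in> \<S>" using neS by blast
    have M1pos: "M1 > 0"
    proof (rule ccontr)
      assume "\<not> M1 > 0"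
      hence "M1 * g S0 \<le> 0" using g1[OF S0] by (intro mult_nonpos_nonneg) auto
      thus False using M1[OF S0] hpos[OF S0] by linarith
    qed
    have M2pos: "M2 > 0"
    proof (rule ccontr)
      assume "\<not> M2 > 0"
      hence "M2 * h S0 \<le> 0" using hpos[OF S0] by (intro mult_nonpos_nonneg) auto
      thus False using M2[OF S0] g1[OF S0] by linarith
    qed
    have Vfin: "finite (simplices i X)" for i using X(1) by (simp add: simplices_def)
    obtain S1 where S1: "S1 \<in> A" using neA by blast
    have Vne: "simplices k X \<noteq> {}"
      using polytope_sphere.facets_nonempty[OF sphA[OF S1]] AS(1)[OF S1] by (auto simp: simplices_def)
    have nne: "simplices n X \<noteq> {}" using X(2) by (auto simp: pure_complex_def)
    have "real (card (simplices n X)) > 0" "real (card A) > 0" "real s > 0"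
      using nne Vfin[of n] neA finA assms(15) by (simp_all add: card_gt_0_iff)
    hence Q: "Q > 0" unfolding Q_def using l lam by (intro mult_pos_pos divide_pos_pos) auto
    have facets_s: "card (simplices k S) \<le> s" if "S \<in> A" for S
    proof -
      have "card (simplices k S) \<le> (SUP S\<in>A. card (simplices k S))"
        by (rule cSUP_upper[OF that]) (use finA in simp)
      thus ?thesis using assms(12) by linarith
    qed
    have weight: "l * real (card {S \<in> A. \<tau> \<in> S}) \<le> simplex_weight n X \<tau>" if \<tau>: "\<tau> \<in> simplices k X" for \<tau>
    proof (cases "card {S \<in> A. \<tau> \<in> S} = 0")
      case True thus ?thesis by (simp add: simplex_weight_def)
    next
      case False
      have "ereal l \<le> (if card {S \<in> A. \<tau> \<in> S} = 0 then \<infinity> else ereal (simplex_weight n X \<tau> / real (card {S \<in> A. \<tau> \<in> S})))"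
        by (rule order_trans[OF assms(11) INF_lower[OF \<tau>]])
      hence "l \<le> simplex_weight n X \<tau> / real (card {S \<in> A. \<tau> \<in> S})" using False by simp
      thus ?thesis using False by (simp add: pos_le_divide_eq)
    qed
    show ?thesis
    proof (cases "R > 0")
      case False
      have "R * inverse (sqrt Q) \<le> 0" using False Q by (intro mult_nonpos_nonneg) auto
      also have "0 \<le> M1 * M2" using M1pos M2pos by simp
      finally show ?thesis unfolding dist R_def Q_def by simp
    next
      case True
      define I where "I = {is. length is = k + 1 \<and> sorted_wrt (<) is \<and> set is \<subseteq> {..<length bs}}"
      define \<phi> where "\<phi> is = antisymmetric_extension k X (\<lambda>\<tau>. form_integral bs k f is (chosen_order \<tau>))" for "is"
      have hsq: "(h S)\<^sup>2 = (\<Sum>is\<in>I. (polytope_sphere.facet_pairing S (r S) k (\<phi> is))\<^sup>2)" if "S \<in> \<S>" for S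
        unfolding h_def I_def \<phi>_def using hilbert_fill_eq_facet_pairings sph[OF that] by blast
      have energy: "(\<Sum>S\<in>A. (h S)\<^sup>2) \<le> real s / (l * lam) * (M1\<^sup>2 * (fact (n + 1) / fact (k + 2) * real (card (simplices n X))))"
      proof -
        have "(\<Sum>S\<in>A. (h S)\<^sup>2) = (\<Sum>S\<in>A. \<Sum>is\<in>I. (polytope_sphere.facet_pairing S (r S) k (\<phi> is))\<^sup>2)"
          by (rule sum.cong) (use hsq assms(18) in auto)
        also have "\<dots> \<le> real s / (l * lam) * (M1\<^sup>2 * (fact (n + 1) / fact (k + 2) * real (card (simplices n X))))"
        proof (rule sum_facet_pairings_le[OF X k1 assms(3,6,13) lam finA _ l weight])
          show "S \<subseteq> X \<and> polytope_sphere S (r S) k \<and> card (simplices k S) \<le> s" if "S \<in> A" for S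
            using that AS(1) sphA facets_s by blast
          show "\<phi> is \<in> cochains k X" for "is" unfolding \<phi>_def by (rule antisymmetric_extension_cochain)
          show "polytope_sphere (simplex_boundary \<sigma>) (r (simplex_boundary \<sigma>)) k \<and>
            (\<Sum>is\<in>I. (polytope_sphere.facet_pairing (simplex_boundary \<sigma>) (r (simplex_boundary \<sigma>)) k (\<phi> is))\<^sup>2) \<le> M1\<^sup>2"
            if "\<sigma> \<in> simplices (Suc k) X" for \<sigma>
          proof
            have \<sigma>: "\<sigma> \<in> simplices (k + 1) X" using that by simp
            show "polytope_sphere (simplex_boundary \<sigma>) (r (simplex_boundary \<sigma>)) k" by (rule sphT[OF \<sigma>])
            have S: "simplex_boundary \<sigma> \<in> \<S>" using \<sigma> assms(17,18) by blast
            have "g (simplex_boundary \<sigma>) \<le> 1" unfolding g_def using gallery_fill_simplex_boundary[OF \<sigma>] by simp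
            hence "M1 * g (simplex_boundary \<sigma>) \<le> M1 * 1" using M1pos by (intro mult_left_mono) auto
            hence "h (simplex_boundary \<sigma>) \<le> M1" using M1[OF S] by linarith
            hence "(h (simplex_boundary \<sigma>))\<^sup>2 \<le> M1\<^sup>2" by (intro power_mono h0)
            thus "(\<Sum>is\<in>I. (polytope_sphere.facet_pairing (simplex_boundary \<sigma>) (r (simplex_boundary \<sigma>)) k (\<phi> is))\<^sup>2) \<le> M1\<^sup>2"
              unfolding hsq[OF S] .
          qed
        qed
        finally show ?thesis .
      qed
      \<comment> \<open>The definition of R says that \<open>(D * k) powr ((s - 1) * (R + 1))\<close> is \<open>\<lfloor>card A / 2\<rfloor> / card (simplices k X) / 2 ^ s\<close>.\<close>
      have few: "12 * real (card {S \<in> A. 2 * g S < 3 * R}) \<le> real (card A)"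
      proof -
        let ?N = "{S \<in> A. 2 * g S < 3 * R}"
        let ?v = "real (card (simplices k X))" and ?m = "real_of_int \<lfloor>real (card A) / 2\<rfloor>" and ?a = "real (D * k)"
        have Dmax: "card {\<sigma> \<in> simplices (k + 1) X. \<tau> \<subseteq> \<sigma>} \<le> D" if "\<tau> \<in> simplices k X" for \<tau>
          unfolding assms(14) using Vfin that by (intro Max_ge) auto
        have cnt: "3 * real (card ?N) \<le> ?v * (2 * ?a powr (R + 1)) ^ (s - 1)"
        proof (rule card_small_filling_le[where r = r, OF X k1 assms(3,5) Dmax assms(16)])
          show "finite ?N" using finA by simp
          show "S \<subseteq> X \<and> polytope_sphere S (r S) k \<and> card (simplices k S) \<le> s" if "S \<in> ?N" for S
            using that AS(1) sphA facets_s by blast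
          show "2 * real (gallery_fill X k S) \<le> 3 * R" if "S \<in> ?N" for S using that by (simp add: g_def)
          show "0 \<le> R" using True by simp
        qed
        have a1: "?a > 1" using assms(16) by linarith
        have v0: "?v > 0" using Vne Vfin[of k] by (simp add: card_gt_0_iff)
        have "\<lfloor>real (card A) / 2\<rfloor> \<ge> 1" using assms(8) by simp
        hence m0: "?m \<ge> 1" by linarith
        have s1: "real s - 1 > 0" using assms(15) by simp
        have lna: "ln ?a > 0" using a1 by simp
        have "(R + 1) * ((real s - 1) * ln ?a) = ln (?m / ?v) - real s * ln 2"
          unfolding R_def using s1 lna by simp
        hence "exp ((R + 1) * ((real s - 1) * ln ?a)) = exp (ln (?m / ?v) - real s * ln 2)" by simp
        also have "\<dots> = (?m / ?v) / 2 ^ s"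
          using m0 v0 by (simp add: exp_diff ln_realpow[symmetric] del: ln_realpow)
        also have "exp ((R + 1) * ((real s - 1) * ln ?a)) = (?a powr (R + 1)) ^ (s - 1)"
        proof -
          have "exp ((R + 1) * ((real s - 1) * ln x)) = (x powr (R + 1)) ^ (s - 1)" if "x > 0" for x :: real
            using that assms(15) by (simp add: powr_def exp_of_nat_mult[symmetric] of_nat_diff mult_ac)
          thus ?thesis using a1 by (meson less_trans zero_less_one)
        qed
        finally have pw: "(?a powr (R + 1)) ^ (s - 1) = (?m / ?v) / 2 ^ s" .
        have two: "(2::real) ^ s = 2 * 2 ^ (s - 1)" using assms(15) by (cases s) auto
        have "?v * (2 * ?a powr (R + 1)) ^ (s - 1) = ?v * (2 ^ (s - 1) * ((?m / ?v) / 2 ^ s))"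
          unfolding power_mult_distrib pw ..
        also have "\<dots> = ?m / 2" unfolding two using v0 by simp
        also have "\<dots> \<le> real (card A) / 4" by linarith
        finally show ?thesis using cnt by linarith
      qed
      have "2 * R\<^sup>2 * real (card A) \<le> (\<Sum>S\<in>A. (g S)\<^sup>2)"
        by (rule sum_squares_fill_ge[OF finA _ few]) (use True in linarith)
      also have "\<dots> \<le> (\<Sum>S\<in>A. M2\<^sup>2 * (h S)\<^sup>2)"
      proof (rule sum_mono)
        fix S assume "S \<in> A"
        hence S: "S \<in> \<S>" using assms(18) by blast
        have "(g S)\<^sup>2 \<le> (M2 * h S)\<^sup>2" using M2[OF S] g1[OF S] by (intro power_mono) auto
        thus "(g S)\<^sup>2 \<le> M2\<^sup>2 * (h S)\<^sup>2" by (simp add: power_mult_distrib)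
      qed
      also have "\<dots> = M2\<^sup>2 * (\<Sum>S\<in>A. (h S)\<^sup>2)" by (rule sum_distrib_left[symmetric])
      also have "\<dots> \<le> M2\<^sup>2 * (real s / (l * lam) * (M1\<^sup>2 * (fact (n + 1) / fact (k + 2) * real (card (simplices n X)))))"
        by (rule mult_left_mono[OF energy]) simp
      also have "\<dots> = (M1 * M2)\<^sup>2 * Q * (2 * real (card A))"
        unfolding Q_def using neA finA l lam by (simp add: field_simps power_mult_distrib del: fact_Suc)
      finally have "R\<^sup>2 * (2 * real (card A)) \<le> (M1 * M2)\<^sup>2 * Q * (2 * real (card A))" by (simp add: mult_ac)
      hence "R\<^sup>2 \<le> (M1 * M2)\<^sup>2 * Q" using assms(8) by (simp add: mult_le_cancel_right)
      hence "R\<^sup>2 \<le> (M1 * M2 * sqrt Q)\<^sup>2" using Q by (simp add: power_mult_distrib)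
      moreover have "0 \<le> M1 * M2 * sqrt Q" using M1pos M2pos Q by simp
      ultimately have "R \<le> M1 * M2 * sqrt Q" by (rule power2_le_imp_le)
      moreover have "sqrt Q > 0" using Q by simp
      ultimately have "R * inverse (sqrt Q) \<le> M1 * M2" by (simp add: divide_inverse[symmetric] pos_divide_le_eq)
      thus ?thesis unfolding dist R_def Q_def by simp
    qed
  qed
qed

end
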